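(* Let $W$ and $W'$ be non-trivial complementary subspaces of $V$, i.e. $W\oplus W'=V$. Let $M$ and $M'$ be lattices of full rank in $W$ and $W'$, respectively. Then the vertices $\{M+\pi^kM'\}$ of $X$, for all $k\in\mathbb{Z}$, define a combinatorial geodesic connecting $W$ and $W'$ (i.e. they are exactly the vertices of such a geodesic, which is unique up to reparametrization). In fact, this induces a bijection between the set of pairs of lattice classes $(\{M\},\{M'\})$ with $M\subset W$ and $M'\subset W'$ full rank lattices and the set of combinatorial geodesics connecting $W$ and $W'$ (up to reparametrization).
   Context: $K$ is a finite extension of $\mathbb{Q}_p$ with valuation ring $R$ and prime element $\pi$; $V$ is an $n$-dimensional $K$-vector space. A (full rank) lattice in a finite-dimensional $K$-vector space $U$ is an $R$-submodule generated by a $K$-basis of $U$; $\{M\}$ denotes the class of the lattice $M$ up to multiplication by $K^\times$. $X$ is the Bruhat-Tits building of $G=PGL(V)$. Its vertices are the classes $\{M\}$ of lattices in $V$. Two different classes are adjacent if they have representatives $M,N$ with $\pi N\subset M\subset N$; simplices are the sets of pairwise adjacent classes, and $X$ is the geometric realization. For a basis $w_1,\dots,w_n$ of $V$, the vertices $\{\sum_i\pi^{k_i}Rw_i\}$, $k_i\in\mathbb{Z}$, span an apartment, identified with $\mathbb{R}^n/\mathbb{R}(1,\dots,1)$ by sending $\{\sum_i\pi^{k_i}Rw_i\}$ to the class of $(-k_1,\dots,-k_n)$. $X$ carries the $G$-invariant metric $d$ which on each apartment is the Euclidean metric of a fixed $S_n$-invariant scalar product. A geodesic (half-geodesic) is an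 isometric map $\mathbb{R}\to X$ (resp. $\mathbb{R}_{\ge0}\to X$) with respect to $d$. $X_\infty$ is the boundary of $X$ in the Borel-Serre compactification; its points are the classes of half-geodesics modulo being at bounded distance, and it is the geometric realization of the Tits building of $G$ (the flag complex of $V$). For a subspace $0\ne W\subsetneq V$, $y_W\in X_\infty$ is the corresponding vertex, i.e. the unique boundary point whose stabilizer in $G$ is the stabilizer of $W$. A geodesic connects $W$ and $W'$ if it converges to $y_W$ at one end and to $y_{W'}$ at the other. A geodesic is combinatorial if it consists of $1$-simplices and their vertices. *)

theory Defs
  imports
    "HOL-Analysis.Abstract_Metric_Spaces"
    "HOL-Computational_Algebra.Primes"
    "HOL-Combinatorics.Permutations"
begin

section \<open>Finite extensions of the field of p-adic numbers\<close>

definition padic_abs :: "nat \<Rightarrow> rat \<Rightarrow> real" where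
  "padic_abs p q =
    (if q = 0 then 0
     else real p powi (int (multiplicity (int p) (snd (quotient_of q)))
                       - int (multiplicity (int p) (fst (quotient_of q)))))"

definition padic_Cauchy :: "nat \<Rightarrow> (nat \<Rightarrow> rat) \<Rightarrow> bool" where
  "padic_Cauchy p s \<longleftrightarrow> (\<forall>e>0. \<exists>N. \<forall>m\<ge>N. \<forall>n\<ge>N. padic_abs p (s m - s n) < e)"

text \<open>
  The field \<open>K\<close> is the type \<open>'k\<close>, and \<open>nv\<close> is the unique extension to \<open>K\<close> of the p-adic
  absolute value. The copy of the p-adic numbers inside \<open>K\<close> is the completion of the rationals:
  the set of limits in \<open>K\<close> of rational sequences, where every p-adic Cauchy sequence of rationals
  is required to have such a limit.
\<close>

definition padic_numbers :: "('k::field_char_0 \<Rightarrow> real) \<Rightarrow> 'k set" where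
  "padic_numbers nv = {x. \<exists>s. (\<lambda>i. nv (x - of_rat (s i))) \<longlonglongrightarrow> 0}"

locale padic_field =
  fixes p :: nat and nv :: "'k::field_char_0 \<Rightarrow> real"
  assumes prime_p: "prime p"
    and nv_nonneg: "nv x \<ge> 0"
    and nv_eq_0_iff: "nv x = 0 \<longleftrightarrow> x = 0"
    and nv_mult: "nv (x * y) = nv x * nv y"
    and nv_ultrametric: "nv (x + y) \<le> max (nv x) (nv y)"
    and nv_of_rat: "nv (of_rat q) = padic_abs p q"
    and rat_Cauchy_converges:
      "padic_Cauchy p s \<Longrightarrow> \<exists>x. (\<lambda>i. nv (x - of_rat (s i))) \<longlonglongrightarrow> 0"
    and finite_extension:
      "\<exists>B. finite B \<and> (\<forall>x. \<exists>c. (\<forall>b\<in>B. c b \<in> padic_numbers nv) \<and> x = (\<Sum>b\<in>B. c b * b))"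
begin

definition valuation_ring :: "'k set" where
  "valuation_ring = {x. nv x \<le> 1}"

definition prime_element :: "'k \<Rightarrow> bool" where
  "prime_element \<pi> \<longleftrightarrow> {x. nv x < 1} = {\<pi> * a | a. a \<in> valuation_ring}"

end


section \<open>The building\<close>

text \<open>
  The vector space \<open>V\<close> is the whole type \<open>'v\<close>. A class of lattices is an element of
  \<open>'v set set\<close>; a point of the geometric realization is given by its barycentric coordinates,
  a function \<open>'v set set \<Rightarrow> real\<close>.
\<close>

locale padic_vector_space = padic_field p nv + vector_space scale
  for p :: nat and nv :: "'k::field_char_0 \<Rightarrow> real"
    and scale :: "'k \<Rightarrow> 'v::ab_group_add \<Rightarrow> 'v" +
  fixes \<pi> :: 'k
  assumes prime_element: "prime_element \<pi>"
    and finite_dimensional: "\<exists>B. finite B \<and> span B = UNIV"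
begin

definition lattice_in :: "'v set \<Rightarrow> 'v set \<Rightarrow> bool" where
  "lattice_in U M \<longleftrightarrow>
    (\<exists>B. finite B \<and> independent B \<and> span B = U \<and>
         M = {(\<Sum>b\<in>B. scale (c b) b) | c. \<forall>b\<in>B. c b \<in> valuation_ring})"

definition lattice_class :: "'v set \<Rightarrow> 'v set set" where
  "lattice_class M = {scale c ` M | c. c \<noteq> 0}"

definition lattice_classes_in :: "'v set \<Rightarrow> 'v set set set" where
  "lattice_classes_in U = {lattice_class M | M. lattice_in U M}"

definition adjacent :: "'v set set \<Rightarrow> 'v set set \<Rightarrow> bool" where
  "adjacent x y \<longleftrightarrow> x \<noteq> y \<and> (\<exists>M\<in>x. \<exists>N\<in>y. scale \<pi> ` N \<subseteq> M \<and> M \<subseteq> N)"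

definition simplices :: "'v set set set set" where
  "simplices = {\<sigma>. finite \<sigma> \<and> \<sigma> \<noteq> {} \<and> \<sigma> \<subseteq> lattice_classes_in UNIV \<and>
                    (\<forall>x\<in>\<sigma>. \<forall>y\<in>\<sigma>. x \<noteq> y \<longrightarrow> adjacent x y)}"

definition supp :: "('v set set \<Rightarrow> real) \<Rightarrow> 'v set set set" where
  "supp f = {x. f x \<noteq> 0}"

definition points :: "('v set set \<Rightarrow> real) set" where
  "points = {f. supp f \<in> simplices \<and> (\<forall>x. f x \<ge> 0) \<and> (\<Sum>x\<in>supp f. f x) = 1}"

definition vertex_point :: "'v set set \<Rightarrow> 'v set set \<Rightarrow> real" where
  "vertex_point x = (\<lambda>y. if y = x then 1 else 0)"

definition closed_simplex :: "'v set set set \<Rightarrow> ('v set set \<Rightarrow> real) set" where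
  "closed_simplex \<sigma> = {f \<in> points. supp f \<subseteq> \<sigma>}"

text \<open>
  The group \<open>G\<close> is the quotient of \<open>GL\<close> below by the scalars. These act trivially on lattice
  classes and stabilize all subspaces, so all notions concerning \<open>G\<close> are expressed through the
  action of \<open>GL\<close>.
\<close>

definition GL :: "('v \<Rightarrow> 'v) set" where
  "GL = {g. Vector_Spaces.linear scale scale g \<and> bij g}"

definition act :: "('v \<Rightarrow> 'v) \<Rightarrow> ('v set set \<Rightarrow> real) \<Rightarrow> ('v set set \<Rightarrow> real)" where
  "act g f = (\<lambda>x. f ((`) (inv g) ` x))"


subsection \<open>Apartments and the metric\<close>

definition is_basis :: "(nat \<Rightarrow> 'v) \<Rightarrow> bool" where
  "is_basis w \<longleftrightarrow> inj_on w {..<dim UNIV} \<and> independent (w ` {..<dim UNIV}) \<and>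
                  span (w ` {..<dim UNIV}) = UNIV"

definition basis_lattice :: "(nat \<Rightarrow> 'v) \<Rightarrow> (nat \<Rightarrow> int) \<Rightarrow> 'v set" where
  "basis_lattice w k =
    {(\<Sum>i<dim UNIV. scale (\<pi> powi k i * a i) (w i)) | a. \<forall>i<dim UNIV. a i \<in> valuation_ring}"

definition apartment :: "(nat \<Rightarrow> 'v) \<Rightarrow> ('v set set \<Rightarrow> real) set" where
  "apartment w = {f \<in> points. supp f \<subseteq> range (\<lambda>k. lattice_class (basis_lattice w k))}"

text \<open>
  A point of \<open>\<real>\<^sup>n/\<real>(1,\<dots>,1)\<close> is represented by a function \<open>nat \<Rightarrow> real\<close>; functions whose
  difference is constant on \<open>{..<n}\<close> represent the same point. The exponents \<open>k\<close> chosen in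
  \<open>apartment_coords\<close> are unique up to a constant, and so is the resulting convex combination.
\<close>

definition apartment_coords :: "(nat \<Rightarrow> 'v) \<Rightarrow> ('v set set \<Rightarrow> real) \<Rightarrow> nat \<Rightarrow> real" where
  "apartment_coords w f =
    (\<lambda>i. \<Sum>x\<in>supp f. f x * - of_int ((SOME k. x = lattice_class (basis_lattice w k)) i))"

end

text \<open>
  Scalar products on \<open>\<real>\<^sup>n/\<real>(1,\<dots>,1)\<close>, with the above representation of this quotient: positive
  semidefinite symmetric bilinear forms whose radical consists of the functions representing zero.
\<close>

definition invariant_scalar_product ::
  "nat \<Rightarrow> ((nat \<Rightarrow> real) \<Rightarrow> (nat \<Rightarrow> real) \<Rightarrow> real) \<Rightarrow> bool" where
  "invariant_scalar_product n ip \<longleftrightarrow>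
    (\<forall>x y z. ip (\<lambda>i. x i + y i) z = ip x z + ip y z) \<and>
    (\<forall>c x y. ip (\<lambda>i. c * x i) y = c * ip x y) \<and>
    (\<forall>x y. ip x y = ip y x) \<and>
    (\<forall>x. ip x x \<ge> 0) \<and>
    (\<forall>x. ip x x = 0 \<longleftrightarrow> (\<exists>c. \<forall>i<n. x i = c)) \<and>
    (\<forall>\<sigma> x y. \<sigma> permutes {..<n} \<longrightarrow> ip (x \<circ> \<sigma>) (y \<circ> \<sigma>) = ip x y)"

text \<open>
  Any two points of the building lie in a common apartment, so \<open>dist_apartment\<close> determines
  \<open>d\<close> on \<open>points\<close>.
\<close>

locale bruhat_tits_building = padic_vector_space p nv scale \<pi>
  for p :: nat and nv :: "'k::field_char_0 \<Rightarrow> real"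
    and scale :: "'k \<Rightarrow> 'v::ab_group_add \<Rightarrow> 'v" and \<pi> :: 'k +
  fixes ip :: "(nat \<Rightarrow> real) \<Rightarrow> (nat \<Rightarrow> real) \<Rightarrow> real"
    and d :: "('v set set \<Rightarrow> real) \<Rightarrow> ('v set set \<Rightarrow> real) \<Rightarrow> real"
  assumes scalar_product: "invariant_scalar_product (dim UNIV) ip"
    and metric: "Metric_space points d"
    and dist_invariant: "\<lbrakk>g \<in> GL; f \<in> points; h \<in> points\<rbrakk> \<Longrightarrow> d (act g f) (act g h) = d f h"
    and dist_apartment:
      "\<lbrakk>is_basis w; f \<in> apartment w; h \<in> apartment w\<rbrakk> \<Longrightarrow>
        d f h = (let \<delta> = (\<lambda>i. apartment_coords w f i - apartment_coords w h i)
                 in sqrt (ip \<delta> \<delta>))"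
begin

subsection \<open>Geodesics and the boundary\<close>

definition geodesic :: "(real \<Rightarrow> 'v set set \<Rightarrow> real) \<Rightarrow> bool" where
  "geodesic \<gamma> \<longleftrightarrow> (\<forall>t. \<gamma> t \<in> points) \<and> (\<forall>s t. d (\<gamma> s) (\<gamma> t) = \<bar>s - t\<bar>)"

text \<open>The values of a half-geodesic at negative arguments are irrelevant.\<close>

definition half_geodesic :: "(real \<Rightarrow> 'v set set \<Rightarrow> real) \<Rightarrow> bool" where
  "half_geodesic \<rho> \<longleftrightarrow>
    (\<forall>t\<ge>0. \<rho> t \<in> points) \<and> (\<forall>s\<ge>0. \<forall>t\<ge>0. d (\<rho> s) (\<rho> t) = \<bar>s - t\<bar>)"

definition asymptotic ::
  "((real \<Rightarrow> 'v set set \<Rightarrow> real) \<times> (real \<Rightarrow> 'v set set \<Rightarrow> real)) set" where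
  "asymptotic = {(\<rho>, \<rho>'). half_geodesic \<rho> \<and> half_geodesic \<rho>' \<and>
                           (\<exists>C. \<forall>t\<ge>0. d (\<rho> t) (\<rho>' t) \<le> C)}"

definition boundary :: "(real \<Rightarrow> 'v set set \<Rightarrow> real) set set" where
  "boundary = {\<rho>. half_geodesic \<rho>} // asymptotic"

definition endpoint :: "(real \<Rightarrow> 'v set set \<Rightarrow> real) \<Rightarrow> (real \<Rightarrow> 'v set set \<Rightarrow> real) set" where
  "endpoint \<rho> = asymptotic `` {\<rho>}"

definition act_boundary ::
  "('v \<Rightarrow> 'v) \<Rightarrow> (real \<Rightarrow> 'v set set \<Rightarrow> real) set \<Rightarrow> (real \<Rightarrow> 'v set set \<Rightarrow> real) set" where
  "act_boundary g \<eta> = (\<lambda>\<rho> t. act g (\<rho> t)) ` \<eta>"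

text \<open>
  \<open>boundary_vertex W \<eta>\<close> says that \<open>\<eta>\<close> is the point \<open>y\<^sub>W\<close>, which is the only boundary point
  with this stabilizer.
\<close>

definition boundary_vertex :: "'v set \<Rightarrow> (real \<Rightarrow> 'v set set \<Rightarrow> real) set \<Rightarrow> bool" where
  "boundary_vertex W \<eta> \<longleftrightarrow>
    \<eta> \<in> boundary \<and> {g \<in> GL. act_boundary g \<eta> = \<eta>} = {g \<in> GL. g ` W = W}"

definition connects :: "(real \<Rightarrow> 'v set set \<Rightarrow> real) \<Rightarrow> 'v set \<Rightarrow> 'v set \<Rightarrow> bool" where
  "connects \<gamma> W W' \<longleftrightarrow>
    (boundary_vertex W (endpoint \<gamma>) \<and> boundary_vertex W' (endpoint (\<lambda>t. \<gamma> (- t)))) \<or>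
    (boundary_vertex W' (endpoint \<gamma>) \<and> boundary_vertex W (endpoint (\<lambda>t. \<gamma> (- t))))"

definition combinatorial :: "(real \<Rightarrow> 'v set set \<Rightarrow> real) \<Rightarrow> bool" where
  "combinatorial \<gamma> \<longleftrightarrow>
    (\<exists>E \<subseteq> {\<sigma> \<in> simplices. card \<sigma> = 2}. range \<gamma> = (\<Union>\<sigma>\<in>E. closed_simplex \<sigma>))"

definition combinatorial_geodesics ::
  "'v set \<Rightarrow> 'v set \<Rightarrow> (real \<Rightarrow> 'v set set \<Rightarrow> real) set" where
  "combinatorial_geodesics W W' = {\<gamma>. geodesic \<gamma> \<and> combinatorial \<gamma> \<and> connects \<gamma> W W'}"

definition vertices_of :: "(real \<Rightarrow> 'v set set \<Rightarrow> real) \<Rightarrow> 'v set set set" where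
  "vertices_of \<gamma> = {x \<in> lattice_classes_in UNIV. vertex_point x \<in> range \<gamma>}"

definition joining_vertex :: "'v set \<Rightarrow> 'v set \<Rightarrow> int \<Rightarrow> 'v set set" where
  "joining_vertex M M' k = lattice_class {m + scale (\<pi> powi k) m' | m m'. m \<in> M \<and> m' \<in> M'}"

definition reparametrization ::
  "((real \<Rightarrow> 'v set set \<Rightarrow> real) \<times> (real \<Rightarrow> 'v set set \<Rightarrow> real)) set" where
  "reparametrization =
    {(\<gamma>, \<gamma>'). \<exists>\<phi>::real \<Rightarrow> real. (\<forall>s t. \<bar>\<phi> s - \<phi> t\<bar> = \<bar>s - t\<bar>) \<and> \<gamma>' = \<gamma> \<circ> \<phi>}"

end

end

theory Submission
  imports Defs
begin

text \<open>
  For lattices \<open>M\<close> in \<open>W\<close> and \<open>M'\<close> in \<open>W'\<close> put \<open>L\<^sub>k = M + \<pi>\<^sup>k M'\<close>. A basis of \<open>V\<close> composed of bases of \<open>M\<close>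
  and \<open>M'\<close> spans an apartment in which the classes of the \<open>L\<^sub>k\<close> are equidistant points on a line, so
  the edges between consecutive classes form a geodesic. To see that its forward end is \<open>y\<^sub>W\<close>, note that
  an element \<open>g\<close> of \<open>GL\<close> fixes the end if and only if the classes of \<open>g L\<^sub>k\<close> and \<open>L\<^sub>k\<close> stay at
  bounded distance for \<open>k \<ge> 0\<close>. Distances of classes measure inclusions up to powers of \<open>\<pi>\<close>, and
  such inclusions hold uniformly exactly for \<open>g W = W\<close>: the parts of the \<open>L\<^sub>k\<close> in \<open>W\<close> are constant
  while those in \<open>W'\<close> shrink. This is lemma \<open>joining_geodesic_exists\<close>.

  Conversely, a combinatorial geodesic is a bi-infinite path of edges. Suitable representatives of its
  vertices form a chain of lattices \<open>N\<^sub>k\<close> with \<open>\<pi> N\<^sub>k \<subset> N\<^sub>k\<^sub>+\<^sub>1 \<subset> N\<^sub>k\<close>. Two consecutive edges lie in a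
  common apartment, and equality in the triangle inequality for the three vertices means
  \<open>N\<^sub>k = N\<^sub>k\<^sub>+\<^sub>1 + \<pi> N\<^sub>k\<^sub>-\<^sub>1\<close> (lemma \<open>straight_edges\<close>). By iteration
  \<open>N\<^sub>k = N\<^sub>k\<^sub>+\<^sub>a + \<pi>\<^sup>b N\<^sub>k\<^sub>-\<^sub>b\<close> for all \<open>a, b \<ge> 0\<close>.

  It remains to see that the chain splits along \<open>V = W \<oplus> W'\<close>, and here the ends enter. If \<open>\<epsilon>\<close> is an
  idempotent endomorphism with \<open>\<epsilon> W \<subseteq> W\<close>, then the involution \<open>1 - 2 \<epsilon>\<close> stabilizes \<open>W\<close>, so it moves the
  geodesic boundedly at the end \<open>y\<^sub>W\<close>; hence \<open>\<epsilon> N\<^sub>k \<subseteq> \<pi>\<^sup>-\<^sup>C N\<^sub>k\<close> with the same \<open>C\<close> for all \<open>k \<ge> 0\<close>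
  (lemma \<open>idempotent_bound\<close>). The matrix units that read off a coordinate belonging to \<open>W'\<close> are
  differences of such idempotents. A vector of \<open>N\<^sub>k\<close> with a large coordinate in \<open>W'\<close> would therefore
  produce a large multiple of all of \<open>N\<^sub>0\<close> inside \<open>N\<^sub>k\<close>, which a straight chain does not allow. So the
  \<open>W'\<close>-coordinates on \<open>N\<^sub>k\<close> are \<open>O(\<pi>\<^sup>k)\<close> for \<open>k \<ge> 0\<close>, and likewise for \<open>W\<close> at the other end. Inserting
  this into \<open>N\<^sub>k = N\<^sub>k\<^sub>+\<^sub>a + \<pi>\<^sup>a N\<^sub>k\<^sub>-\<^sub>a\<close> for large \<open>a\<close> shows that the projection to \<open>W\<close> maps \<open>N\<^sub>k\<close> into every
  \<open>N\<^sub>l\<close>, and therefore \<open>N\<^sub>k = M + \<pi>\<^sup>k M'\<close> for \<open>M\<close> the intersection of \<open>W\<close> with all \<open>N\<^sub>l\<close> and \<open>M'\<close> that of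
  \<open>W'\<close> with all \<open>\<pi>\<^sup>-\<^sup>l N\<^sub>l\<close> (lemma \<open>oriented_structure\<close>).

  The vertices determine the classes of \<open>M\<close> and \<open>M'\<close>, since \<open>M\<close> and a multiple of \<open>M'\<close> are the
  intersections of \<open>L\<^sub>k\<close> with \<open>W\<close> and \<open>W'\<close>. They also determine the image of the geodesic, and two
  geodesics with the same image differ by an isometry of the real line.
\<close>

section \<open>Valuations and lattices\<close>

context padic_field begin

lemma nv_0 [simp]: "nv 0 = 0" by (simp add: nv_eq_0_iff)

lemma nv_1 [simp]: "nv 1 = 1"
  using nv_mult[of 1 1] nv_eq_0_iff[of 1] by simp

lemma nv_pos: "x \<noteq> 0 \<Longrightarrow> 0 < nv x"
  using nv_nonneg[of x] nv_eq_0_iff[of x] by linarith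

lemma nv_uminus [simp]: "nv (- x) = nv x"
proof -
  have "nv (-1) * nv (-1) = 1" using nv_mult[of "-1" "-1"] by simp
  then have "nv (-1) = 1" using nv_nonneg[of "-1"]
    by (simp add: square_eq_1_iff)
  then show ?thesis using nv_mult[of "-1" x] by simp
qed

lemma nv_add_le: "nv x \<le> r \<Longrightarrow> nv y \<le> r \<Longrightarrow> nv (x + y) \<le> r"
  using nv_ultrametric[of x y] by simp

lemma nv_sum_le:
  assumes "\<And>a. a \<in> A \<Longrightarrow> nv (f a) \<le> r" "0 \<le> r"
  shows "nv (sum f A) \<le> r"
  using assms by (induction A rule: infinite_finite_induct) (auto intro: nv_add_le)

lemma nv_inverse: "nv (inverse x) = inverse (nv x)"
proof (cases "x = 0")
  case False
  then have "nv x * nv (inverse x) = 1" using nv_mult[of x "inverse x"] by simp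
  then show ?thesis by (rule inverse_unique[symmetric])
qed simp

lemma nv_divide: "nv (x / y) = nv x / nv y"
  by (simp add: divide_inverse nv_mult nv_inverse)

lemma nv_power: "nv (x ^ n) = nv x ^ n"
  by (induction n) (auto simp: nv_mult)

lemma nv_power_int: "nv (x powi k) = nv x powi k"
  by (simp add: power_int_def nv_power nv_inverse)

lemma nv_p_less_1: "nv (of_nat p) < 1"
proof -
  have "p > 1" using prime_p prime_gt_1_nat by blast
  have "multiplicity (int p) (int p) = 1" using \<open>p > 1\<close>
    by (intro multiplicity_self) auto
  moreover have "quotient_of (of_int (int p)) = (int p, 1)"
    using quotient_of_int[of "int p"] unfolding Rat.of_int_def .
  ultimately have "padic_abs p (of_int (int p)) = real p powi (0 - 1)"
    using \<open>p > 1\<close> unfolding padic_abs_def by (simp only: fst_conv snd_conv) simp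
  also have "\<dots> = 1 / real p" by (simp add: power_int_minus divide_inverse)
  also have "\<dots> < 1" using \<open>p > 1\<close> by simp
  finally have "nv (of_rat (of_int (int p))) < 1" unfolding nv_of_rat .
  then show ?thesis by (simp only: of_rat_of_int_eq of_int_of_nat_eq of_rat_of_nat_eq)
qed

end

context padic_vector_space begin

notation scale (infixr "\<odot>" 75)

definition std_basis :: "'v set" where
  "std_basis = (SOME B. finite B \<and> independent B \<and> span B = UNIV)"

lemma std_basis: "finite std_basis" "independent std_basis" "span std_basis = UNIV"
proof -
  obtain B where B: "finite B" "span B = UNIV" using finite_dimensional by blast
  obtain C where "C \<subseteq> B" "independent C" "B \<subseteq> span C"
    using maximal_independent_subset by blast
  then have "finite C \<and> independent C \<and> span C = UNIV"
    using B by (metis finite_subset span_mono span_span top.extremum_uniqueI)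
  then have "finite std_basis \<and> independent std_basis \<and> span std_basis = UNIV"
    unfolding std_basis_def by (rule someI)
  then show "finite std_basis" "independent std_basis" "span std_basis = UNIV" by auto
qed

sublocale finite_dimensional_vector_space scale std_basis
  by unfold_locales (use std_basis in auto)

declare dim_UNIV [simp del]

abbreviation q :: real where "q \<equiv> nv \<pi>"

lemma q_less_1: "q < 1"
proof -
  have "1 \<in> valuation_ring" by (simp add: valuation_ring_def)
  then have "\<pi> \<in> {\<pi> * a |a. a \<in> valuation_ring}"
    by (intro CollectI exI[of _ 1]) simp
  also have "\<dots> = {x. nv x < 1}" using prime_element by (simp add: prime_element_def)
  finally show ?thesis by simp
qed

lemma nv_less_1_iff: "nv x < 1 \<longleftrightarrow> nv x \<le> q"
proof
  assume "nv x < 1"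
  then obtain a where "x = \<pi> * a" "nv a \<le> 1"
    using prime_element unfolding prime_element_def valuation_ring_def by blast
  then show "nv x \<le> q" using nv_nonneg[of \<pi>] by (simp add: nv_mult mult_left_le)
qed (use q_less_1 in simp)

lemma pi_nonzero [simp]: "\<pi> \<noteq> 0"
proof
  assume "\<pi> = 0"
  have "nv (of_nat p) \<le> q" by (rule iffD1[OF nv_less_1_iff nv_p_less_1])
  then have "nv (of_nat p) \<le> 0" unfolding \<open>\<pi> = 0\<close> nv_0 .
  moreover have "(of_nat p :: 'k) \<noteq> 0" using prime_gt_0_nat[OF prime_p] by simp
  ultimately show False using nv_pos[of "of_nat p"] by linarith
qed

lemma q_pos: "0 < q" by (simp add: nv_pos)

lemma q_nonzero [simp]: "q \<noteq> 0"
  using q_pos by simp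

lemma q_powi_pos [simp]: "0 < q powi k"
  using q_pos by (rule zero_less_power_int)

lemma q_powi_nonneg [simp]: "0 \<le> q powi k"
  using q_powi_pos by (rule less_imp_le)

lemma q_powi_less: "a < b \<Longrightarrow> q powi b < q powi a"
  by (rule power_int_strict_decreasing[OF _ q_pos q_less_1])

lemma q_powi_le_iff [simp]: "q powi a \<le> q powi b \<longleftrightarrow> b \<le> a"
proof (cases a b rule: linorder_cases)
  case less
  then show ?thesis using q_powi_less[OF less] by linarith
next
  case greater
  then show ?thesis using q_powi_less[OF greater] by linarith
qed simp

lemma nv_pi_powi: "nv (\<pi> powi k) = q powi k" by (rule nv_power_int)

lemma nv_value:
  assumes "x \<noteq> 0" obtains k where "nv x = q powi k"
proof -
  define S where "S = {k. nv x \<le> q powi k}"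
  obtain n where "q ^ n < nv x" using real_arch_pow_inv[OF nv_pos[OF assms] q_less_1] by blast
  then have up: "k < int n" if "k \<in> S" for k
    using that unfolding S_def
    by (metis (mono_tags, lifting) linorder_not_le mem_Collect_eq order.strict_trans1 power_int_of_nat
        q_powi_le_iff)
  obtain m where "(1/q) ^ m > nv x" using real_arch_pow[of "1/q"] q_pos q_less_1 by fastforce
  then have "- int m \<in> S" by (simp add: S_def power_int_minus field_simps power_divide)
  then obtain k where k: "k \<in> S" "\<forall>l\<in>S. l \<le> k"
  proof -
    define T where "T = S \<inter> {- int m..int n}"
    have "finite T" "- int m \<in> T" using \<open>- int m \<in> S\<close> up by (auto simp: T_def less_imp_le)
    moreover define k where "k = Max T"
    ultimately have "k \<in> T" "\<forall>l\<in>T. l \<le> k" using Max_in by auto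
    then have "k \<in> S" "\<forall>l\<in>S. l \<le> k" using up by (force simp: T_def)+
    then show ?thesis using that by blast
  qed
  have "\<not> nv x \<le> q powi (k + 1)" using k(2)[rule_format, of "k+1"] by (auto simp: S_def)
  then have "\<not> nv (x / \<pi> powi k) \<le> q" using q_pos
    by (simp add: nv_divide nv_pi_powi field_simps power_int_add)
  then have "\<not> nv (x / \<pi> powi k) < 1" by (simp add: nv_less_1_iff)
  moreover have "nv (x / \<pi> powi k) \<le> 1" using k(1) by (simp add: nv_divide nv_pi_powi S_def)
  ultimately have "nv x = q powi k" by (simp add: nv_divide nv_pi_powi)
  then show ?thesis by (rule that)
qed

text \<open>
  The norms of the nonzero elements are powers of \<open>q\<close>, so a bounded submodule of \<open>K\<close> contains an
  element of largest norm and consists of its integral multiples.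
\<close>

lemma fractional_ideal:
  assumes "I \<noteq> {0}" "I \<noteq> {}" "\<And>a c. a \<in> I \<Longrightarrow> nv c \<le> 1 \<Longrightarrow> c * a \<in> I" "\<And>a. a \<in> I \<Longrightarrow> nv a \<le> r"
  obtains k where "I = {a. nv a \<le> q powi k}"
proof -
  define S where "S = {k. \<exists>a\<in>I. a \<noteq> 0 \<and> nv a = q powi k}"
  obtain a where a: "a \<in> I" "a \<noteq> 0" using assms by blast
  obtain k0 where k0: "nv a = q powi k0" using nv_value[OF a(2)] by blast
  have k0S: "k0 \<in> S" using a k0 by (auto simp: S_def)
  obtain m where m: "(1/q) ^ m > r" using real_arch_pow[of "1/q"] q_pos q_less_1 by fastforce
  have lo: "- int m \<le> k" if "k \<in> S" for k
  proof -
    have "q powi k \<le> r" using that assms(4) by (force simp: S_def)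
    also have "r < q powi (- int m)" using m by (simp add: power_int_minus field_simps power_divide)
    finally have "q powi k < q powi (- int m)" .
    then show ?thesis by (metis less_imp_le q_powi_le_iff)
  qed
  obtain k where k: "k \<in> S" "\<forall>l\<in>S. k \<le> l"
  proof -
    define T where "T = S \<inter> {- int m..k0}"
    have "finite T" "k0 \<in> T" using k0S lo by (auto simp: T_def)
    moreover define k where "k = Min T"
    ultimately have "k \<in> T" "\<forall>l\<in>T. k \<le> l" using Min_in by auto
    then have "k \<in> S" "\<forall>l\<in>S. k \<le> l" using lo by (force simp: T_def)+
    then show ?thesis using that by blast
  qed
  obtain b where b: "b \<in> I" "b \<noteq> 0" "nv b = q powi k" using k by (auto simp: S_def)
  have "I = {a. nv a \<le> q powi k}"
  proof (intro set_eqI iffI)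
    fix x assume x: "x \<in> I"
    show "x \<in> {a. nv a \<le> q powi k}"
    proof (cases "x = 0")
      case False
      then obtain l where "nv x = q powi l" using nv_value by blast
      then show ?thesis using k x False by (auto simp: S_def)
    qed simp
  next
    fix x assume "x \<in> {a. nv a \<le> q powi k}"
    then have "nv (x / b) \<le> 1" using b by (simp add: nv_divide)
    then have "x / b * b \<in> I" using assms(3) b by blast
    then show "x \<in> I" using b by simp
  qed
  then show ?thesis by (rule that)
qed

subsection \<open>Lattices as bounded spanning submodules\<close>

definition submodule :: "'v set \<Rightarrow> bool" where
  "submodule X \<longleftrightarrow> 0 \<in> X \<and> (\<forall>x\<in>X. \<forall>y\<in>X. x + y \<in> X) \<and> (\<forall>c x. nv c \<le> 1 \<longrightarrow> x \<in> X \<longrightarrow> c \<odot> x \<in> X)"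

text \<open>
  Boundedness does not depend on the basis used to measure it.
\<close>

definition nv_bounded :: "'v set \<Rightarrow> bool" where
  "nv_bounded X \<longleftrightarrow> (\<exists>r. \<forall>x\<in>X. \<forall>b\<in>std_basis. nv (representation std_basis x b) \<le> r)"

text \<open>
  This description of lattices passes to the kernel of a functional without a choice of basis, which
  makes induction on the dimension possible. A basis is recovered in \<open>lattice_has_basis\<close>.
\<close>

definition full_lattice :: "'v set \<Rightarrow> 'v set \<Rightarrow> bool" where
  "full_lattice U L \<longleftrightarrow> submodule L \<and> nv_bounded L \<and> span L = U"

definition functional :: "('v \<Rightarrow> 'k) \<Rightarrow> bool" where
  "functional \<phi> \<longleftrightarrow> (\<forall>x y. \<phi> (x + y) = \<phi> x + \<phi> y) \<and> (\<forall>c x. \<phi> (c \<odot> x) = c * \<phi> x)"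

text \<open>
  The lattice with basis \<open>\<pi>\<^sup>k\<^sup>(\<^sup>b\<^sup>) b\<close> for \<open>b \<in> S\<close>. Keeping \<open>S\<close> apart from the exponents allows several lattices
  to be described in one basis.
\<close>

definition box :: "'v set \<Rightarrow> ('v \<Rightarrow> int) \<Rightarrow> 'v set" where
  "box S k = {\<Sum>b\<in>S. c b \<odot> b |c. \<forall>b\<in>S. nv (c b) \<le> q powi k b}"

lemma submodule_0: "submodule X \<Longrightarrow> 0 \<in> X"
  and submodule_add: "submodule X \<Longrightarrow> x \<in> X \<Longrightarrow> y \<in> X \<Longrightarrow> x + y \<in> X"
  and submodule_scale: "submodule X \<Longrightarrow> nv c \<le> 1 \<Longrightarrow> x \<in> X \<Longrightarrow> c \<odot> x \<in> X"
  by (auto simp: submodule_def)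

lemma submodule_uminus: "submodule X \<Longrightarrow> x \<in> X \<Longrightarrow> - x \<in> X"
  using submodule_scale[of X "-1" x] by simp

lemma submodule_diff: "submodule X \<Longrightarrow> x \<in> X \<Longrightarrow> y \<in> X \<Longrightarrow> x - y \<in> X"
  using submodule_add[of X x "-y"] submodule_uminus[of X y] by simp

lemma submodule_sum: "submodule X \<Longrightarrow> (\<And>a. a \<in> A \<Longrightarrow> f a \<in> X) \<Longrightarrow> sum f A \<in> X"
  by (induction A rule: infinite_finite_induct) (auto intro: submodule_0 submodule_add)

lemma functional_add: "functional \<phi> \<Longrightarrow> \<phi> (x + y) = \<phi> x + \<phi> y"
  and functional_scale: "functional \<phi> \<Longrightarrow> \<phi> (c \<odot> x) = c * \<phi> x"
  by (auto simp: functional_def)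

lemma functional_0: "functional \<phi> \<Longrightarrow> \<phi> 0 = 0"
  using functional_scale[of \<phi> 0 0] by simp

lemma functional_diff: "functional \<phi> \<Longrightarrow> \<phi> (x - y) = \<phi> x - \<phi> y"
  using functional_add[of \<phi> "x - y" y] by simp

lemma functional_sum: "functional \<phi> \<Longrightarrow> \<phi> (sum f A) = (\<Sum>a\<in>A. \<phi> (f a))"
  by (induction A rule: infinite_finite_induct) (auto simp: functional_0 functional_add)

lemma functional_representation:
  "independent S \<Longrightarrow> span S = UNIV \<Longrightarrow> functional (\<lambda>x. representation S x b)"
  by (auto simp: functional_def representation_add representation_scale)

lemma functional_divide: "functional \<phi> \<Longrightarrow> functional (\<lambda>x. \<phi> x / c)"
  by (auto simp: functional_def add_divide_distrib)

lemma subspace_kernel: "functional \<phi> \<Longrightarrow> subspace {x. \<phi> x = 0}"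
  by (auto simp: subspace_def functional_add functional_scale functional_0)

lemma functional_bounded:
  assumes "functional \<phi>" "nv_bounded X"
  obtains r where "\<And>x. x \<in> X \<Longrightarrow> nv (\<phi> x) \<le> r"
proof -
  obtain r where r: "\<And>x b. x \<in> X \<Longrightarrow> b \<in> std_basis \<Longrightarrow> nv (representation std_basis x b) \<le> r"
    using assms(2) unfolding nv_bounded_def by blast
  define s where "s = (\<Sum>b\<in>std_basis. \<bar>r\<bar> * nv (\<phi> b))"
  have s: "0 \<le> s" unfolding s_def by (intro sum_nonneg mult_nonneg_nonneg) (auto simp: nv_nonneg)
  have "nv (\<phi> x) \<le> s" if x: "x \<in> X" for x
  proof -
    have "x = (\<Sum>b\<in>std_basis. representation std_basis x b \<odot> b)"
      using sum_representation_eq[OF std_basis(2), of x std_basis] std_basis by simp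
    then have "\<phi> x = (\<Sum>b\<in>std_basis. representation std_basis x b * \<phi> b)"
      using assms(1) by (metis (no_types, lifting) functional_scale functional_sum sum.cong)
    also have "nv \<dots> \<le> s"
    proof (intro nv_sum_le s)
      fix b assume b: "b \<in> std_basis"
      have "nv (representation std_basis x b * \<phi> b) \<le> \<bar>r\<bar> * nv (\<phi> b)"
        using r[OF x b] nv_nonneg[of "\<phi> b"] by (auto simp: nv_mult intro!: mult_right_mono)
      also have "\<dots> \<le> s" unfolding s_def
        by (rule member_le_sum[OF b]) (auto simp: nv_nonneg std_basis)
      finally show "nv (representation std_basis x b * \<phi> b) \<le> s" .
    qed
    finally show ?thesis .
  qed
  then show ?thesis by (rule that)
qed

lemma functional_image_lattice:
  assumes "full_lattice U L" "functional \<phi>" "w \<in> U" "\<phi> w \<noteq> 0"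
  obtains k where "\<phi> ` L = {a. nv a \<le> q powi k}"
proof -
  have sub: "submodule L" and bd: "nv_bounded L" and sp: "span L = U" using assms by (auto simp: full_lattice_def)
  obtain r where r: "\<And>x. x \<in> L \<Longrightarrow> nv (\<phi> x) \<le> r" using functional_bounded[OF assms(2) bd] by blast
  have "\<not> L \<subseteq> {x. \<phi> x = 0}"
    using span_minimal[OF _ subspace_kernel[OF assms(2)]] sp assms(3,4) by blast
  then have nz: "\<phi> ` L \<noteq> {0}" by auto
  have ne: "\<phi> ` L \<noteq> {}" using submodule_0[OF sub] by auto
  have closed: "c * a \<in> \<phi> ` L" if "a \<in> \<phi> ` L" "nv c \<le> 1" for a c
  proof -
    from that(1) obtain x where "x \<in> L" "a = \<phi> x" by blast
    then show ?thesis using submodule_scale[OF sub that(2)] functional_scale[OF assms(2), of c x]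
      by (intro image_eqI[of _ _ "c \<odot> x"]) auto
  qed
  have "nv a \<le> r" if "a \<in> \<phi> ` L" for a using that r by auto
  from fractional_ideal[OF nz ne closed this] that show ?thesis by blast
qed

text \<open>
  The map \<open>x \<mapsto> x - \<phi> x w\<close> projects \<open>U\<close> onto the kernel of \<open>\<phi>\<close> and preserves \<open>L\<close>, so the kernel is
  spanned by its intersection with \<open>L\<close>.
\<close>

lemma full_lattice_kernel:
  assumes "full_lattice U L" "functional \<phi>" "\<phi> w = 1" "\<And>x. x \<in> L \<Longrightarrow> \<phi> x \<odot> w \<in> L" "w \<in> U"
  shows "full_lattice (U \<inter> {x. \<phi> x = 0}) (L \<inter> {x. \<phi> x = 0})"
proof -
  have sub: "submodule L" and bd: "nv_bounded L" and sp: "span L = U" using assms by (auto simp: full_lattice_def)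
  define P where "P = (\<lambda>x. x - \<phi> x \<odot> w)"
  have P: "P (x + y) = P x + P y" "P (c \<odot> x) = c \<odot> P x" "\<phi> (P x) = 0" for x y c
    using assms(2,3)
    by (auto simp: P_def functional_add functional_scale functional_diff algebra_simps)
  have PL: "P x \<in> L \<inter> {x. \<phi> x = 0}" if "x \<in> L" for x
    using that P(3) assms(4) submodule_diff[OF sub] by (auto simp: P_def)
  have "P x \<in> span (L \<inter> {x. \<phi> x = 0})" if "x \<in> span L" for x
    using that
  proof (induction rule: span_induct_alt)
    case base
    then show ?case using P(2)[of 0 0] by (simp add: span_zero)
  next
    case (step c x y)
    then show ?case using PL[of x] by (auto simp: P intro!: span_add span_scale intro: span_base)
  qed
  then have "U \<inter> {x. \<phi> x = 0} \<subseteq> span (L \<inter> {x. \<phi> x = 0})"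
    using sp by (force simp: P_def)
  moreover have "span (L \<inter> {x. \<phi> x = 0}) \<subseteq> U \<inter> {x. \<phi> x = 0}"
    using sp subspace_kernel[OF assms(2)] by (metis (no_types, lifting) Int_mono span_superset
      order_refl span_minimal subspace_inter subspace_span)
  moreover have "submodule (L \<inter> {x. \<phi> x = 0})"
    using sub assms(2) by (auto simp: submodule_def functional_add functional_scale functional_0)
  moreover have "nv_bounded (L \<inter> {x. \<phi> x = 0})" using bd by (auto simp: nv_bounded_def)
  ultimately show ?thesis by (auto simp: full_lattice_def)
qed

lemma mem_box_iff:
  assumes "finite S" "independent S"
  shows "x \<in> box S k \<longleftrightarrow> x \<in> span S \<and> (\<forall>b\<in>S. nv (representation S x b) \<le> q powi k b)"
proof
  assume "x \<in> box S k"
  then obtain c where c: "x = (\<Sum>b\<in>S. c b \<odot> b)" "\<forall>b\<in>S. nv (c b) \<le> q powi k b"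
    by (auto simp: box_def)
  have sp: "x \<in> span S" unfolding c by (intro span_sum span_scale span_base)
  have "representation S x b = c b" if b: "b \<in> S" for b
  proof -
    have "representation S x = (\<lambda>b. if b \<in> S then c b else 0)"
    proof (rule representation_eqI[OF assms(2) sp])
      have "{b. (if b \<in> S then c b else 0) \<noteq> 0} \<subseteq> S" by auto
      then show "finite {b. (if b \<in> S then c b else 0) \<noteq> 0}"
        using assms(1) finite_subset by blast
      show "(\<Sum>b | (if b \<in> S then c b else 0) \<noteq> 0. (if b \<in> S then c b else 0) \<odot> b) = x"
        unfolding c(1) by (rule sum.mono_neutral_cong_left) (use assms(1) in \<open>auto split: if_splits\<close>)
    qed (auto split: if_splits)
    then show ?thesis using b by simp
  qed
  then show "x \<in> span S \<and> (\<forall>b\<in>S. nv (representation S x b) \<le> q powi k b)"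
    using c sp by auto
next
  assume *: "x \<in> span S \<and> (\<forall>b\<in>S. nv (representation S x b) \<le> q powi k b)"
  then have "x = (\<Sum>b\<in>S. representation S x b \<odot> b)"
    using sum_representation_eq[OF assms(2), of x S] assms(1) by simp
  then show "x \<in> box S k" using * by (auto simp: box_def)
qed

text \<open>
  If all lattices of a family split off the same vector \<open>w\<close> along the same functional \<open>\<phi>\<close>, what remains
  is a family of lattices in the kernel of \<open>\<phi>\<close>. The predicate \<open>P\<close> describes the families to which this
  step applies again.
\<close>

lemma common_basis_induct:
  fixes X :: "'i \<Rightarrow> 'v set"
  assumes full_lattice: "\<And>U (X :: 'i \<Rightarrow> 'v set) i. P U X \<Longrightarrow> full_lattice U (X i)"
    and split: "\<And>U (X :: 'i \<Rightarrow> 'v set). P U X \<Longrightarrow> U \<noteq> {0} \<Longrightarrow>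
      \<exists>w \<phi>. functional \<phi> \<and> w \<in> U \<and> \<phi> w = 1 \<and> (\<forall>i. \<forall>x\<in>X i. \<phi> x \<odot> w \<in> X i) \<and>
            P (U \<inter> {x. \<phi> x = 0}) (\<lambda>i. X i \<inter> {x. \<phi> x = 0})"
    and "P U X"
  shows "\<exists>S k. finite S \<and> independent S \<and> span S = U \<and> (\<forall>i. X i = box S (k i))"
  using \<open>P U X\<close>
proof (induction "dim U" arbitrary: U X rule: less_induct)
  case less
  have latU: "full_lattice U (X i)" for i using full_lattice less.prems by blast
  then have U: "subspace U" unfolding full_lattice_def by (metis subspace_span)
  show ?case
  proof (cases "U = {0}")
    case True
    have "X i = {0}" for i
      using latU[of i] True span_superset[of "X i"] submodule_0[of "X i"] unfolding full_lattice_def by auto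
    then show ?thesis using True by (intro exI[of _ "{}"]) (auto simp: box_def independent_empty)
  next
    case False
    then obtain w \<phi> where w: "functional \<phi>" "w \<in> U" "\<phi> w = 1" "\<And>i x. x \<in> X i \<Longrightarrow> \<phi> x \<odot> w \<in> X i"
        and P': "P (U \<inter> {x. \<phi> x = 0}) (\<lambda>i. X i \<inter> {x. \<phi> x = 0})"
      using split[OF less.prems] by blast
    let ?U = "U \<inter> {x. \<phi> x = 0}"
    have subU: "subspace ?U" using U subspace_kernel[OF w(1)] by (rule subspace_inter)
    have "w \<notin> ?U" using w(3) by simp
    then have "span ?U \<subset> span U" unfolding span_eq_iff[THEN iffD2, OF subU] span_eq_iff[THEN iffD2, OF U]
      using w(2) by blast
    then have "dim ?U < dim U" by (rule dim_psubset)
    from less.hyps[OF this P'] obtain S k where S: "finite S" "independent S" "span S = ?U"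
        and k: "\<And>i. X i \<inter> {x. \<phi> x = 0} = box S (k i)" by blast
    have "\<exists>e. \<phi> ` X i = {a. nv a \<le> q powi e}" for i
      using functional_image_lattice[OF latU[of i] w(1,2)] w(3) by (metis zero_neq_one)
    then obtain e where e: "\<And>i. \<phi> ` X i = {a. nv a \<le> q powi e i}" by metis
    have wS: "w \<notin> span S" "w \<notin> S" using S(3) w(3) span_base[of w S] by auto
    have "span (insert w S) = U"
    proof
      show "span (insert w S) \<subseteq> U"
        using S(3) w(2) span_superset[of S] by (intro span_minimal U) auto
      show "U \<subseteq> span (insert w S)"
      proof
        fix x assume x: "x \<in> U"
        have "x - \<phi> x \<odot> w \<in> span S" unfolding S(3) using x w U
          by (auto simp: functional_diff functional_scale intro: subspace_diff subspace_scale)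
        then show "x \<in> span (insert w S)" by (auto simp: span_insert)
      qed
    qed
    moreover have "X i = box (insert w S) ((k i)(w := e i))" for i
    proof
      have sub: "submodule (X i)" using latU by (auto simp: full_lattice_def)
      show "X i \<subseteq> box (insert w S) ((k i)(w := e i))"
      proof
        fix x assume x: "x \<in> X i"
        have "x - \<phi> x \<odot> w \<in> X i \<inter> {x. \<phi> x = 0}" using x w submodule_diff[OF sub]
          by (auto simp: functional_diff functional_scale)
        then obtain c where c: "x - \<phi> x \<odot> w = (\<Sum>b\<in>S. c b \<odot> b)" "\<forall>b\<in>S. nv (c b) \<le> q powi k i b"
          unfolding k box_def by blast
        have "x = (\<Sum>b\<in>insert w S. (c(w := \<phi> x)) b \<odot> b)"
        proof -
          have "(\<Sum>b\<in>S. (c(w := \<phi> x)) b \<odot> b) = (\<Sum>b\<in>S. c b \<odot> b)"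
            using wS by (intro sum.cong) auto
          then show ?thesis using S(1) wS c(1) by (simp add: algebra_simps)
        qed
        moreover have "nv (\<phi> x) \<le> q powi e i" using e[of i] x by blast
        then have "\<forall>b\<in>insert w S. nv ((c(w := \<phi> x)) b) \<le> q powi ((k i)(w := e i)) b"
          using c(2) by auto
        ultimately show "x \<in> box (insert w S) ((k i)(w := e i))" unfolding box_def by blast
      qed
      show "box (insert w S) ((k i)(w := e i)) \<subseteq> X i"
      proof
        fix x assume "x \<in> box (insert w S) ((k i)(w := e i))"
        then obtain c where c: "x = (\<Sum>b\<in>insert w S. c b \<odot> b)"
            "\<forall>b\<in>insert w S. nv (c b) \<le> q powi ((k i)(w := e i)) b"
          unfolding box_def by blast
        have "c w \<in> \<phi> ` X i" using c(2) e[of i] by auto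
        then have 1: "c w \<odot> w \<in> X i" using w(4) by auto
        have "\<forall>b\<in>S. nv (c b) \<le> q powi k i b" using c(2) wS by (metis fun_upd_other insertI2)
        then have "(\<Sum>b\<in>S. c b \<odot> b) \<in> box S (k i)" unfolding box_def by blast
        then have 2: "(\<Sum>b\<in>S. c b \<odot> b) \<in> X i" using k[of i] by blast
        show "x \<in> X i" using c(1) S(1) wS submodule_add[OF sub 1 2] by simp
      qed
    qed
    moreover have "independent (insert w S)" using S(2) wS by (simp add: independent_insert)
    ultimately show ?thesis using S(1) by (intro exI[of _ "insert w S"]) auto
  qed
qed

section \<open>Common bases of lattices\<close>

lemma box_subset_span: "box S k \<subseteq> span S"
  by (auto simp: box_def intro!: span_sum span_scale intro: span_base)

lemma submodule_box: "submodule (box S k)"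
  unfolding submodule_def
proof (intro conjI ballI allI impI)
  show "0 \<in> box S k" unfolding box_def by (rule CollectI, rule exI[of _ "\<lambda>_. 0"]) simp
next
  fix x y assume "x \<in> box S k" "y \<in> box S k"
  then obtain c e where "x = (\<Sum>b\<in>S. c b \<odot> b)" "\<forall>b\<in>S. nv (c b) \<le> q powi k b"
    "y = (\<Sum>b\<in>S. e b \<odot> b)" "\<forall>b\<in>S. nv (e b) \<le> q powi k b" by (auto simp: box_def)
  then have "x + y = (\<Sum>b\<in>S. (c b + e b) \<odot> b)" "\<forall>b\<in>S. nv (c b + e b) \<le> q powi k b"
    by (auto simp: scale_left_distrib sum.distrib intro: nv_add_le)
  then show "x + y \<in> box S k" unfolding box_def by (intro CollectI exI[of _ "\<lambda>b. c b + e b"]) simp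
next
  fix a x assume a: "nv a \<le> 1" and "x \<in> box S k"
  then obtain c where c: "x = (\<Sum>b\<in>S. c b \<odot> b)" "\<forall>b\<in>S. nv (c b) \<le> q powi k b" by (auto simp: box_def)
  have "a \<odot> x = (\<Sum>b\<in>S. (a * c b) \<odot> b)" unfolding c by (simp add: scale_sum_right)
  moreover have "\<forall>b\<in>S. nv (a * c b) \<le> q powi k b"
  proof
    fix b assume "b \<in> S"
    have "nv (a * c b) \<le> 1 * nv (c b)" unfolding nv_mult using a nv_nonneg by (intro mult_right_mono)
    then show "nv (a * c b) \<le> q powi k b" using c(2) \<open>b \<in> S\<close> by fastforce
  qed
  ultimately show "a \<odot> x \<in> box S k" unfolding box_def by (intro CollectI exI[of _ "\<lambda>b. a * c b"]) simp
qed

lemma scaled_basis_mem_box: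
  assumes "finite S" "b \<in> S" "k b \<le> j"
  shows "(\<pi> powi j) \<odot> b \<in> box S k"
proof -
  have "(\<pi> powi j) \<odot> b = (\<Sum>c\<in>S. (if c = b then \<pi> powi j else 0) \<odot> c)"
    using assms by (simp add: if_distrib[of "\<lambda>x. x \<odot> _"] sum.delta cong: if_cong)
  moreover have "\<forall>c\<in>S. nv (if c = b then \<pi> powi j else 0) \<le> q powi k c"
    using assms(3) by (simp add: nv_pi_powi)
  ultimately show ?thesis unfolding box_def by (intro CollectI exI[of _ "\<lambda>c. if c = b then \<pi> powi j else 0"]) simp
qed

lemma span_box:
  assumes "finite S"
  shows "span (box S k) = span S"
proof
  show "span (box S k) \<subseteq> span S" by (rule span_minimal[OF box_subset_span subspace_span])
  show "span S \<subseteq> span (box S k)"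
  proof (rule span_minimal[OF _ subspace_span], rule subsetI)
    fix b assume b: "b \<in> S"
    have "(\<pi> powi k b) \<odot> b \<in> box S k" using scaled_basis_mem_box[OF assms b] by simp
    then have "inverse (\<pi> powi k b) \<odot> ((\<pi> powi k b) \<odot> b) \<in> span (box S k)"
      by (intro span_scale span_base)
    then show "b \<in> span (box S k)" by (simp add: scale_scale)
  qed
qed

lemma nv_bounded_box:
  assumes "finite S"
  shows "nv_bounded (box S k)"
proof -
  define r where "r = (\<Sum>b\<in>S. \<Sum>a\<in>std_basis. q powi k b * nv (representation std_basis b a))"
  have r: "0 \<le> r" unfolding r_def by (intro sum_nonneg mult_nonneg_nonneg) (auto simp: nv_nonneg)
  have "nv (representation std_basis x a) \<le> r" if x: "x \<in> box S k" and a: "a \<in> std_basis" for x a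
  proof -
    let ?f = "\<lambda>x. representation std_basis x a"
    have f: "functional ?f" by (rule functional_representation[OF std_basis(2,3)])
    obtain c where c: "x = (\<Sum>b\<in>S. c b \<odot> b)" "\<forall>b\<in>S. nv (c b) \<le> q powi k b"
      using x by (auto simp: box_def)
    have "?f x = (\<Sum>b\<in>S. c b * ?f b)"
      unfolding c(1) functional_sum[OF f] functional_scale[OF f] ..
    also have "nv \<dots> \<le> r"
    proof (intro nv_sum_le r)
      fix b assume b: "b \<in> S"
      have "nv (c b * ?f b) \<le> q powi k b * nv (?f b)"
        unfolding nv_mult using c(2) b nv_nonneg by (intro mult_right_mono) auto
      also have "\<dots> \<le> (\<Sum>a\<in>std_basis. q powi k b * nv (representation std_basis b a))"
        by (rule member_le_sum[OF a]) (auto simp: nv_nonneg std_basis)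
      also have "\<dots> \<le> r" unfolding r_def
        by (rule member_le_sum[OF b]) (auto simp: assms nv_nonneg intro!: sum_nonneg)
      finally show "nv (c b * ?f b) \<le> r" .
    qed
    finally show ?thesis .
  qed
  then show ?thesis unfolding nv_bounded_def by blast
qed

lemma full_lattice_box: "finite S \<Longrightarrow> full_lattice (span S) (box S k)"
  by (simp add: full_lattice_def submodule_box nv_bounded_box span_box)

lemma box_subset_iff:
  assumes "finite S" "independent S"
  shows "box S k \<subseteq> box S l \<longleftrightarrow> (\<forall>b\<in>S. l b \<le> k b)"
proof
  assume sub: "box S k \<subseteq> box S l"
  show "\<forall>b\<in>S. l b \<le> k b"
  proof
    fix b assume b: "b \<in> S"
    have "(\<pi> powi k b) \<odot> b \<in> box S l" using scaled_basis_mem_box[OF assms(1) b] sub by blast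
    then have "nv (representation S ((\<pi> powi k b) \<odot> b) b) \<le> q powi l b"
      using mem_box_iff[OF assms] b by blast
    then show "l b \<le> k b"
      using b assms(2) by (simp add: representation_scale span_base representation_basis nv_pi_powi)
  qed
next
  assume "\<forall>b\<in>S. l b \<le> k b"
  then show "box S k \<subseteq> box S l"
    unfolding subset_iff mem_box_iff[OF assms] by (meson order_trans q_powi_le_iff)
qed

text \<open>
  This is the splitting step for \<open>A\<close> together with one lattice, or with the two ends of an edge, that
  already have the basis \<open>S\<close>. Let \<open>\<pi>\<^sup>e\<^sup>(\<^sup>b\<^sup>)\<close> generate the \<open>b\<close>-coordinates of \<open>A\<close>. A vector of \<open>A\<close> whose
  \<open>b\<close>-coordinate is a generator always splits off from \<open>A\<close>. It splits off from \<open>box S l\<close> and \<open>box S m\<close>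
  if its other coordinates are small in comparison, that is, if \<open>b\<close> minimizes both \<open>e - l\<close> and \<open>e - m\<close>.
  As \<open>m - l\<close> takes only the values 0 and 1, such a \<open>b\<close> exists.
\<close>

lemma split_adapted:
  assumes S: "finite S" "independent S" "S \<noteq> {}"
    and A: "full_lattice (span S) A"
    and lm: "\<And>b. b \<in> S \<Longrightarrow> l b \<le> m b" "\<And>b. b \<in> S \<Longrightarrow> m b \<le> l b + 1"
  obtains w \<phi> where "functional \<phi>" "w \<in> span S" "\<phi> w = 1" "\<And>x. x \<in> A \<Longrightarrow> \<phi> x \<odot> w \<in> A"
    "\<And>x. x \<in> box S l \<Longrightarrow> \<phi> x \<odot> w \<in> box S l" "\<And>x. x \<in> box S m \<Longrightarrow> \<phi> x \<odot> w \<in> box S m"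
proof -
  define T where "T = extend_basis S"
  have T: "independent T" "span T = UNIV" "S \<subseteq> T"
    using extend_basis_superset independent_extend_basis span_extend_basis S(2) unfolding T_def by auto
  define f where "f = (\<lambda>b x. representation T x b)"
  have f: "functional (f b)" for b unfolding f_def by (rule functional_representation[OF T(1,2)])
  have fS: "f b x = representation S x b" if "x \<in> span S" for b x
    unfolding f_def using representation_extend[OF T(1) that T(3)] by simp
  have "\<exists>e. f b ` A = {a. nv a \<le> q powi e}" if b: "b \<in> S" for b
  proof -
    have "f b b = 1" unfolding f_def using representation_basis[OF T(1)] b T(3) by auto
    then show ?thesis using functional_image_lattice[OF A f, of b b] span_base[OF b]
      by (metis zero_neq_one)
  qed
  then obtain e where e: "\<And>b. b \<in> S \<Longrightarrow> f b ` A = {a. nv a \<le> q powi e b}" by metis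
  \<comment> \<open>Minimize \<open>e - l\<close> first, with ties broken in favour of \<open>m = l + 1\<close>.\<close>
  define h where "h = (\<lambda>b. 2 * (e b - l b) - (m b - l b))"
  obtain b where b: "b \<in> S" "\<And>c. c \<in> S \<Longrightarrow> h b \<le> h c"
    using ex_min_if_finite[of "h ` S"] S(1,3) by (metis (no_types, lifting) finite_imageI image_iff
      image_is_empty linorder_not_less)
  have min: "e b - l b \<le> e c - l c" "e b - m b \<le> e c - m c" if "c \<in> S" for c
    using b(2)[OF that] lm[OF that] lm[OF b(1)] unfolding h_def by presburger+
  obtain w where w: "w \<in> A" "f b w = \<pi> powi e b"
  proof -
    have "\<pi> powi e b \<in> f b ` A" unfolding e[OF b(1)] by (simp add: nv_pi_powi)
    then show ?thesis using that by (metis imageE)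
  qed
  define \<phi> where "\<phi> = (\<lambda>x. f b x / \<pi> powi e b)"
  have sub: "submodule A" and AU: "A \<subseteq> span S" using A span_superset[of A] by (auto simp: full_lattice_def)
  have bx: "\<phi> x \<odot> w \<in> box S n" if x: "x \<in> box S n" and n: "\<And>c. c \<in> S \<Longrightarrow> e b - n b \<le> e c - n c" for n x
    unfolding mem_box_iff[OF S(1,2)]
  proof (intro conjI ballI)
    show ws: "\<phi> x \<odot> w \<in> span S" using w(1) AU by (auto intro: span_scale)
    fix c assume c: "c \<in> S"
    have xs: "x \<in> span S" "nv (f b x) \<le> q powi n b"
      using x b(1) fS mem_box_iff[OF S(1,2)] by auto
    have "f c w \<in> f c ` A" using w(1) by blast
    then have wc: "nv (f c w) \<le> q powi e c" unfolding e[OF c] by simp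
    have "representation S (\<phi> x \<odot> w) c = \<phi> x * f c w"
      unfolding fS[OF ws, symmetric] functional_scale[OF f] ..
    then have "nv (representation S (\<phi> x \<odot> w) c) = nv (f b x) / q powi e b * nv (f c w)"
      by (simp add: nv_mult \<phi>_def nv_divide nv_pi_powi)
    also have "\<dots> \<le> q powi n b / q powi e b * q powi e c"
      using xs wc by (intro mult_mono divide_right_mono) (auto simp: nv_nonneg)
    also have "\<dots> = q powi (n b - e b + e c)" using q_pos by (simp add: power_int_add power_int_diff)
    also have "\<dots> \<le> q powi n c" using n[OF c] by simp
    finally show "nv (representation S (\<phi> x \<odot> w) c) \<le> q powi n c" .
  qed
  show ?thesis
  proof (rule that[of \<phi> w])
    show "functional \<phi>" unfolding \<phi>_def by (rule functional_divide[OF f])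
    show "w \<in> span S" using w(1) AU by blast
    show "\<phi> w = 1" unfolding \<phi>_def w(2) by simp
    show "\<phi> x \<odot> w \<in> A" if "x \<in> A" for x
    proof (rule submodule_scale[OF sub _ w(1)])
      have "f b x \<in> f b ` A" using that by blast
      then show "nv (\<phi> x) \<le> 1" unfolding e[OF b(1)] \<phi>_def by (simp add: nv_divide nv_pi_powi)
    qed
  qed (use bx min in blast)+
qed

text \<open>
  A coordinate functional that does not vanish on \<open>U\<close> has a value of largest norm on \<open>L\<close>, and a vector
  where it is attained splits off.
\<close>

lemma lattice_has_basis:
  assumes "full_lattice U L"
  obtains S k where "finite S" "independent S" "span S = U" "L = box S k"
proof -
  have "\<exists>S k. finite S \<and> independent S \<and> span S = U \<and> (\<forall>i::unit. L = box S (k i))"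
  proof (rule common_basis_induct[of "\<lambda>U X. full_lattice U (X ())" U "\<lambda>_. L"])
    show "full_lattice V (X i)" if "full_lattice V (X ())" for V X and i :: unit using that by simp
    fix V and X :: "unit \<Rightarrow> 'v set" assume X: "full_lattice V (X ())" and V: "V \<noteq> {0}"
    let ?L = "X ()"
    have sub: "submodule ?L" and LV: "?L \<subseteq> V" and "subspace V"
      using X span_superset[of ?L] subspace_span[of ?L] by (auto simp: full_lattice_def)
    then obtain u where u: "u \<in> V" "u \<noteq> 0" using V subspace_0 by blast
    have "\<exists>b. representation std_basis u b \<noteq> 0"
    proof (rule ccontr)
      assume "\<nexists>b. representation std_basis u b \<noteq> 0"
      then have "(\<Sum>b\<in>std_basis. representation std_basis u b \<odot> b) = 0" by simp
      then show False using sum_representation_eq[OF std_basis(2), of u std_basis] std_basis u by simp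
    qed
    then obtain b where b: "representation std_basis u b \<noteq> 0" by blast
    define f where "f = (\<lambda>x. representation std_basis x b)"
    have f: "functional f" unfolding f_def by (rule functional_representation[OF std_basis(2,3)])
    obtain e where e: "f ` ?L = {a. nv a \<le> q powi e}"
      using functional_image_lattice[OF X f u(1)] b unfolding f_def by blast
    obtain w where w: "w \<in> ?L" "f w = \<pi> powi e"
    proof -
      have "\<pi> powi e \<in> f ` ?L" unfolding e by (simp add: nv_pi_powi)
      then show ?thesis using that by (metis imageE)
    qed
    define \<phi> where "\<phi> = (\<lambda>x. f x / \<pi> powi e)"
    have \<phi>: "functional \<phi>" unfolding \<phi>_def by (rule functional_divide[OF f])
    have \<phi>w: "\<phi> w = 1" unfolding \<phi>_def w(2) by simp
    have \<phi>L: "\<phi> x \<odot> w \<in> ?L" if "x \<in> ?L" for x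
    proof (rule submodule_scale[OF sub _ w(1)])
      have "f x \<in> f ` ?L" using that by blast
      then show "nv (\<phi> x) \<le> 1" unfolding e \<phi>_def by (simp add: nv_divide nv_pi_powi)
    qed
    have wV: "w \<in> V" using w(1) LV by blast
    have "full_lattice (V \<inter> {x. \<phi> x = 0}) (?L \<inter> {x. \<phi> x = 0})"
      using full_lattice_kernel[OF X \<phi> \<phi>w \<phi>L wV] .
    then show "\<exists>w \<phi>. functional \<phi> \<and> w \<in> V \<and> \<phi> w = 1 \<and> (\<forall>i. \<forall>x\<in>X i. \<phi> x \<odot> w \<in> X i) \<and>
        full_lattice (V \<inter> {x. \<phi> x = 0}) (X () \<inter> {x. \<phi> x = 0})"
      using \<phi> \<phi>w \<phi>L wV by (intro exI[of _ w] exI[of _ \<phi>]) (simp add: UNIV_unit)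
  qed (use assms in simp)
  then show ?thesis using that by blast
qed

lemma span_eq_0_empty: "span S \<noteq> {0} \<Longrightarrow> S \<noteq> {}" by auto

text \<open>
  The theorem on elementary divisors: any two vertices lie in a common apartment.
\<close>

lemma common_basis_two:
  assumes "full_lattice U L" "full_lattice U A"
  obtains S k l where "finite S" "independent S" "span S = U" "L = box S k" "A = box S l"
proof -
  define Y where "Y = (\<lambda>i. if i then L else A)"
  have "\<exists>S k. finite S \<and> independent S \<and> span S = U \<and> (\<forall>i::bool. Y i = box S (k i))"
  proof (rule common_basis_induct[of "\<lambda>U X. \<forall>i. full_lattice U (X i)" U Y])
    fix V and X :: "bool \<Rightarrow> 'v set" assume X: "\<forall>i. full_lattice V (X i)" and V: "V \<noteq> {0}"
    obtain S l where S: "finite S" "independent S" "span S = V" and l: "X True = box S l"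
      using lattice_has_basis[of V "X True"] X by blast
    have SX: "full_lattice (span S) (X False)" using X S(3) by blast
    have "S \<noteq> {}" using span_eq_0_empty V S(3) by blast
    from split_adapted[OF S(1,2) this SX, of l l]
    obtain w \<phi> where w: "functional \<phi>" "w \<in> span S" "\<phi> w = 1"
      "\<And>x. x \<in> X False \<Longrightarrow> \<phi> x \<odot> w \<in> X False" "\<And>x. x \<in> X True \<Longrightarrow> \<phi> x \<odot> w \<in> X True"
      unfolding l by (metis order_refl less_add_one less_imp_le)
    then have st: "\<forall>i. \<forall>x\<in>X i. \<phi> x \<odot> w \<in> X i" by (metis (full_types))
    have "full_lattice (V \<inter> {x. \<phi> x = 0}) (X i \<inter> {x. \<phi> x = 0})" for i
      by (rule full_lattice_kernel[OF _ w(1,3)]) (use X st w(2) S(3) in auto)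
    then show "\<exists>w \<phi>. functional \<phi> \<and> w \<in> V \<and> \<phi> w = 1 \<and> (\<forall>i. \<forall>x\<in>X i. \<phi> x \<odot> w \<in> X i) \<and>
        (\<forall>i. full_lattice (V \<inter> {x. \<phi> x = 0}) (X i \<inter> {x. \<phi> x = 0}))"
      using st w S(3) by blast
  qed (use assms in \<open>auto simp: Y_def\<close>)
  then obtain S k where S: "finite S" "independent S" "span S = U" and k: "\<And>i. Y i = box S (k i)"
    by blast
  have "L = box S (k True)" "A = box S (k False)" using k[of True] k[of False] by (auto simp: Y_def)
  then show ?thesis using that S by blast
qed

text \<open>
  A vertex and an edge lie in a common apartment. A basis adapted to the edge has exponents that differ
  by at most 1, as \<open>split_adapted\<close> requires. The same argument fails for three arbitrary lattices,
  which need not have a common basis.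
\<close>

lemma common_basis_three:
  assumes "full_lattice U L" "full_lattice U B" "full_lattice U A" "B \<subseteq> L" "scale \<pi> ` L \<subseteq> B"
  obtains S k l m where "finite S" "independent S" "span S = U" "L = box S k" "B = box S l" "A = box S m"
proof -
  define Y where "Y = (\<lambda>i::nat. if i = 0 then L else if i = 1 then B else A)"
  \<comment> \<open>The indices above 2 repeat earlier lattices; the inclusions survive in kernels.\<close>
  define P where "P = (\<lambda>U X. (\<forall>i::nat. full_lattice U (X i) \<and> X i \<in> {X 0, X 1, X 2}) \<and> X 1 \<subseteq> X 0 \<and>
    (\<forall>x\<in>X 0. \<pi> \<odot> x \<in> X 1))"
  have "\<exists>S k. finite S \<and> independent S \<and> span S = U \<and> (\<forall>i::nat. Y i = box S (k i))"
  proof (rule common_basis_induct[of P U Y])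
    fix V and X :: "nat \<Rightarrow> 'v set" assume X: "P V X" and V: "V \<noteq> {0}"
    have lats: "full_lattice V (X i)" for i using X by (simp add: P_def)
    obtain S l m where S: "finite S" "independent S" "span S = V" and l: "X 0 = box S l" and m: "X 1 = box S m"
      using common_basis_two[OF lats[of 0] lats[of 1]] by blast
    have lm: "l b \<le> m b" if "b \<in> S" for b
      using X box_subset_iff[OF S(1,2)] that unfolding P_def l m by blast
    have ml: "m b \<le> l b + 1" if b: "b \<in> S" for b
    proof -
      have "(\<pi> powi l b) \<odot> b \<in> X 0" unfolding l using scaled_basis_mem_box[OF S(1) b] by simp
      then have "\<pi> \<odot> ((\<pi> powi l b) \<odot> b) \<in> box S m" using X unfolding P_def m by blast
      then have "nv (representation S (\<pi> \<odot> ((\<pi> powi l b) \<odot> b)) b) \<le> q powi m b"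
        using mem_box_iff[OF S(1,2)] b by blast
      then have "q * q powi l b \<le> q powi m b"
        using b S(2) by (simp add: representation_scale span_base span_scale representation_basis nv_pi_powi nv_mult)
      then have "q powi (l b + 1) \<le> q powi m b" using q_pos by (simp add: power_int_add mult.commute)
      then show ?thesis by simp
    qed
    have SX: "full_lattice (span S) (X 2)" using lats S(3) by blast
    have "S \<noteq> {}" using span_eq_0_empty V S(3) by blast
    then obtain w \<phi> where w: "functional \<phi>" "w \<in> span S" "\<phi> w = 1"
      "\<And>x. x \<in> X 2 \<Longrightarrow> \<phi> x \<odot> w \<in> X 2"
      "\<And>x. x \<in> box S l \<Longrightarrow> \<phi> x \<odot> w \<in> box S l" "\<And>x. x \<in> box S m \<Longrightarrow> \<phi> x \<odot> w \<in> box S m"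
      by (rule split_adapted[OF S(1,2) _ SX, of l m, OF _ lm ml]) (assumption | rule that; assumption)+
    have st: "\<forall>x\<in>X i. \<phi> x \<odot> w \<in> X i" for i
    proof -
      have "X i = X 0 \<or> X i = X 1 \<or> X i = X 2" using X unfolding P_def by blast
      then show ?thesis using w(4-6) unfolding l[symmetric] m[symmetric] by auto
    qed
    have "full_lattice (V \<inter> {x. \<phi> x = 0}) (X i \<inter> {x. \<phi> x = 0})" for i
      by (rule full_lattice_kernel[OF _ w(1,3)]) (use lats st w(2) S(3) in auto)
    moreover have "X i \<inter> {x. \<phi> x = 0} \<in> {X 0 \<inter> {x. \<phi> x = 0}, X 1 \<inter> {x. \<phi> x = 0}, X 2 \<inter> {x. \<phi> x = 0}}" for i
      using X unfolding P_def by blast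
    ultimately have "P (V \<inter> {x. \<phi> x = 0}) (\<lambda>i. X i \<inter> {x. \<phi> x = 0})"
      using X functional_scale[OF w(1)] unfolding P_def by auto
    then show "\<exists>w \<phi>. functional \<phi> \<and> w \<in> V \<and> \<phi> w = 1 \<and> (\<forall>i. \<forall>x\<in>X i. \<phi> x \<odot> w \<in> X i) \<and>
        P (V \<inter> {x. \<phi> x = 0}) (\<lambda>i. X i \<inter> {x. \<phi> x = 0})"
      using st w S(3) by blast
  next
    show "P U Y" using assms by (auto simp: P_def Y_def)
  qed (simp add: P_def)
  then obtain S k where S: "finite S" "independent S" "span S = U" and k: "\<And>i. Y i = box S (k i)"
    by blast
  have "L = box S (k 0)" "B = box S (k 1)" "A = box S (k 2)" using k[of 0] k[of 1] k[of 2] by (auto simp: Y_def)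
  then show ?thesis using that S by blast
qed

subsection \<open>Lattices spanned by multiples of basis vectors\<close>

lemma full_lattice_subspace: "full_lattice U L \<Longrightarrow> subspace U"
  unfolding full_lattice_def by (metis subspace_span)

lemma full_lattice_subset: "full_lattice U L \<Longrightarrow> L \<subseteq> U"
  unfolding full_lattice_def by (metis span_superset)

lemma lattice_in_iff_lat: "lattice_in U M \<longleftrightarrow> full_lattice U M"
proof
  assume "lattice_in U M"
  then obtain B where B: "finite B" "independent B" "span B = U"
    and M: "M = {(\<Sum>b\<in>B. c b \<odot> b) | c. \<forall>b\<in>B. c b \<in> valuation_ring}"
    by (auto simp: lattice_in_def)
  have "M = box B (\<lambda>_. 0)" unfolding M box_def valuation_ring_def by simp
  then show "full_lattice U M" using full_lattice_box[OF B(1)] B(3) by simp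
next
  assume "full_lattice U M"
  then obtain S k where S: "finite S" "independent S" "span S = U" "M = box S k"
    by (rule lattice_has_basis)
  define T where "T = (\<lambda>b. (\<pi> powi k b) \<odot> b) ` S"
  have T: "finite T" "span T = U" using S span_image_scale[OF S(1), of "\<lambda>b. \<pi> powi k b"]
    by (auto simp: T_def)
  have "card T \<le> dim U" using card_image_le[OF S(1)] dim_span_eq_card_independent[OF S(2)] S(3)
    unfolding T_def by metis
  moreover have "T \<subseteq> U" using T(2) span_superset by blast
  ultimately have ind: "independent T" using T by (intro card_le_dim_spanning[of T U]) auto
  have "card T = card S" using dim_span_eq_card_independent[OF ind] dim_span_eq_card_independent[OF S(2)]
    T(2) S(3) by simp
  then have inj: "inj_on (\<lambda>b. (\<pi> powi k b) \<odot> b) S" unfolding T_def by (rule eq_card_imp_inj_on[OF S(1)])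
  have "M = {(\<Sum>b\<in>T. c b \<odot> b) | c. \<forall>b\<in>T. c b \<in> valuation_ring}" (is "_ = ?R")
  proof (intro set_eqI iffI)
    fix x assume "x \<in> M"
    then obtain c where c: "x = (\<Sum>b\<in>S. c b \<odot> b)" "\<forall>b\<in>S. nv (c b) \<le> q powi k b"
      unfolding S(4) box_def by blast
    define c' where "c' = (\<lambda>t. let b = the_inv_into S (\<lambda>b. (\<pi> powi k b) \<odot> b) t in c b / \<pi> powi k b)"
    have c': "c' ((\<pi> powi k b) \<odot> b) = c b / \<pi> powi k b" if "b \<in> S" for b
      using the_inv_into_f_f[OF inj that] by (simp add: c'_def)
    have "x = (\<Sum>b\<in>S. c' ((\<pi> powi k b) \<odot> b) \<odot> ((\<pi> powi k b) \<odot> b))"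
      unfolding c(1) by (rule sum.cong) (simp_all add: c')
    also have "\<dots> = (\<Sum>b\<in>T. c' b \<odot> b)" unfolding T_def by (simp add: sum.reindex[OF inj])
    finally have "x = (\<Sum>b\<in>T. c' b \<odot> b)" .
    moreover have "\<forall>b\<in>T. c' b \<in> valuation_ring"
      using c(2) by (auto simp: T_def c' valuation_ring_def nv_divide nv_pi_powi)
    ultimately show "x \<in> ?R" by blast
  next
    fix x assume "x \<in> ?R"
    then obtain c where c: "x = (\<Sum>b\<in>T. c b \<odot> b)" "\<forall>b\<in>T. nv (c b) \<le> 1"
      unfolding valuation_ring_def by blast
    have "x = (\<Sum>b\<in>S. (c ((\<pi> powi k b) \<odot> b) * \<pi> powi k b) \<odot> b)"
      unfolding c(1) T_def by (simp add: sum.reindex[OF inj])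
    moreover have "\<forall>b\<in>S. nv (c ((\<pi> powi k b) \<odot> b) * \<pi> powi k b) \<le> q powi k b"
    proof
      fix b assume "b \<in> S"
      then have "nv (c ((\<pi> powi k b) \<odot> b)) \<le> 1" using c(2) by (auto simp: T_def)
      then have "nv (c ((\<pi> powi k b) \<odot> b)) * q powi k b \<le> 1 * q powi k b"
        by (intro mult_right_mono) auto
      then show "nv (c ((\<pi> powi k b) \<odot> b) * \<pi> powi k b) \<le> q powi k b"
        by (simp add: nv_mult nv_pi_powi)
    qed
    ultimately show "x \<in> M" unfolding S(4) box_def
      by (intro CollectI exI[of _ "\<lambda>b. c ((\<pi> powi k b) \<odot> b) * \<pi> powi k b"]) simp
  qed
  then show "lattice_in U M" unfolding lattice_in_def using T ind by blast
qed

abbreviation n :: nat where "n \<equiv> dim UNIV"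

lemma basis_lattice_eq_box:
  assumes "is_basis w" "\<And>i. i < n \<Longrightarrow> k' (w i) = k i"
  shows "basis_lattice w k = box (w ` {..<n}) k'"
proof -
  have inj: "inj_on w {..<n}" using assms by (simp add: is_basis_def)
  show ?thesis
  proof (intro set_eqI iffI)
    fix x assume "x \<in> basis_lattice w k"
    then obtain a where a: "x = (\<Sum>i<n. (\<pi> powi k i * a i) \<odot> w i)" "\<forall>i<n. nv (a i) \<le> 1"
      unfolding basis_lattice_def valuation_ring_def by blast
    define c where "c = (\<lambda>b. let i = the_inv_into {..<n} w b in \<pi> powi k i * a i)"
    have c: "c (w i) = \<pi> powi k i * a i" if "i < n" for i
      using the_inv_into_f_f[OF inj, of i] that by (simp add: c_def)
    have "x = (\<Sum>b\<in>w ` {..<n}. c b \<odot> b)" unfolding a(1) sum.reindex[OF inj]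
      by (rule sum.cong) (auto simp: c)
    moreover have "\<forall>b\<in>w ` {..<n}. nv (c b) \<le> q powi k' b"
      using a(2) assms(2) by (auto simp: c nv_mult nv_pi_powi mult_left_le)
    ultimately show "x \<in> box (w ` {..<n}) k'" unfolding box_def by blast
  next
    fix x assume "x \<in> box (w ` {..<n}) k'"
    then obtain c where c: "x = (\<Sum>b\<in>w ` {..<n}. c b \<odot> b)" "\<forall>b\<in>w ` {..<n}. nv (c b) \<le> q powi k' b"
      unfolding box_def by blast
    define a where "a = (\<lambda>i. c (w i) / \<pi> powi k i)"
    have "x = (\<Sum>i<n. (\<pi> powi k i * a i) \<odot> w i)"
      unfolding c(1) sum.reindex[OF inj] by (rule sum.cong) (auto simp: a_def)
    moreover have "\<forall>i<n. a i \<in> valuation_ring"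
      using c(2) assms(2) by (auto simp: a_def valuation_ring_def nv_divide nv_pi_powi)
    ultimately show "x \<in> basis_lattice w k" unfolding basis_lattice_def by blast
  qed
qed

lemma basis_lattice_box_inv:
  assumes "is_basis w"
  shows "basis_lattice w k = box (w ` {..<n}) (\<lambda>b. k (the_inv_into {..<n} w b))"
  using assms by (intro basis_lattice_eq_box) (auto simp: is_basis_def the_inv_into_f_f)

lemma is_basisD:
  assumes "is_basis w"
  shows "inj_on w {..<n}" "finite (w ` {..<n})" "independent (w ` {..<n})" "span (w ` {..<n}) = UNIV"
  using assms by (auto simp: is_basis_def)

lemma is_basis_from_set:
  assumes "finite S" "independent S" "span S = UNIV"
  obtains w where "is_basis w" "w ` {..<n} = S" "\<And>k. box S k = basis_lattice w (\<lambda>i. k (w i))"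
proof -
  have "card S = n" using dim_span_eq_card_independent[OF assms(2)] assms(3) by simp
  then obtain w where w: "bij_betw w {..<n} S"
    using assms(1) by (metis bij_betw_from_nat_into_finite)
  then have "is_basis w" "w ` {..<n} = S" using assms by (auto simp: is_basis_def bij_betw_def)
  then show ?thesis using that basis_lattice_eq_box[of w] by metis
qed

lemma full_lattice_basis_lattice: "is_basis w \<Longrightarrow> full_lattice UNIV (basis_lattice w k)"
  using full_lattice_box[of "w ` {..<n}"] basis_lattice_box_inv[of w k] by (simp add: is_basisD(4))

lemma basis_lattice_subset_iff:
  assumes "is_basis w"
  shows "basis_lattice w k \<subseteq> basis_lattice w l \<longleftrightarrow> (\<forall>i<n. l i \<le> k i)"
  unfolding basis_lattice_box_inv[OF assms] box_subset_iff[OF is_basisD(2,3)[OF assms]]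
  using is_basisD(1)[OF assms] by (auto simp: the_inv_into_f_f)

lemma basis_lattice_eq_iff:
  assumes "is_basis w"
  shows "basis_lattice w k = basis_lattice w l \<longleftrightarrow> (\<forall>i<n. k i = l i)"
  unfolding set_eq_subset basis_lattice_subset_iff[OF assms] by (auto intro: order_antisym)

lemma mem_basis_lattice_iff:
  assumes "is_basis w"
  shows "x \<in> basis_lattice w k \<longleftrightarrow> (\<forall>i<n. nv (representation (w ` {..<n}) x (w i)) \<le> q powi k i)"
  unfolding basis_lattice_box_inv[OF assms] mem_box_iff[OF is_basisD(2,3)[OF assms]]
  using is_basisD(1,4)[OF assms] by (auto simp: the_inv_into_f_f)

lemma mem_scale_image: "c \<noteq> 0 \<Longrightarrow> x \<in> scale c ` X \<longleftrightarrow> inverse c \<odot> x \<in> X"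
  by (metis (no_types, lifting) image_iff right_inverse left_inverse scale_one scale_scale)

lemma scale_image_scale: "scale a ` scale b ` X = scale (a * b) ` X"
  by (auto simp: image_iff)

lemma scale_image_basis_lattice:
  assumes "is_basis w"
  shows "scale (\<pi> powi j) ` basis_lattice w k = basis_lattice w (\<lambda>i. k i + j)"
proof (intro set_eqI)
  fix x
  have *: "nv (inverse (\<pi> powi j) * a) \<le> q powi k \<longleftrightarrow> nv a \<le> q powi (k + j)" for a k
  proof -
    have "nv (inverse (\<pi> powi j) * a) = nv a / q powi j"
      by (simp add: nv_mult nv_inverse nv_pi_powi divide_inverse mult.commute)
    then show ?thesis by (simp add: pos_divide_le_eq power_int_add)
  qed
  show "x \<in> scale (\<pi> powi j) ` basis_lattice w k \<longleftrightarrow> x \<in> basis_lattice w (\<lambda>i. k i + j)"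
    using is_basisD[OF assms]
    by (simp add: mem_scale_image mem_basis_lattice_iff[OF assms] representation_scale *)
qed

lemma scale_unit_image:
  assumes "submodule L" "nv u = 1"
  shows "scale u ` L = L"
proof
  show "scale u ` L \<subseteq> L" using submodule_scale[OF assms(1)] assms(2) by auto
  have "u \<noteq> 0" using assms(2) by auto
  then show "L \<subseteq> scale u ` L"
    using submodule_scale[OF assms(1), of "inverse u"] assms(2) by (auto simp: mem_scale_image nv_inverse)
qed

lemma scale_image_value:
  assumes "submodule L" "nv c = q powi j"
  shows "scale c ` L = scale (\<pi> powi j) ` L"
proof -
  have "nv (c / \<pi> powi j) = 1" using assms(2) by (simp add: nv_divide nv_pi_powi)
  then have "scale (\<pi> powi j) ` scale (c / \<pi> powi j) ` L = scale (\<pi> powi j) ` L"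
    using scale_unit_image[OF assms(1)] by metis
  then show ?thesis by (simp add: scale_image_scale)
qed

lemma lattice_class_eq: "submodule L \<Longrightarrow> lattice_class L = {scale (\<pi> powi j) ` L | j. True}"
  unfolding lattice_class_def
proof (intro set_eqI iffI)
  fix X assume L: "submodule L" and "X \<in> {scale c ` L |c. c \<noteq> 0}"
  then obtain c where c: "X = scale c ` L" "c \<noteq> 0" by blast
  then obtain j where "nv c = q powi j" using nv_value by blast
  then show "X \<in> {scale (\<pi> powi j) ` L |j. True}" using scale_image_value[OF L] c by blast
next
  fix X assume "X \<in> {scale (\<pi> powi j) ` L |j. True}"
  then show "X \<in> {scale c ` L |c. c \<noteq> 0}" by fastforce
qed

lemma self_mem_lattice_class: "L \<in> lattice_class L"
  unfolding lattice_class_def by (rule CollectI, rule exI[of _ 1]) simp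

lemma lattice_class_scale: "c \<noteq> 0 \<Longrightarrow> lattice_class (scale c ` L) = lattice_class L"
proof -
  assume c: "c \<noteq> 0"
  show ?thesis unfolding lattice_class_def
  proof (intro set_eqI iffI)
    fix X assume "X \<in> {scale e ` scale c ` L |e. e \<noteq> 0}"
    then obtain e where "X = scale (e * c) ` L" "e \<noteq> 0" by (auto simp: scale_image_scale)
    then show "X \<in> {scale e ` L |e. e \<noteq> 0}" using c by (intro CollectI exI[of _ "e * c"]) simp
  next
    fix X assume "X \<in> {scale e ` L |e. e \<noteq> 0}"
    then obtain e where "X = scale e ` L" "e \<noteq> 0" by blast
    then show "X \<in> {scale e ` scale c ` L |e. e \<noteq> 0}" using c
      by (intro CollectI exI[of _ "e / c"]) (simp add: scale_image_scale)
  qed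
qed

lemma lattice_class_eq_iff:
  assumes "submodule L"
  shows "lattice_class N = lattice_class L \<longleftrightarrow> (\<exists>j. N = scale (\<pi> powi j) ` L)"
proof
  assume "lattice_class N = lattice_class L"
  then have "N \<in> lattice_class L" using self_mem_lattice_class by blast
  then show "\<exists>j. N = scale (\<pi> powi j) ` L" unfolding lattice_class_eq[OF assms] by blast
next
  assume "\<exists>j. N = scale (\<pi> powi j) ` L"
  then show "lattice_class N = lattice_class L" using lattice_class_scale by auto
qed

lemma class_basis_lattice_eq_iff:
  assumes "is_basis w"
  shows "lattice_class (basis_lattice w k) = lattice_class (basis_lattice w l) \<longleftrightarrow>
    (\<exists>j. \<forall>i<n. k i = l i + j)"
  using lattice_class_eq_iff[of "basis_lattice w l" "basis_lattice w k"] full_lattice_basis_lattice[OF assms]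
  by (simp add: full_lattice_def scale_image_basis_lattice[OF assms] basis_lattice_eq_iff[OF assms])

lemma full_lattice_scale: "full_lattice U L \<Longrightarrow> c \<noteq> 0 \<Longrightarrow> full_lattice U (scale c ` L)"
proof -
  assume L: "full_lattice U L" and c: "c \<noteq> 0"
  obtain S k where S: "finite S" "independent S" "span S = U" "L = box S k"
    using lattice_has_basis[OF L] by blast
  obtain j where j: "nv c = q powi j" using nv_value[OF c] by blast
  have "scale c ` L = box S (\<lambda>b. k b + j)"
  proof (intro set_eqI)
    fix x
    have *: "nv (inverse c * a) \<le> q powi k \<longleftrightarrow> nv a \<le> q powi (k + j)" for a k
    proof -
      have "nv (inverse c * a) = nv a / q powi j"
        by (simp add: nv_mult nv_inverse j divide_inverse mult.commute)
      then show ?thesis by (simp add: pos_divide_le_eq power_int_add)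
    qed
    have "inverse c \<odot> x \<in> span S \<longleftrightarrow> x \<in> span S"
      using span_scale[of "inverse c \<odot> x" S c] span_scale[of x S "inverse c"] c by auto
    then show "x \<in> scale c ` L \<longleftrightarrow> x \<in> box S (\<lambda>b. k b + j)"
      using c S(2) by (auto simp: mem_scale_image S(4) mem_box_iff[OF S(1,2)] representation_scale *)
  qed
  then show ?thesis using full_lattice_box[OF S(1)] S(3) by simp
qed

lemma lattice_class_mem: "X \<in> lattice_class L \<Longrightarrow> full_lattice U L \<Longrightarrow> full_lattice U X \<and> lattice_class X = lattice_class L"
proof -
  assume "X \<in> lattice_class L" and L: "full_lattice U L"
  then obtain c where "X = scale c ` L" "c \<noteq> 0" unfolding lattice_class_def by blast
  then show ?thesis using full_lattice_scale[OF L] lattice_class_scale by metis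
qed

lemma common_apartment_two:
  assumes "full_lattice UNIV L" "full_lattice UNIV A"
  obtains w k l where "is_basis w" "L = basis_lattice w k" "A = basis_lattice w l"
proof -
  obtain S k l where "finite S" "independent S" "span S = UNIV" "L = box S k" "A = box S l"
    using common_basis_two[OF assms] by blast
  then show ?thesis using is_basis_from_set[of S] that by metis
qed

lemma common_apartment_three:
  assumes "full_lattice UNIV L" "full_lattice UNIV B" "full_lattice UNIV A" "B \<subseteq> L" "scale \<pi> ` L \<subseteq> B"
  obtains w k l m where "is_basis w" "L = basis_lattice w k" "B = basis_lattice w l" "A = basis_lattice w m"
proof -
  obtain S k l m where "finite S" "independent S" "span S = UNIV" "L = box S k" "B = box S l" "A = box S m"
    using common_basis_three[OF assms] by blast
  then show ?thesis using is_basis_from_set[of S] that by metis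
qed

end

context bruhat_tits_building begin

section \<open>The norm on an apartment\<close>

lemma ip_add_left: "ip (\<lambda>i. x i + y i) z = ip x z + ip y z"
  and ip_scale_left: "ip (\<lambda>i. c * x i) y = c * ip x y"
  and ip_commute: "ip x y = ip y x"
  and ip_nonneg: "0 \<le> ip x x"
  and ip_eq_0_iff: "ip x x = 0 \<longleftrightarrow> (\<exists>c. \<forall>i<n. x i = c)"
  and ip_permute: "\<sigma> permutes {..<n} \<Longrightarrow> ip (x \<circ> \<sigma>) (y \<circ> \<sigma>) = ip x y"
proof -
  note sp = scalar_product[unfolded invariant_scalar_product_def]
  note sp1 = sp[THEN conjunct2] note sp2 = sp1[THEN conjunct2] note sp3 = sp2[THEN conjunct2]
  note sp4 = sp3[THEN conjunct2] note sp5 = sp4[THEN conjunct2]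
  show "ip (\<lambda>i. x i + y i) z = ip x z + ip y z" by (rule sp[THEN conjunct1, THEN spec, THEN spec, THEN spec])
  show "ip (\<lambda>i. c * x i) y = c * ip x y" by (rule sp1[THEN conjunct1, THEN spec, THEN spec, THEN spec])
  show "ip x y = ip y x" by (rule sp2[THEN conjunct1, THEN spec, THEN spec])
  show "0 \<le> ip x x" by (rule sp3[THEN conjunct1, THEN spec])
  show "ip x x = 0 \<longleftrightarrow> (\<exists>c. \<forall>i<n. x i = c)" by (rule sp4[THEN conjunct1, THEN spec])
  show "ip (x \<circ> \<sigma>) (y \<circ> \<sigma>) = ip x y" if "\<sigma> permutes {..<n}"
    using that by (rule sp5[THEN spec, THEN spec, THEN spec, THEN mp])
qed

lemma ip_add_right: "ip z (\<lambda>i. x i + y i) = ip z x + ip z y"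
  using ip_add_left[of x y z] by (simp add: ip_commute)

lemma ip_scale_right: "ip y (\<lambda>i. c * x i) = c * ip y x"
  using ip_scale_left[of c x y] by (simp add: ip_commute)

text \<open>
  The norm on \<open>\<real>\<^sup>n/\<real>(1,\<dots>,1)\<close>, as a seminorm on representatives.
\<close>

definition apartment_norm :: "(nat \<Rightarrow> real) \<Rightarrow> real" where
  "apartment_norm x = sqrt (ip x x)"

lemma apartment_norm_nonneg [simp]: "0 \<le> apartment_norm x" by (simp add: apartment_norm_def ip_nonneg)

lemma apartment_norm_square: "(apartment_norm x)\<^sup>2 = ip x x" by (simp add: apartment_norm_def ip_nonneg)

lemma apartment_norm_scale: "apartment_norm (\<lambda>i. c * x i) = \<bar>c\<bar> * apartment_norm x"
  unfolding apartment_norm_def ip_scale_left ip_scale_right by (simp add: real_sqrt_mult flip: mult.assoc)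

lemma ip_combination: "ip (\<lambda>i. a * x i + b * y i) (\<lambda>i. a * x i + b * y i) =
    a\<^sup>2 * ip x x + 2 * a * b * ip x y + b\<^sup>2 * ip y y"
  unfolding ip_add_left ip_add_right ip_scale_left ip_scale_right
  by (simp add: ip_commute[of y x] power2_eq_square algebra_simps)

lemma ip_le_apartment_norm: "ip x y \<le> apartment_norm x * apartment_norm y"
proof (cases "apartment_norm x = 0 \<or> apartment_norm y = 0")
  case True
  have *: "ip x y = 0" if "apartment_norm y = 0" for x y
  proof (rule ccontr)
    assume ne: "ip x y \<noteq> 0"
    define b where "b = - (ip x x + 1) / (2 * ip x y)"
    have "0 \<le> ip x x + 2 * b * ip x y"
      using ip_combination[of 1 x b y] ip_nonneg[of "\<lambda>i. 1 * x i + b * y i"] that apartment_norm_square[of y] by simp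
    also have "\<dots> = - 1" using ne by (simp add: b_def field_simps)
    finally show False by simp
  qed
  have "ip x y = 0" using True *[of y x] *[of x y] ip_commute[of x y] by auto
  then show ?thesis using True by auto
next
  case False
  then have pos: "0 < apartment_norm x" "0 < apartment_norm y" using apartment_norm_nonneg[of x] apartment_norm_nonneg[of y] by linarith+
  have "0 \<le> ip (\<lambda>i. apartment_norm y * x i + - apartment_norm x * y i) (\<lambda>i. apartment_norm y * x i + - apartment_norm x * y i)" by (rule ip_nonneg)
  also have "\<dots> = 2 * (apartment_norm x * apartment_norm y) * (apartment_norm x * apartment_norm y - ip x y)"
    unfolding ip_combination apartment_norm_square[symmetric] by (simp add: power2_eq_square algebra_simps)
  finally show ?thesis using mult_pos_pos[OF pos] by (auto simp: zero_le_mult_iff)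
qed

lemma apartment_norm_triangle: "apartment_norm (\<lambda>i. x i + y i) \<le> apartment_norm x + apartment_norm y"
proof (rule power2_le_imp_le)
  have "(apartment_norm (\<lambda>i. x i + y i))\<^sup>2 = (apartment_norm x)\<^sup>2 + 2 * ip x y + (apartment_norm y)\<^sup>2"
    using ip_combination[of 1 x 1 y] by (simp add: apartment_norm_square)
  then show "(apartment_norm (\<lambda>i. x i + y i))\<^sup>2 \<le> (apartment_norm x + apartment_norm y)\<^sup>2"
    using ip_le_apartment_norm[of x y] by (simp add: power2_sum)
qed simp

lemma apartment_norm_eq_0_iff: "apartment_norm x = 0 \<longleftrightarrow> (\<exists>c. \<forall>i<n. x i = c)"
  by (simp add: apartment_norm_def ip_eq_0_iff)

lemma apartment_norm_cong:
  assumes "\<And>i. i < n \<Longrightarrow> x i = y i + c"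
  shows "apartment_norm x = apartment_norm y"
proof -
  have "apartment_norm x \<le> apartment_norm y + apartment_norm (\<lambda>i. x i - y i)"
    using apartment_norm_triangle[of y "\<lambda>i. x i - y i"] by simp
  moreover have "apartment_norm y \<le> apartment_norm x + apartment_norm (\<lambda>i. y i - x i)"
    using apartment_norm_triangle[of x "\<lambda>i. y i - x i"] by simp
  moreover have "apartment_norm (\<lambda>i. x i - y i) = 0" "apartment_norm (\<lambda>i. y i - x i) = 0"
    unfolding apartment_norm_eq_0_iff using assms by (auto intro: exI[of _ c] exI[of _ "- c"])
  ultimately show ?thesis by simp
qed

text \<open>
  Equality in the triangle inequality forces equality in the Cauchy-Schwarz inequality.
\<close>

lemma apartment_norm_add_eqD:
  assumes "apartment_norm (\<lambda>i. x i + y i) = apartment_norm x + apartment_norm y"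
  shows "apartment_norm (\<lambda>i. apartment_norm y * x i + - apartment_norm x * y i) = 0"
proof -
  have "(apartment_norm x + apartment_norm y)\<^sup>2 = (apartment_norm x)\<^sup>2 + 2 * ip x y + (apartment_norm y)\<^sup>2"
    using ip_combination[of 1 x 1 y] apartment_norm_square[of "\<lambda>i. x i + y i"] by (simp add: apartment_norm_square assms)
  then have "ip x y = apartment_norm x * apartment_norm y" by (simp add: power2_sum)
  then have "(apartment_norm (\<lambda>i. apartment_norm y * x i + - apartment_norm x * y i))\<^sup>2 = 0"
    unfolding apartment_norm_square ip_combination by (simp add: power2_eq_square flip: apartment_norm_square)
  then show ?thesis by simp
qed

text \<open>
  Transposing the entries \<open>i\<close> and \<open>j\<close> preserves the norm and changes \<open>x\<close> by \<open>x i - x j\<close> times a vector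
  that depends on \<open>i\<close> and \<open>j\<close> only. Hence small distances force close exponents.
\<close>

lemma apartment_norm_lower_bound:
  obtains \<kappa> where "\<kappa> > 0" "\<And>x i j. i < n \<Longrightarrow> j < n \<Longrightarrow> \<kappa> * \<bar>x i - x j\<bar> \<le> apartment_norm x"
proof -
  define e :: "nat \<times> nat \<Rightarrow> nat \<Rightarrow> real" where
    "e = (\<lambda>p k. (if k = fst p then 1 else 0) - (if k = snd p then 1 else 0))"
  define S where "S = {p \<in> {..<n} \<times> {..<n}. fst p \<noteq> snd p}"
  have S: "finite S" by (simp add: S_def)
  have pos: "0 < apartment_norm (e p)" if "p \<in> S" for p
  proof -
    have "apartment_norm (e p) \<noteq> 0" unfolding apartment_norm_eq_0_iff
    proof
      assume "\<exists>c. \<forall>i<n. e p i = c"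
      then have "e p (fst p) = e p (snd p)" using that by (auto simp: S_def)
      then show False using that by (auto simp: S_def e_def split: if_splits)
    qed
    then show ?thesis using apartment_norm_nonneg[of "e p"] by linarith
  qed
  define \<kappa> where "\<kappa> = Min (insert 1 ((\<lambda>p. apartment_norm (e p) / 2) ` S))"
  have "\<kappa> > 0" unfolding \<kappa>_def using S pos by (subst Min_gr_iff) auto
  moreover have "\<kappa> * \<bar>x i - x j\<bar> \<le> apartment_norm x" if ij: "i < n" "j < n" for x :: "nat \<Rightarrow> real" and i j
  proof (cases "i = j")
    case False
    let ?\<tau> = "Transposition.transpose i j"
    have "?\<tau> permutes {..<n}" using ij by (intro permutes_swap_id) auto
    then have n1: "apartment_norm (x \<circ> ?\<tau>) = apartment_norm x" unfolding apartment_norm_def by (simp add: ip_permute)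
    have "(\<lambda>k. x k + (-1) * (x \<circ> ?\<tau>) k) = (\<lambda>k. (x i - x j) * e (i, j) k)"
      by (rule ext) (use False in \<open>auto simp: e_def transpose_def\<close>)
    then have "\<bar>x i - x j\<bar> * apartment_norm (e (i, j)) = apartment_norm (\<lambda>k. x k + (-1) * (x \<circ> ?\<tau>) k)"
      by (simp only: apartment_norm_scale)
    also have "\<dots> \<le> apartment_norm x + apartment_norm (\<lambda>k. (-1) * (x \<circ> ?\<tau>) k)" by (rule apartment_norm_triangle)
    also have "\<dots> = 2 * apartment_norm x" unfolding apartment_norm_scale n1 by simp
    finally have 1: "\<bar>x i - x j\<bar> * (apartment_norm (e (i, j)) / 2) \<le> apartment_norm x" by simp
    have "\<kappa> \<le> apartment_norm (e (i, j)) / 2" unfolding \<kappa>_def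
      using S False ij by (intro Min_le) (auto simp: S_def)
    then have "\<kappa> * \<bar>x i - x j\<bar> \<le> (apartment_norm (e (i, j)) / 2) * \<bar>x i - x j\<bar>" by (rule mult_right_mono) simp
    then show ?thesis using 1 by (simp add: mult.commute)
  qed simp
  ultimately show ?thesis by (rule that)
qed

lemma apartment_norm_upper_bound:
  obtains B where "B \<ge> 0" "\<And>x c. (\<And>i. i < n \<Longrightarrow> \<bar>x i\<bar> \<le> c) \<Longrightarrow> apartment_norm x \<le> B * c"
proof -
  define e :: "nat \<Rightarrow> nat \<Rightarrow> real" where "e = (\<lambda>i k. if k = i then 1 else 0)"
  define B where "B = (\<Sum>i<n. apartment_norm (e i))"
  have sum: "apartment_norm (\<lambda>k. \<Sum>i<m. x i * e i k) \<le> (\<Sum>i<m. \<bar>x i\<bar> * apartment_norm (e i))" for m and x :: "nat \<Rightarrow> real"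
  proof (induction m)
    case 0
    have "apartment_norm (\<lambda>k. 0) = 0" unfolding apartment_norm_eq_0_iff by blast
    then show ?case by simp
  next
    case (Suc m)
    have "apartment_norm (\<lambda>k. \<Sum>i<Suc m. x i * e i k) \<le> apartment_norm (\<lambda>k. \<Sum>i<m. x i * e i k) + apartment_norm (\<lambda>k. x m * e m k)"
      using apartment_norm_triangle[of "\<lambda>k. \<Sum>i<m. x i * e i k" "\<lambda>k. x m * e m k"] by simp
    also have "apartment_norm (\<lambda>k. x m * e m k) = \<bar>x m\<bar> * apartment_norm (e m)" by (rule apartment_norm_scale)
    finally show ?case using Suc by simp
  qed
  have "apartment_norm x \<le> B * c" if "\<And>i. i < n \<Longrightarrow> \<bar>x i\<bar> \<le> c" for x and c :: real
  proof -
    have "apartment_norm x = apartment_norm (\<lambda>k. \<Sum>i<n. x i * e i k)"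
      by (rule apartment_norm_cong[of _ _ 0]) (simp add: e_def if_distrib sum.delta cong: if_cong)
    also have "\<dots> \<le> (\<Sum>i<n. \<bar>x i\<bar> * apartment_norm (e i))" by (rule sum)
    also have "\<dots> \<le> (\<Sum>i<n. c * apartment_norm (e i))" using that by (intro sum_mono mult_right_mono) auto
    also have "\<dots> = B * c" by (simp add: B_def mult.commute flip: sum_distrib_left)
    finally show ?thesis .
  qed
  moreover have "B \<ge> 0" unfolding B_def by (intro sum_nonneg) simp
  ultimately show ?thesis using that by blast
qed

section \<open>Points and distances\<close>

interpretation Metric_space points d by (rule metric)

lemmas d_nonneg [simp] = nonneg
lemmas d_commute = commute
lemmas d_zero = zero
lemmas d_triangle = triangle

abbreviation vertices :: "'v set set set" where "vertices \<equiv> lattice_classes_in UNIV"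

abbreviation class_vertex :: "'v set \<Rightarrow> 'v set set \<Rightarrow> real" where
  "class_vertex L \<equiv> vertex_point (lattice_class L)"

lemma vertices_iff: "x \<in> vertices \<longleftrightarrow> (\<exists>L. full_lattice UNIV L \<and> x = lattice_class L)"
  by (auto simp: lattice_classes_in_def lattice_in_iff_lat)

lemma lattice_class_vertex: "full_lattice UNIV L \<Longrightarrow> lattice_class L \<in> vertices"
  by (auto simp: vertices_iff)

lemma supp_vertex_point [simp]: "supp (vertex_point x) = {x}"
  by (auto simp: supp_def vertex_point_def)

lemma vertex_point_self [simp]: "vertex_point x x = 1"
  by (simp add: vertex_point_def)

lemma vertex_point_eq_iff [simp]: "vertex_point x = vertex_point y \<longleftrightarrow> x = y"
  by (metis supp_vertex_point singleton_inject)

lemma vertex_point_in_points: "x \<in> vertices \<Longrightarrow> vertex_point x \<in> points"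
  by (simp add: points_def simplices_def) (simp add: vertex_point_def)

definition edge :: "'v set set \<Rightarrow> 'v set set \<Rightarrow> bool" where
  "edge x y \<longleftrightarrow> x \<noteq> y \<and> {x, y} \<in> simplices"

definition edge_point :: "'v set set \<Rightarrow> 'v set set \<Rightarrow> real \<Rightarrow> 'v set set \<Rightarrow> real" where
  "edge_point x y s = (\<lambda>z. (1 - s) * vertex_point x z + s * vertex_point y z)"

lemma edge_commute: "edge x y \<longleftrightarrow> edge y x"
  unfolding edge_def by (simp add: insert_commute[of x y] eq_commute[of x y])

lemma edge_vertices: "edge x y \<Longrightarrow> x \<in> vertices" "edge x y \<Longrightarrow> y \<in> vertices"
  by (simp_all add: edge_def simplices_def)

lemma edge_point_0 [simp]: "edge_point x y 0 = vertex_point x"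
  and edge_point_1 [simp]: "edge_point x y 1 = vertex_point y"
  by (simp_all add: edge_point_def)

lemma edge_point_swap: "edge_point x y s = edge_point y x (1 - s)"
  by (simp add: edge_point_def algebra_simps)

lemma supp_edge_point: "supp (edge_point x y s) \<subseteq> {x, y}"
  unfolding supp_def edge_point_def vertex_point_def by (rule subsetI) (simp split: if_splits)

lemma supp_edge_point_interior: "x \<noteq> y \<Longrightarrow> 0 < s \<Longrightarrow> s < 1 \<Longrightarrow> supp (edge_point x y s) = {x, y}"
  unfolding supp_def edge_point_def vertex_point_def by (rule set_eqI) (simp split: if_splits)

lemma sum_edge_point:
  assumes "x \<noteq> y"
  shows "(\<Sum>z\<in>supp (edge_point x y s). edge_point x y s z * g z) = (1 - s) * g x + s * g y"
proof -
  have "(\<Sum>z\<in>supp (edge_point x y s). edge_point x y s z * g z) = (\<Sum>z\<in>{x, y}. edge_point x y s z * g z)"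
    by (rule sum.mono_neutral_left[OF _ supp_edge_point]) (simp_all add: supp_def)
  also have "\<dots> = (1 - s) * g x + s * g y"
    using assms by (simp add: edge_point_def vertex_point_def)
  finally show ?thesis .
qed

lemma simplices_subset:
  assumes "\<sigma> \<in> simplices" "\<tau> \<subseteq> \<sigma>" "\<tau> \<noteq> {}"
  shows "\<tau> \<in> simplices"
proof -
  have \<sigma>: "finite \<sigma>" "\<sigma> \<subseteq> vertices" "\<And>x y. x \<in> \<sigma> \<Longrightarrow> y \<in> \<sigma> \<Longrightarrow> x \<noteq> y \<Longrightarrow> adjacent x y"
    using assms(1) by (simp_all add: simplices_def)
  then show ?thesis
    unfolding simplices_def mem_Collect_eq
    using finite_subset[OF assms(2)] subset_trans[OF assms(2)] subsetD[OF assms(2)] assms(3) by metis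
qed

lemma edge_point_in_points:
  assumes "edge x y" "0 \<le> s" "s \<le> 1"
  shows "edge_point x y s \<in> points"
proof -
  have ne: "x \<noteq> y" using assms by (simp add: edge_def)
  have "edge_point x y s x \<noteq> 0 \<or> edge_point x y s y \<noteq> 0" using ne
    by (simp add: edge_point_def vertex_point_def)
  then have "supp (edge_point x y s) \<noteq> {}" unfolding supp_def by blast
  moreover have "{x, y} \<in> simplices" using assms(1) by (simp add: edge_def)
  ultimately have "supp (edge_point x y s) \<in> simplices"
    using simplices_subset[OF _ supp_edge_point] by blast
  moreover have "(\<Sum>z\<in>supp (edge_point x y s). edge_point x y s z) = 1"
    using sum_edge_point[OF ne, of s "\<lambda>_. 1"] by simp
  moreover have "0 \<le> edge_point x y s z" for z
    using assms(2,3) by (simp add: edge_point_def vertex_point_def)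
  ultimately show ?thesis unfolding points_def by blast
qed

lemma closed_simplex_edge:
  assumes "edge x y"
  shows "closed_simplex {x, y} = edge_point x y ` {0..1}"
proof (intro set_eqI iffI)
  fix f assume "f \<in> closed_simplex {x, y}"
  then have f: "f \<in> points" "supp f \<subseteq> {x, y}" by (auto simp: closed_simplex_def)
  have ne: "x \<noteq> y" using assms by (simp add: edge_def)
  have "1 = (\<Sum>z\<in>supp f. f z)" using f by (simp add: points_def)
  also have "\<dots> = (\<Sum>z\<in>{x, y}. f z)"
    by (rule sum.mono_neutral_left[OF _ f(2)]) (simp_all add: supp_def)
  finally have sum: "f x = 1 - f y" using ne by simp
  have "f = edge_point x y (f y)"
  proof
    fix z show "f z = edge_point x y (f y) z"
      proof (cases "z = x \<or> z = y")
      case True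
      then show ?thesis using sum ne ne[symmetric]
        by (elim disjE) (simp_all add: edge_point_def vertex_point_def)
    next
      case False
      then have "f z = 0" using f(2) unfolding supp_def by blast
      then show ?thesis using False by (simp add: edge_point_def vertex_point_def)
    qed
  qed
  moreover have "0 \<le> f y" "0 \<le> f x" using f by (auto simp: points_def)
  then have "f y \<in> {0..1}" using sum by simp
  ultimately show "f \<in> edge_point x y ` {0..1}" by blast
next
  fix f assume "f \<in> edge_point x y ` {0..1}"
  then obtain s where "f = edge_point x y s" "0 \<le> s" "s \<le> 1" by auto
  then show "f \<in> closed_simplex {x, y}"
    using edge_point_in_points[OF assms] supp_edge_point unfolding closed_simplex_def by blast
qed

lemma edge_if_card_2: "\<sigma> \<in> simplices \<Longrightarrow> card \<sigma> = 2 \<Longrightarrow> \<exists>x y. \<sigma> = {x, y} \<and> edge x y"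
  by (auto simp: card_2_iff edge_def)

lemma edge_classI:
  assumes "full_lattice UNIV L" "full_lattice UNIV M" "scale \<pi> ` L \<subseteq> M" "M \<subseteq> L" "lattice_class L \<noteq> lattice_class M"
  shows "edge (lattice_class L) (lattice_class M)"
proof -
  have "adjacent (lattice_class M) (lattice_class L)"
    unfolding adjacent_def using assms self_mem_lattice_class by metis
  moreover have "scale \<pi> ` L \<in> lattice_class L" unfolding lattice_class_def by force
  then have "adjacent (lattice_class L) (lattice_class M)"
    unfolding adjacent_def using assms self_mem_lattice_class image_mono[OF assms(4), of "scale \<pi>"] by metis
  ultimately show ?thesis using assms lattice_class_vertex
    by (auto simp: edge_def simplices_def)
qed

text \<open>
  A given representative of one end of an edge determines a representative of the other end that lies
  below it; the next lemma goes upwards. Edge paths thus lift to chains of lattices.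
\<close>

lemma edge_next_lattice:
  assumes "edge x y" "full_lattice UNIV N" "x = lattice_class N"
  obtains M where "full_lattice UNIV M" "y = lattice_class M" "scale \<pi> ` N \<subseteq> M" "M \<subseteq> N"
proof -
  have "adjacent y x" using assms(1) by (auto simp: edge_def simplices_def)
  then obtain M0 N0 where 0: "M0 \<in> y" "N0 \<in> x" "scale \<pi> ` N0 \<subseteq> M0" "M0 \<subseteq> N0"
    by (auto simp: adjacent_def)
  obtain L where L: "y = lattice_class L" "full_lattice UNIV L" using edge_vertices(2)[OF assms(1)] vertices_iff by blast
  obtain c where c: "N0 = scale c ` N" "c \<noteq> 0" using 0(2) assms(3) by (auto simp: lattice_class_def)
  let ?M = "scale (inverse c) ` M0"
  have N: "N = scale (inverse c) ` N0" using c by (simp add: scale_image_scale)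
  have M0: "full_lattice UNIV M0" "lattice_class M0 = y" using lattice_class_mem 0(1) L by blast+
  have "full_lattice UNIV ?M" "lattice_class ?M = y"
    using full_lattice_scale[OF M0(1)] lattice_class_scale M0(2) c(2) by auto
  moreover have "?M \<subseteq> N" unfolding N by (rule image_mono[OF 0(4)])
  moreover have "scale \<pi> ` N \<subseteq> ?M"
    using image_mono[OF 0(3), of "scale (inverse c)"] unfolding N by (simp add: scale_image_scale mult.commute)
  ultimately show ?thesis using that by blast
qed

lemma edge_prev_lattice:
  assumes "edge x y" "full_lattice UNIV M" "y = lattice_class M"
  obtains N where "full_lattice UNIV N" "x = lattice_class N" "scale \<pi> ` N \<subseteq> M" "M \<subseteq> N"
proof -
  obtain N where N: "full_lattice UNIV N" "x = lattice_class N" "scale \<pi> ` M \<subseteq> N" "N \<subseteq> M"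
    using edge_next_lattice[of y x M] assms edge_commute by metis
  let ?N = "scale (inverse \<pi>) ` N"
  have "scale \<pi> ` ?N \<subseteq> M" using N(4) by (simp add: scale_image_scale)
  moreover have "M \<subseteq> ?N" using image_mono[OF N(3), of "scale (inverse \<pi>)"] by (simp add: scale_image_scale)
  moreover have "full_lattice UNIV ?N" "lattice_class ?N = x" using full_lattice_scale[OF N(1)] lattice_class_scale N(2) by auto
  ultimately show ?thesis using that by blast
qed

subsection \<open>Distances through apartment coordinates\<close>

text \<open>
  Any exponents \<open>\<kappa>\<close> of the vertices differ from the chosen ones by constants, which add up to a constant
  in the coordinates. Distances can therefore be computed with the exponents at hand.
\<close>

lemma apartment_coords_expand:
  assumes w: "is_basis w" and f: "f \<in> points"
    and \<kappa>: "\<And>x. x \<in> supp f \<Longrightarrow> x = lattice_class (basis_lattice w (\<kappa> x))"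
  obtains c where "\<And>i. i < n \<Longrightarrow> apartment_coords w f i = c - (\<Sum>x\<in>supp f. f x * real_of_int (\<kappa> x i))"
proof -
  define K where "K = (\<lambda>x. SOME k. x = lattice_class (basis_lattice w k))"
  have "\<exists>j. \<forall>i<n. K x i = \<kappa> x i + j" if x: "x \<in> supp f" for x
  proof -
    have "x = lattice_class (basis_lattice w (K x))" unfolding K_def using \<kappa>[OF x]
      by (rule someI[of "\<lambda>k. x = lattice_class (basis_lattice w k)"])
    then show ?thesis using \<kappa>[OF x] class_basis_lattice_eq_iff[OF w] by metis
  qed
  then obtain j where j: "\<And>x i. x \<in> supp f \<Longrightarrow> i < n \<Longrightarrow> K x i = \<kappa> x i + j x" by metis
  have "apartment_coords w f i = - (\<Sum>x\<in>supp f. f x * real_of_int (j x)) - (\<Sum>x\<in>supp f. f x * real_of_int (\<kappa> x i))"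
    if i: "i < n" for i
  proof -
    have "apartment_coords w f i = (\<Sum>x\<in>supp f. f x * - real_of_int (K x i))"
      by (simp add: apartment_coords_def K_def)
    also have "\<dots> = (\<Sum>x\<in>supp f. - (f x * real_of_int (j x)) - f x * real_of_int (\<kappa> x i))"
      by (rule sum.cong) (auto simp: j i algebra_simps)
    finally show ?thesis by (simp add: sum_subtractf sum_negf)
  qed
  then show ?thesis using that by blast
qed

lemma dist_formula:
  assumes w: "is_basis w" and f: "f \<in> points" and h: "h \<in> points"
    and \<kappa>: "\<And>x. x \<in> supp f \<Longrightarrow> x = lattice_class (basis_lattice w (\<kappa> x))"
    and \<kappa>': "\<And>x. x \<in> supp h \<Longrightarrow> x = lattice_class (basis_lattice w (\<kappa>' x))"
  shows "d f h = apartment_norm (\<lambda>i. (\<Sum>x\<in>supp f. f x * real_of_int (\<kappa> x i)) - (\<Sum>x\<in>supp h. h x * real_of_int (\<kappa>' x i)))"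
proof -
  obtain a where a: "\<And>i. i < n \<Longrightarrow> apartment_coords w f i = a - (\<Sum>x\<in>supp f. f x * real_of_int (\<kappa> x i))"
    using apartment_coords_expand[OF w f \<kappa>] by blast
  obtain b where b: "\<And>i. i < n \<Longrightarrow> apartment_coords w h i = b - (\<Sum>x\<in>supp h. h x * real_of_int (\<kappa>' x i))"
    using apartment_coords_expand[OF w h \<kappa>'] by blast
  let ?D = "\<lambda>i. apartment_coords w f i - apartment_coords w h i"
  have "f \<in> apartment w" "h \<in> apartment w" unfolding apartment_def using f h \<kappa> \<kappa>' by blast+
  then have "d f h = apartment_norm ?D" using dist_apartment[OF w] by (simp add: Let_def apartment_norm_def)
  also have "\<dots> = apartment_norm (\<lambda>i. (-1) * ?D i)" unfolding apartment_norm_scale by simp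
  also have "\<dots> = apartment_norm (\<lambda>i. (\<Sum>x\<in>supp f. f x * real_of_int (\<kappa> x i)) - (\<Sum>x\<in>supp h. h x * real_of_int (\<kappa>' x i)))"
    by (rule apartment_norm_cong[of _ _ "b - a"]) (simp add: a b)
  finally show ?thesis .
qed

lemma dist_vertices:
  assumes "is_basis w"
  shows "d (class_vertex (basis_lattice w k)) (class_vertex (basis_lattice w l)) =
    apartment_norm (\<lambda>i. real_of_int (k i) - real_of_int (l i))"
  using dist_formula[OF assms, of "class_vertex (basis_lattice w k)" "class_vertex (basis_lattice w l)" "\<lambda>_. k" "\<lambda>_. l"]
    lattice_class_vertex[OF full_lattice_basis_lattice[OF assms]] vertex_point_in_points by simp

lemma dist_edge_points:
  assumes "is_basis w" "edge x y" "edge x' y'" "0 \<le> s" "s \<le> 1" "0 \<le> t" "t \<le> 1"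
    "x = lattice_class (basis_lattice w k)" "y = lattice_class (basis_lattice w l)"
    "x' = lattice_class (basis_lattice w k')" "y' = lattice_class (basis_lattice w l')"
  shows "d (edge_point x y s) (edge_point x' y' t) =
    apartment_norm (\<lambda>i. ((1 - s) * real_of_int (k i) + s * real_of_int (l i)) - ((1 - t) * real_of_int (k' i) + t * real_of_int (l' i)))"
proof -
  have ne: "x \<noteq> y" "x' \<noteq> y'" using assms(2,3) by (auto simp: edge_def)
  let ?\<kappa> = "\<lambda>z. if z = x then k else l" and ?\<kappa>' = "\<lambda>z. if z = x' then k' else l'"
  have "d (edge_point x y s) (edge_point x' y' t) =
    apartment_norm (\<lambda>i. (\<Sum>z\<in>supp (edge_point x y s). edge_point x y s z * real_of_int (?\<kappa> z i)) -
             (\<Sum>z\<in>supp (edge_point x' y' t). edge_point x' y' t z * real_of_int (?\<kappa>' z i)))"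
  proof (rule dist_formula[OF assms(1) edge_point_in_points[OF assms(2,4,5)] edge_point_in_points[OF assms(3,6,7)]])
    fix z assume "z \<in> supp (edge_point x y s)"
    then show "z = lattice_class (basis_lattice w (?\<kappa> z))"
      using supp_edge_point[of x y s] assms(8,9) by auto
  next
    fix z assume "z \<in> supp (edge_point x' y' t)"
    then show "z = lattice_class (basis_lattice w (?\<kappa>' z))"
      using supp_edge_point[of x' y' t] assms(10,11) by auto
  qed
  then show ?thesis unfolding sum_edge_point[OF ne(1)] sum_edge_point[OF ne(2)] using ne by auto
qed

lemma dist_along_edge:
  assumes "edge x y" "0 \<le> s" "s \<le> 1" "0 \<le> t" "t \<le> 1"
  shows "d (edge_point x y s) (edge_point x y t) = \<bar>s - t\<bar> * d (vertex_point x) (vertex_point y)"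
proof -
  obtain L M where L: "full_lattice UNIV L" "x = lattice_class L" and M: "full_lattice UNIV M" "y = lattice_class M"
    using edge_vertices[OF assms(1)] vertices_iff by metis
  obtain w k l where w: "is_basis w" "L = basis_lattice w k" "M = basis_lattice w l"
    using common_apartment_two[OF L(1) M(1)] by blast
  have "d (edge_point x y s) (edge_point x y t) =
    apartment_norm (\<lambda>i. ((1 - s) * real_of_int (k i) + s * real_of_int (l i)) - ((1 - t) * real_of_int (k i) + t * real_of_int (l i)))"
    by (rule dist_edge_points[OF w(1) assms(1,1) assms(2-5)]) (use L M w in auto)
  also have "\<dots> = apartment_norm (\<lambda>i. (t - s) * (real_of_int (k i) - real_of_int (l i)))"
    by (simp add: algebra_simps)
  also have "\<dots> = \<bar>s - t\<bar> * d (vertex_point x) (vertex_point y)"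
    unfolding apartment_norm_scale L(2) M(2) w(2,3) dist_vertices[OF w(1)] by (simp add: abs_minus_commute)
  finally show ?thesis .
qed

text \<open>
  The exponents are integers, and those of different vertices do not differ by a constant.
\<close>

lemma dist_vertices_ge:
  obtains \<kappa> where "\<kappa> > 0" "\<And>x y. x \<in> vertices \<Longrightarrow> y \<in> vertices \<Longrightarrow> x \<noteq> y \<Longrightarrow> \<kappa> \<le> d (vertex_point x) (vertex_point y)"
proof -
  obtain \<kappa> where \<kappa>: "\<kappa> > 0" "\<And>x i j. i < n \<Longrightarrow> j < n \<Longrightarrow> \<kappa> * \<bar>x i - x j\<bar> \<le> apartment_norm x"
    using apartment_norm_lower_bound by blast
  have "\<kappa> \<le> d (vertex_point x) (vertex_point y)" if xy: "x \<in> vertices" "y \<in> vertices" "x \<noteq> y" for x y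
  proof -
    obtain L M where L: "full_lattice UNIV L" "x = lattice_class L" and M: "full_lattice UNIV M" "y = lattice_class M"
      using xy vertices_iff by metis
    obtain w k l where w: "is_basis w" "L = basis_lattice w k" "M = basis_lattice w l"
      using common_apartment_two[OF L(1) M(1)] by blast
    have "\<not> (\<exists>j. \<forall>i<n. k i = l i + j)"
      using xy(3) class_basis_lattice_eq_iff[OF w(1)] L M w by metis
    then have "n \<noteq> 0" by (metis not_less_zero)
    then obtain i where i: "i < n" "k i \<noteq> l i + (k 0 - l 0)" "0 < n"
      using \<open>\<not> (\<exists>j. \<forall>i<n. k i = l i + j)\<close> by blast
    have "1 \<le> \<bar>(real_of_int (k i) - real_of_int (l i)) - (real_of_int (k 0) - real_of_int (l 0))\<bar>"
    proof -
      have "1 \<le> \<bar>(k i - l i) - (k 0 - l 0)\<bar>" using i(2) by linarith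
      then have "real_of_int 1 \<le> real_of_int \<bar>(k i - l i) - (k 0 - l 0)\<bar>" by (simp only: of_int_le_iff)
      then show ?thesis by simp
    qed
    then have "\<kappa> * 1 \<le> \<kappa> * \<bar>(real_of_int (k i) - real_of_int (l i)) - (real_of_int (k 0) - real_of_int (l 0))\<bar>"
      using \<kappa>(1) by (intro mult_left_mono) auto
    also have "\<dots> \<le> apartment_norm (\<lambda>i. real_of_int (k i) - real_of_int (l i))" by (rule \<kappa>(2)[OF i(1,3)])
    finally show ?thesis unfolding L(2) M(2) w(2,3) dist_vertices[OF w(1)] by simp
  qed
  then show ?thesis using that \<kappa>(1) by blast
qed

text \<open>
  This lemma and the next translate between distances of classes and inclusions of lattices up to powers
  of \<open>\<pi>\<close>.
\<close>

lemma dist_classes_le: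
  obtains B where "B \<ge> 0" "\<And>L N a. full_lattice UNIV L \<Longrightarrow> full_lattice UNIV N \<Longrightarrow> scale (\<pi> powi a) ` L \<subseteq> N \<Longrightarrow>
    scale (\<pi> powi a) ` N \<subseteq> L \<Longrightarrow> d (class_vertex L) (class_vertex N) \<le> B * real_of_int a"
proof -
  obtain B where B: "B \<ge> 0" "\<And>x c. (\<And>i. i < n \<Longrightarrow> \<bar>x i\<bar> \<le> c) \<Longrightarrow> apartment_norm x \<le> B * c"
    using apartment_norm_upper_bound by blast
  have "d (class_vertex L) (class_vertex N) \<le> B * real_of_int a"
    if LN: "full_lattice UNIV L" "full_lattice UNIV N" "scale (\<pi> powi a) ` L \<subseteq> N" "scale (\<pi> powi a) ` N \<subseteq> L" for L N a
  proof -
    obtain w k l where w: "is_basis w" "L = basis_lattice w k" "N = basis_lattice w l"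
      using common_apartment_two[OF LN(1,2)] by blast
    have "\<forall>i<n. l i \<le> k i + a" "\<forall>i<n. k i \<le> l i + a"
      using LN(3,4) unfolding w(2,3) scale_image_basis_lattice[OF w(1)] basis_lattice_subset_iff[OF w(1)] by auto
    then have "\<bar>real_of_int (k i) - real_of_int (l i)\<bar> \<le> real_of_int a" if "i < n" for i
      using that by (smt (verit) of_int_add of_int_le_iff)
    then show ?thesis unfolding w(2,3) dist_vertices[OF w(1)] by (rule B(2))
  qed
  then show ?thesis using that B(1) by blast
qed

lemma classes_close:
  fixes D :: real
  obtains C :: int where "C \<ge> 0" "\<And>L N. full_lattice UNIV L \<Longrightarrow> full_lattice UNIV N \<Longrightarrow> d (class_vertex L) (class_vertex N) \<le> D \<Longrightarrow>
    \<exists>j. scale (\<pi> powi (j + C)) ` L \<subseteq> N \<and> N \<subseteq> scale (\<pi> powi j) ` L"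
proof -
  obtain \<kappa> where \<kappa>: "\<kappa> > 0" "\<And>x i j. i < n \<Longrightarrow> j < n \<Longrightarrow> \<kappa> * \<bar>x i - x j\<bar> \<le> apartment_norm x"
    using apartment_norm_lower_bound by blast
  \<comment> \<open>By the lower bound on the norm, differences of relative exponents are at most \<open>D / \<kappa>\<close>.\<close>
  define C where "C = max 0 \<lceil>D / \<kappa>\<rceil>"
  have "\<exists>j. scale (\<pi> powi (j + C)) ` L \<subseteq> N \<and> N \<subseteq> scale (\<pi> powi j) ` L"
    if LN: "full_lattice UNIV L" "full_lattice UNIV N" "d (class_vertex L) (class_vertex N) \<le> D" for L N
  proof -
    obtain w k l where w: "is_basis w" "L = basis_lattice w k" "N = basis_lattice w l"
      using common_apartment_two[OF LN(1,2)] by blast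
    have nD: "apartment_norm (\<lambda>i. real_of_int (k i) - real_of_int (l i)) \<le> D"
      using LN(3) unfolding w(2,3) dist_vertices[OF w(1)] .
    have close: "(l i - k i) - (l i' - k i') \<le> C" if "i < n" "i' < n" for i i'
    proof -
      have "\<kappa> * \<bar>(real_of_int (k i) - real_of_int (l i)) - (real_of_int (k i') - real_of_int (l i'))\<bar> \<le> D"
        using \<kappa>(2)[OF that, of "\<lambda>i. real_of_int (k i) - real_of_int (l i)"] nD by linarith
      then have "\<bar>(real_of_int (k i) - real_of_int (l i)) - (real_of_int (k i') - real_of_int (l i'))\<bar> \<le> D / \<kappa>"
        using \<kappa>(1) by (simp add: field_simps)
      then have "real_of_int ((l i - k i) - (l i' - k i')) \<le> D / \<kappa>" by simp
      also have "\<dots> \<le> real_of_int C" unfolding C_def by linarith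
      finally show ?thesis by (simp only: of_int_le_iff)
    qed
    obtain j where j: "\<forall>i<n. j \<le> l i - k i" "\<forall>i<n. l i - k i \<le> j + C"
    proof (cases "n = 0")
      case True
      show ?thesis using that[of 0] unfolding True by simp
    next
      case False
      then have "0 \<in> {..<n}" by (simp only: lessThan_iff neq0_conv)
      then have fin: "finite ((\<lambda>i. l i - k i) ` {..<n})" "(\<lambda>i. l i - k i) ` {..<n} \<noteq> {}" by blast+
      obtain i0 where "i0 < n" "Min ((\<lambda>i. l i - k i) ` {..<n}) = l i0 - k i0"
        using Min_in[OF fin] by auto
      then have "\<forall>i<n. l i0 - k i0 \<le> l i - k i" using Min_le[OF fin(1)] by (metis image_eqI lessThan_iff)
      moreover have "\<forall>i<n. l i - k i \<le> l i0 - k i0 + C" using close \<open>i0 < n\<close> by (metis add.commute diff_le_eq)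
      ultimately show ?thesis using that by blast
    qed
    have "scale (\<pi> powi (j + C)) ` L \<subseteq> N" "N \<subseteq> scale (\<pi> powi j) ` L"
      unfolding w(2,3) scale_image_basis_lattice[OF w(1)] basis_lattice_subset_iff[OF w(1)]
      using j by (auto simp: algebra_simps)
    then show ?thesis by blast
  qed
  moreover have "C \<ge> 0" by (simp add: C_def)
  ultimately show ?thesis using that by blast
qed

subsection \<open>Straight pairs of edges\<close>

text \<open>
  In an apartment containing both edges they are given by vectors \<open>\<alpha>\<close> and \<open>\<beta>\<close> with entries in \<open>{0, 1}\<close>,
  neither of them constant. Equality in the triangle inequality makes them proportional modulo constants, hence
  equal. So each basis vector of \<open>N1\<close> lies in \<open>N2\<close> or in \<open>\<pi> N0\<close>.
\<close>

lemma straight_edges: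
  assumes lats: "full_lattice UNIV N0" "full_lattice UNIV N1" "full_lattice UNIV N2"
    and 01: "scale \<pi> ` N0 \<subseteq> N1" "N1 \<subseteq> N0" and 12: "scale \<pi> ` N1 \<subseteq> N2" "N2 \<subseteq> N1"
    and ne: "lattice_class N0 \<noteq> lattice_class N1" "lattice_class N1 \<noteq> lattice_class N2"
    and add: "d (class_vertex N0) (class_vertex N2) =
      d (class_vertex N0) (class_vertex N1) + d (class_vertex N1) (class_vertex N2)"
    and x: "x \<in> N1"
  shows "\<exists>y z. y \<in> N2 \<and> z \<in> N0 \<and> x = y + \<pi> \<odot> z"
proof -
  \<comment> \<open>Multiplied by \<open>\<pi>\<close>, the lattice \<open>N0\<close> lies between \<open>\<pi> N1\<close> and \<open>N1\<close>, as the common basis requires.\<close>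
  have pN0: "full_lattice UNIV (scale \<pi> ` N0)" by (rule full_lattice_scale[OF lats(1)]) simp
  have pp: "scale \<pi> ` N1 \<subseteq> scale \<pi> ` N0" using 01(2) by (rule image_mono)
  obtain w k b m where w: "is_basis w" and k: "N1 = basis_lattice w k"
    and b: "scale \<pi> ` N0 = basis_lattice w b" and m: "N2 = basis_lattice w m"
    using common_apartment_three[OF lats(2) pN0 lats(3) 01(1) pp] by blast
  have N0: "N0 = basis_lattice w (\<lambda>i. b i - 1)"
  proof -
    have "N0 = scale (\<pi> powi (-1)) ` scale \<pi> ` N0" by (simp add: scale_image_scale power_int_minus)
    then show ?thesis unfolding b scale_image_basis_lattice[OF w] by simp
  qed
  have "\<forall>i<n. k i \<le> b i" using 01(1) unfolding b k basis_lattice_subset_iff[OF w] .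
  moreover have "\<forall>i<n. b i - 1 \<le> k i" using 01(2) unfolding N0 k basis_lattice_subset_iff[OF w] .
  ultimately have kb: "\<forall>i<n. k i \<le> b i \<and> b i \<le> k i + 1" by fastforce
  have km: "\<forall>i<n. k i \<le> m i \<and> m i \<le> k i + 1"
  proof -
    have pN1: "scale \<pi> ` N1 = basis_lattice w (\<lambda>i. k i + 1)"
      using scale_image_basis_lattice[OF w, of 1 k] k by simp
    have "\<forall>i<n. m i \<le> k i + 1" using 12(1) unfolding pN1 m basis_lattice_subset_iff[OF w] .
    moreover have "\<forall>i<n. k i \<le> m i" using 12(2) unfolding k m basis_lattice_subset_iff[OF w] .
    ultimately show ?thesis by blast
  qed
  define \<alpha> where "\<alpha> = (\<lambda>i. real_of_int (m i) - real_of_int (k i))"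
  define \<beta> where "\<beta> = (\<lambda>i. real_of_int (k i) - real_of_int (b i - 1))"
  have d01: "d (class_vertex N0) (class_vertex N1) = apartment_norm \<beta>"
    unfolding N0 k dist_vertices[OF w] \<beta>_def
    using apartment_norm_scale[of "-1" "\<lambda>i. real_of_int (k i) - real_of_int (b i - 1)"] by simp
  have d12: "d (class_vertex N1) (class_vertex N2) = apartment_norm \<alpha>"
    unfolding m k dist_vertices[OF w] \<alpha>_def
    using apartment_norm_scale[of "-1" "\<lambda>i. real_of_int (m i) - real_of_int (k i)"] by simp
  have d02: "d (class_vertex N0) (class_vertex N2) = apartment_norm (\<lambda>i. \<beta> i + \<alpha> i)"
    unfolding m N0 dist_vertices[OF w] \<alpha>_def \<beta>_def
    using apartment_norm_scale[of "-1" "\<lambda>i. real_of_int (m i) - real_of_int (b i - 1)"] by (simp add: algebra_simps)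
  have vert: "class_vertex N \<in> points" if "full_lattice UNIV N" for N
    using vertex_point_in_points lattice_class_vertex that by blast
  have pos: "0 < apartment_norm \<alpha>" "0 < apartment_norm \<beta>"
    using d01 d12 ne d_zero vert lats by (metis d_nonneg less_eq_real_def vertex_point_eq_iff)+
  have "apartment_norm (\<lambda>i. apartment_norm \<alpha> * \<beta> i + - apartment_norm \<beta> * \<alpha> i) = 0"
    using add unfolding d01 d12 d02 by (rule apartment_norm_add_eqD)
  then obtain c where c: "\<And>i. i < n \<Longrightarrow> apartment_norm \<alpha> * \<beta> i - apartment_norm \<beta> * \<alpha> i = c"
    unfolding apartment_norm_eq_0_iff by auto
  have \<alpha>01: "\<alpha> i = 0 \<or> \<alpha> i = 1" if "i < n" for i
  proof -
    have "m i = k i \<or> m i = k i + 1" using km that by force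
    then show ?thesis by (auto simp: \<alpha>_def)
  qed
  have \<beta>01: "\<beta> i = 0 \<or> \<beta> i = 1" if "i < n" for i
  proof -
    have "b i = k i \<or> b i = k i + 1" using kb that by force
    then show ?thesis by (auto simp: \<beta>_def)
  qed
  have "\<exists>i<n. \<alpha> i = 1"
  proof (rule ccontr)
    assume "\<not> (\<exists>i<n. \<alpha> i = 1)"
    then have "\<forall>i<n. \<alpha> i = 0" using \<alpha>01 by blast
    then show False using pos(1) apartment_norm_eq_0_iff[of \<alpha>] by auto
  qed
  moreover have "\<exists>i<n. \<alpha> i = 0"
  proof (rule ccontr)
    assume "\<not> (\<exists>i<n. \<alpha> i = 0)"
    then have "\<forall>i<n. \<alpha> i = 1" using \<alpha>01 by blast
    then show False using pos(1) apartment_norm_eq_0_iff[of \<alpha>] by auto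
  qed
  ultimately obtain i1 i0 where i1: "i1 < n" "\<alpha> i1 = 1" and i0: "i0 < n" "\<alpha> i0 = 0" by blast
  have \<alpha>\<beta>: "\<alpha> i = \<beta> i" if i: "i < n" for i
  proof (cases "\<alpha> i = 0")
    case True
    have "apartment_norm \<alpha> * \<beta> i - apartment_norm \<beta> * \<alpha> i = apartment_norm \<alpha> * \<beta> i1 - apartment_norm \<beta> * \<alpha> i1" using c i i1(1) by simp
    then have "apartment_norm \<alpha> * (\<beta> i1 - \<beta> i) = apartment_norm \<beta>" using True i1(2) by (simp add: algebra_simps)
    then have "0 < apartment_norm \<alpha> * (\<beta> i1 - \<beta> i)" using pos by simp
    then have "\<beta> i < \<beta> i1" using pos by (simp add: zero_less_mult_iff)
    then show ?thesis using \<beta>01[OF i] \<beta>01[OF i1(1)] True by auto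
  next
    case False
    then have 1: "\<alpha> i = 1" using \<alpha>01[OF i] by blast
    have "apartment_norm \<alpha> * \<beta> i - apartment_norm \<beta> * \<alpha> i = apartment_norm \<alpha> * \<beta> i0 - apartment_norm \<beta> * \<alpha> i0" using c i i0(1) by simp
    then have "apartment_norm \<alpha> * (\<beta> i - \<beta> i0) = apartment_norm \<beta>" using 1 i0(2) by (simp add: algebra_simps)
    then have "0 < apartment_norm \<alpha> * (\<beta> i - \<beta> i0)" using pos by simp
    then have "\<beta> i0 < \<beta> i" using pos by (simp add: zero_less_mult_iff)
    then show ?thesis using \<beta>01[OF i] \<beta>01[OF i0(1)] 1 by auto
  qed
  have alt: "m i = k i \<or> b i = k i" if "i < n" for i
    using \<alpha>\<beta>[OF that] \<alpha>01[OF that] by (auto simp: \<alpha>_def \<beta>_def)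
  obtain a where a: "x = (\<Sum>i<n. (\<pi> powi k i * a i) \<odot> w i)" "\<forall>i<n. a i \<in> valuation_ring"
    using x unfolding k basis_lattice_def by blast
  define y where "y = (\<Sum>i<n. (\<pi> powi m i * (if m i = k i then a i else 0)) \<odot> w i)"
  define z where "z = (\<Sum>i<n. (\<pi> powi b i * (if m i = k i then 0 else a i)) \<odot> w i)"
  have "y \<in> N2" unfolding m basis_lattice_def y_def using a(2)
    by (intro CollectI exI[of _ "\<lambda>i. if m i = k i then a i else 0"]) (auto simp: valuation_ring_def)
  moreover have "z \<in> scale \<pi> ` N0" unfolding b basis_lattice_def z_def using a(2)
    by (intro CollectI exI[of _ "\<lambda>i. if m i = k i then 0 else a i"]) (auto simp: valuation_ring_def)
  moreover have "x = y + z" unfolding a(1) y_def z_def sum.distrib[symmetric]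
  proof (rule sum.cong[OF refl])
    fix i assume "i \<in> {..<n}"
    then have "m i = k i \<or> b i = k i" using alt by simp
    then show "(\<pi> powi k i * a i) \<odot> w i = (\<pi> powi m i * (if m i = k i then a i else 0)) \<odot> w i +
        (\<pi> powi b i * (if m i = k i then 0 else a i)) \<odot> w i" by auto
  qed
  ultimately show ?thesis by blast
qed

end

section \<open>Straight chains of lattices\<close>

context padic_vector_space begin

definition pi_scale :: "int \<Rightarrow> 'v set \<Rightarrow> 'v set" where
  "pi_scale j X = scale (\<pi> powi j) ` X"

lemma pi_scale_pi_scale: "pi_scale a (pi_scale b X) = pi_scale (a + b) X"
  by (simp add: pi_scale_def scale_image_scale power_int_add)

lemma pi_scale_0 [simp]: "pi_scale 0 X = X" by (simp add: pi_scale_def)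

lemma pi_scale_1: "pi_scale 1 X = scale \<pi> ` X" by (simp add: pi_scale_def)

lemma mem_pi_scale_iff: "x \<in> pi_scale j X \<longleftrightarrow> (\<pi> powi (- j)) \<odot> x \<in> X"
  by (simp add: pi_scale_def mem_scale_image power_int_minus)

lemma pi_scale_I: "x \<in> X \<Longrightarrow> (\<pi> powi j) \<odot> x \<in> pi_scale j X"
  by (simp add: pi_scale_def)

lemma pi_scale_E:
  assumes "x \<in> pi_scale j X" obtains y where "x = (\<pi> powi j) \<odot> y" "y \<in> X"
  using assms by (auto simp: pi_scale_def)

lemma pi_scale_mono: "X \<subseteq> Y \<Longrightarrow> pi_scale j X \<subseteq> pi_scale j Y"
  unfolding pi_scale_def by (rule image_mono)

lemma pi_scale_subset_iff: "pi_scale j X \<subseteq> pi_scale j Y \<longleftrightarrow> X \<subseteq> Y"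
  using pi_scale_mono[of X Y j] pi_scale_mono[of "pi_scale j X" "pi_scale j Y" "- j"] by (auto simp: pi_scale_pi_scale)

lemma pi_scale_subset:
  assumes "submodule X" "b \<le> a"
  shows "pi_scale a X \<subseteq> pi_scale b X"
proof -
  have "pi_scale (a - b) X \<subseteq> X"
    using submodule_scale[OF assms(1), of "\<pi> powi (a - b)"] assms(2) q_powi_le_iff[of "a - b" 0]
    by (auto simp: nv_pi_powi pi_scale_def simp del: q_powi_le_iff)
  then have "pi_scale b (pi_scale (a - b) X) \<subseteq> pi_scale b X" by (rule pi_scale_mono)
  then show ?thesis by (simp add: pi_scale_pi_scale)
qed

lemma submodule_pi_scale: "submodule X \<Longrightarrow> submodule (pi_scale j X)"
  unfolding submodule_def
proof (elim conjE, intro conjI ballI allI impI)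
  assume X: "0 \<in> X" "\<forall>x\<in>X. \<forall>y\<in>X. x + y \<in> X" "\<forall>c x. nv c \<le> 1 \<longrightarrow> x \<in> X \<longrightarrow> c \<odot> x \<in> X"
  show "0 \<in> pi_scale j X" using X(1) by (simp add: mem_pi_scale_iff)
  show "x + y \<in> pi_scale j X" if "x \<in> pi_scale j X" "y \<in> pi_scale j X" for x y
    using X(2) that unfolding mem_pi_scale_iff by (simp add: scale_right_distrib)
  show "c \<odot> x \<in> pi_scale j X" if "nv c \<le> 1" "x \<in> pi_scale j X" for c x
    using X(3) that unfolding mem_pi_scale_iff scale_left_commute[of "\<pi> powi (- j)" c] by blast
qed

lemma full_lattice_pi_scale: "full_lattice U L \<Longrightarrow> full_lattice U (pi_scale j L)"
  unfolding pi_scale_def by (rule full_lattice_scale) simp_all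

lemma full_lattice_submodule: "full_lattice U L \<Longrightarrow> submodule L"
  by (simp add: full_lattice_def)

lemma full_lattice_commensurable:
  assumes "full_lattice U L" "full_lattice U A"
  obtains c where "c \<ge> 0" "pi_scale c A \<subseteq> L"
proof -
  obtain S k l where S: "finite S" "independent S" "span S = U" "L = box S k" "A = box S l"
    using common_basis_two[OF assms] by blast
  define c where "c = (\<Sum>b\<in>S. \<bar>k b - l b\<bar>)"
  have c: "k b \<le> l b + c" if "b \<in> S" for b
  proof -
    have "\<bar>k b - l b\<bar> \<le> c" unfolding c_def by (rule member_le_sum[OF that]) (auto simp: S(1))
    then show ?thesis by linarith
  qed
  have "pi_scale c A \<subseteq> L"
  proof
    fix x assume "x \<in> pi_scale c A"
    then obtain y where y: "x = (\<pi> powi c) \<odot> y" "y \<in> A" by (rule pi_scale_E)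
    then have ys: "y \<in> span S" "\<forall>b\<in>S. nv (representation S y b) \<le> q powi l b"
      unfolding S(5) mem_box_iff[OF S(1,2)] by auto
    have "nv (representation S x b) \<le> q powi k b" if b: "b \<in> S" for b
    proof -
      have "nv (representation S x b) = q powi c * nv (representation S y b)"
        unfolding y(1) using ys(1) S(2) by (simp add: representation_scale nv_mult nv_pi_powi)
      also have "\<dots> \<le> q powi c * q powi l b" using ys(2) b by (intro mult_left_mono) auto
      also have "\<dots> = q powi (l b + c)" by (simp add: power_int_add mult.commute)
      also have "\<dots> \<le> q powi k b" using c[OF b] by simp
      finally show ?thesis .
    qed
    then show "x \<in> L" unfolding S(4) mem_box_iff[OF S(1,2)] using ys(1) y(1) by (auto intro: span_scale)
  qed
  moreover have "c \<ge> 0" unfolding c_def by (intro sum_nonneg) simp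
  ultimately show ?thesis using that by blast
qed

text \<open>
  Such chains represent the vertices of bi-infinite paths of edges; the last condition is the straightness
  obtained in \<open>straight_edges\<close>.
\<close>

definition straight_chain :: "(int \<Rightarrow> 'v set) \<Rightarrow> bool" where
  "straight_chain N \<longleftrightarrow> (\<forall>k. full_lattice UNIV (N k)) \<and> (\<forall>k. N (k + 1) \<subset> N k) \<and> (\<forall>k. pi_scale 1 (N k) \<subset> N (k + 1)) \<and>
    (\<forall>k. \<forall>x\<in>N k. \<exists>y\<in>N (k + 1). \<exists>z\<in>pi_scale 1 (N (k - 1)). x = y + z)"

lemma straight_chainD:
  assumes "straight_chain N"
  shows "full_lattice UNIV (N k)" "N (k + 1) \<subset> N k" "pi_scale 1 (N k) \<subset> N (k + 1)"
    "x \<in> N k \<Longrightarrow> \<exists>y\<in>N (k + 1). \<exists>z\<in>pi_scale 1 (N (k - 1)). x = y + z"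
  using assms by (simp_all add: straight_chain_def)

lemma straight_chain_antimono:
  assumes "straight_chain N" "j \<le> k"
  shows "N k \<subseteq> N j"
  using assms(2)
proof (induction k rule: int_ge_induct)
  case (step i)
  then show ?case using straight_chainD(2)[OF assms(1), of i] by blast
qed simp

lemma straight_chain_pi_scale:
  assumes "straight_chain N" "0 \<le> a"
  shows "pi_scale a (N k) \<subseteq> N (k + a)"
  using assms(2)
proof (induction a rule: int_ge_induct)
  case (step i)
  have "pi_scale (i + 1) (N k) = pi_scale 1 (pi_scale i (N k))" by (simp add: pi_scale_pi_scale add.commute)
  also have "\<dots> \<subseteq> pi_scale 1 (N (k + i))" by (rule pi_scale_mono[OF step.IH])
  also have "\<dots> \<subseteq> N (k + (i + 1))" using straight_chainD(3)[OF assms(1), of "k + i"] by (simp add: add.assoc)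
  finally show ?case .
qed simp

text \<open>
  The chain of the same path in the opposite direction. It exchanges the two ends in all that follows.
\<close>

lemma straight_chain_reverse:
  assumes "straight_chain N"
  shows "straight_chain (\<lambda>k. pi_scale k (N (- k)))"
proof -
  note D = straight_chainD[OF assms]
  have 1: "full_lattice UNIV (pi_scale k (N (- k)))" for k by (rule full_lattice_pi_scale[OF D(1)])
  have strict: "pi_scale j X \<subset> pi_scale j Y" if "X \<subset> Y" for j X Y
    using that pi_scale_subset_iff by (metis psubset_eq subset_not_subset_eq)
  have "pi_scale 1 (N (- k - 1)) \<subset> N (- k)" for k using D(3)[of "- k - 1"] by simp
  from strict[OF this, of _ k for k] have 2: "pi_scale (k + 1) (N (- (k + 1))) \<subset> pi_scale k (N (- k))" for k
    by (simp add: pi_scale_pi_scale)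
  have 3: "pi_scale 1 (pi_scale k (N (- k))) \<subset> pi_scale (k + 1) (N (- (k + 1)))" for k
  proof -
    have "pi_scale (k + 1) (N (- k)) \<subset> pi_scale (k + 1) (N (- (k + 1)))"
      by (rule strict) (use D(2)[of "- (k + 1)"] in simp)
    then show ?thesis unfolding pi_scale_pi_scale add.commute[of 1 k] .
  qed
  have 4: "\<exists>y\<in>pi_scale (k + 1) (N (- (k + 1))). \<exists>z\<in>pi_scale 1 (pi_scale (k - 1) (N (- (k - 1)))). x = y + z"
    if "x \<in> pi_scale k (N (- k))" for k x
  proof -
    obtain x' where x': "x = (\<pi> powi k) \<odot> x'" "x' \<in> N (- k)"
      using \<open>x \<in> pi_scale k (N (- k))\<close> by (rule pi_scale_E)
    obtain y z where yz: "y \<in> N (- k + 1)" "z \<in> pi_scale 1 (N (- k - 1))" "x' = y + z" using D(4)[OF x'(2)] by blast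
    have "(\<pi> powi k) \<odot> z \<in> pi_scale k (pi_scale 1 (N (- k - 1)))" using yz(2) by (rule pi_scale_I)
    then have "(\<pi> powi k) \<odot> z \<in> pi_scale (k + 1) (N (- (k + 1)))" by (simp add: pi_scale_pi_scale)
    moreover have "(\<pi> powi k) \<odot> y \<in> pi_scale k (N (- k + 1))" using yz(1) by (rule pi_scale_I)
    then have "(\<pi> powi k) \<odot> y \<in> pi_scale 1 (pi_scale (k - 1) (N (- (k - 1))))" by (simp add: pi_scale_pi_scale)
    moreover have "x = (\<pi> powi k) \<odot> z + (\<pi> powi k) \<odot> y" using x'(1) yz(3) by (simp add: scale_right_distrib)
    ultimately show ?thesis by blast
  qed
  show ?thesis unfolding straight_chain_def using 1 2 3 4 by blast
qed

lemma straight_chain_sum1: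
  assumes "straight_chain N" "x \<in> N k"
  shows "\<exists>y\<in>N (k + int a). \<exists>z\<in>pi_scale 1 (N (k - 1)). x = y + z"
proof (induction a)
  case 0
  have "0 \<in> pi_scale 1 (N (k - 1))"
    by (rule submodule_0[OF submodule_pi_scale[OF full_lattice_submodule[OF straight_chainD(1)[OF assms(1)]]]])
  then show ?case using assms(2) by (intro bexI[of _ x] bexI[of _ 0]) auto
next
  case (Suc a)
  then obtain y z where yz: "y \<in> N (k + int a)" "z \<in> pi_scale 1 (N (k - 1))" "x = y + z" by blast
  obtain y' z' where yz': "y' \<in> N (k + int a + 1)" "z' \<in> pi_scale 1 (N (k + int a - 1))" "y = y' + z'"
    using straight_chainD(4)[OF assms(1) yz(1)] by blast
  have "pi_scale 1 (N (k + int a - 1)) \<subseteq> pi_scale 1 (N (k - 1))"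
    by (rule pi_scale_mono[OF straight_chain_antimono[OF assms(1)]]) simp
  then have "z' + z \<in> pi_scale 1 (N (k - 1))" using yz(2) yz'(2)
    submodule_add[OF submodule_pi_scale[OF full_lattice_submodule[OF straight_chainD(1)[OF assms(1)]]]] by blast
  moreover have "y' \<in> N (k + int (Suc a))" using yz'(1) by (simp add: add.commute add.left_commute)
  moreover have "x = y' + (z' + z)" using yz(3) yz'(3) by (simp add: add.assoc)
  ultimately show ?case by blast
qed

lemma straight_chain_sum:
  assumes "straight_chain N" "x \<in> N k" "0 \<le> a" "0 \<le> b"
  shows "\<exists>y\<in>N (k + a). \<exists>z\<in>pi_scale b (N (k - b)). x = y + z"
  using assms(4)
proof (induction b rule: int_ge_induct)
  case base
  have "0 \<in> N (k + a)"
    by (rule submodule_0[OF full_lattice_submodule[OF straight_chainD(1)[OF assms(1)]]])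
  then show ?case using assms(2) by (intro bexI[of _ 0] bexI[of _ x]) auto
next
  case (step b)
  then obtain y z where yz: "y \<in> N (k + a)" "z \<in> pi_scale b (N (k - b))" "x = y + z" by blast
  obtain z1 where z1: "z = (\<pi> powi b) \<odot> z1" "z1 \<in> N (k - b)" using yz(2) by (rule pi_scale_E)
  have "k + a = (k - b) + int (nat (a + b))" using step.hyps assms(3) by simp
  then obtain y' z' where yz': "y' \<in> N (k + a)" "z' \<in> pi_scale 1 (N (k - b - 1))" "z1 = y' + z'"
    using straight_chain_sum1[OF assms(1) z1(2), of "nat (a + b)"] by metis
  have sub: "submodule (N (k + a))" by (rule full_lattice_submodule[OF straight_chainD(1)[OF assms(1)]])
  have "(\<pi> powi b) \<odot> y' \<in> pi_scale b (N (k + a))" using yz'(1) by (rule pi_scale_I)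
  then have "(\<pi> powi b) \<odot> y' \<in> N (k + a)" using pi_scale_subset[OF sub, of 0 b] step.hyps by auto
  then have 1: "y + (\<pi> powi b) \<odot> y' \<in> N (k + a)" by (rule submodule_add[OF sub yz(1)])
  have "(\<pi> powi b) \<odot> z' \<in> pi_scale b (pi_scale 1 (N (k - b - 1)))" using yz'(2) by (rule pi_scale_I)
  then have 2: "(\<pi> powi b) \<odot> z' \<in> pi_scale (b + 1) (N (k - (b + 1)))" by (simp add: pi_scale_pi_scale algebra_simps)
  have "x = (y + (\<pi> powi b) \<odot> y') + (\<pi> powi b) \<odot> z'"
    using yz(3) z1(1) yz'(3) by (simp add: scale_right_distrib add.assoc)
  then show ?case using 1 2 by blast
qed

text \<open>
  Otherwise \<open>\<pi>\<^sup>k N\<^sub>j\<close> would be contained in \<open>N\<^sub>j\<^sub>+\<^sub>k\<^sub>+\<^sub>1\<close>, and then so would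
  \<open>N\<^sub>j\<^sub>+\<^sub>k = N\<^sub>j\<^sub>+\<^sub>k\<^sub>+\<^sub>1 + \<pi>\<^sup>k N\<^sub>j\<close>.
\<close>

lemma straight_chain_not_subset:
  assumes "straight_chain N" "0 \<le> k"
  shows "\<not> pi_scale (k - 1) (N j) \<subseteq> N (j + k)"
proof
  assume sub: "pi_scale (k - 1) (N j) \<subseteq> N (j + k)"
  have "pi_scale k (N j) = pi_scale 1 (pi_scale (k - 1) (N j))" by (simp add: pi_scale_pi_scale)
  also have "\<dots> \<subseteq> pi_scale 1 (N (j + k))" by (rule pi_scale_mono[OF sub])
  also have "\<dots> \<subseteq> N (j + k + 1)" using straight_chainD(3)[OF assms(1)] by blast
  finally have *: "pi_scale k (N j) \<subseteq> N (j + k + 1)" .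
  have "N (j + k) \<subseteq> N (j + k + 1)"
  proof
    fix x assume "x \<in> N (j + k)"
    then obtain y z where "y \<in> N (j + k + 1)" "z \<in> pi_scale k (N (j + k - k))" "x = y + z"
      using straight_chain_sum[OF assms(1), of x "j + k" 1 k] assms(2) by auto
    then show "x \<in> N (j + k + 1)"
      using * submodule_add[OF full_lattice_submodule[OF straight_chainD(1)[OF assms(1)]]] by auto
  qed
  then show False using straight_chainD(2)[OF assms(1), of "j + k"] by blast
qed

lemma pi_scale_lattice_subset_iff:
  assumes "straight_chain N"
  shows "pi_scale a (N k) \<subseteq> pi_scale b (N k) \<longleftrightarrow> b \<le> a"
proof
  have sub: "submodule (N k)" by (rule full_lattice_submodule[OF straight_chainD(1)[OF assms]])
  assume *: "pi_scale a (N k) \<subseteq> pi_scale b (N k)"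
  show "b \<le> a"
  proof (rule ccontr)
    assume "\<not> b \<le> a"
    then have "pi_scale (b - a) (N k) \<subseteq> pi_scale 1 (N k)" using pi_scale_subset[OF sub] by simp
    moreover have "pi_scale (- a) (pi_scale a (N k)) \<subseteq> pi_scale (- a) (pi_scale b (N k))" by (rule pi_scale_mono[OF *])
    then have "N k \<subseteq> pi_scale (b - a) (N k)" by (simp add: pi_scale_pi_scale)
    ultimately have "N k \<subseteq> pi_scale 1 (N k)" by (rule subset_trans[rotated])
    then show False using straight_chainD(2,3)[OF assms, of k] by blast
  qed
qed (rule pi_scale_subset[OF full_lattice_submodule[OF straight_chainD(1)[OF assms]]])

subsection \<open>Splitting a straight chain\<close>

definition idempotent_preserving :: "'v set \<Rightarrow> ('v \<Rightarrow> 'v) \<Rightarrow> bool" where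
  "idempotent_preserving W \<epsilon> \<longleftrightarrow> (\<forall>x y. \<epsilon> (x + y) = \<epsilon> x + \<epsilon> y) \<and> (\<forall>c x. \<epsilon> (c \<odot> x) = c \<odot> \<epsilon> x) \<and>
     (\<forall>x. \<epsilon> (\<epsilon> x) = \<epsilon> x) \<and> \<epsilon> ` W \<subseteq> W"

text \<open>
  The matrix unit \<open>E\<^sub>i\<^sub>j\<close>, which sends \<open>x\<close> to its \<open>j\<close>-coordinate times \<open>i\<close>, is for \<open>i \<noteq> j\<close> the difference
  of the idempotents \<open>E\<^sub>i\<^sub>i + E\<^sub>i\<^sub>j\<close> and \<open>E\<^sub>i\<^sub>i\<close>. Both preserve the span of \<open>S1\<close> because \<open>j\<close> is not in \<open>S1\<close>.
\<close>

lemma matrix_unit_bound: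
  assumes S: "finite S" "independent S" "span S = UNIV" "S1 \<subseteq> S" "j \<in> S" "j \<notin> S1" "i \<in> S"
    and N: "\<forall>k. submodule (N k)"
    and \<epsilon>: "\<And>\<epsilon>. idempotent_preserving (span S1) \<epsilon> \<Longrightarrow> \<exists>C\<ge>0. \<forall>k\<ge>0::int. \<forall>x\<in>N k. \<epsilon> x \<in> pi_scale (- C) (N k)"
  shows "\<exists>C\<ge>0. \<forall>k\<ge>0. \<forall>x\<in>N k. representation S x j \<odot> i \<in> pi_scale (- C) (N k)"
proof -
  have ri: "representation S i b = (if b = i then 1 else 0)" for b
    using representation_basis[OF S(2,7)] by simp
  have zero: "representation S x j = 0" if "x \<in> span S1" for x
    using representation_extend[OF S(2) that S(4)] representation_ne_zero[of S1 x j] S(6) by auto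
  have diag: "idempotent_preserving (span S1) (\<lambda>x. representation S x i \<odot> i)"
    unfolding idempotent_preserving_def
  proof (intro conjI allI subsetI)
    fix y assume "y \<in> (\<lambda>x. representation S x i \<odot> i) ` span S1"
    then obtain x where x: "x \<in> span S1" "y = representation S x i \<odot> i" by blast
    show "y \<in> span S1"
    proof (cases "i \<in> S1")
      case True
      then show ?thesis unfolding x(2) by (intro span_scale span_base)
    next
      case False
      then have "representation S x i = 0"
        using representation_extend[OF S(2) x(1) S(4)] representation_ne_zero[of S1 x i] by auto
      then show ?thesis unfolding x(2) by (simp add: span_zero)
    qed
  qed (simp_all add: representation_add representation_scale S(2,3) scale_left_distrib ri)
  obtain C1 where C1: "C1 \<ge> 0" "\<forall>k\<ge>0. \<forall>x\<in>N k. representation S x i \<odot> i \<in> pi_scale (- C1) (N k)"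
    using \<epsilon>[OF diag] by blast
  show ?thesis
  proof (cases "i = j")
    case True
    then show ?thesis using C1 by blast
  next
    case False
    define \<delta> where "\<delta> = (\<lambda>x. (representation S x i + representation S x j) \<odot> i)"
    have "idempotent_preserving (span S1) \<delta>"
      unfolding idempotent_preserving_def
    proof (intro conjI allI subsetI)
      fix y assume "y \<in> \<delta> ` span S1"
      then obtain x where x: "x \<in> span S1" "y = \<delta> x" by blast
      then have "y = representation S x i \<odot> i" using zero unfolding \<delta>_def by simp
      then show "y \<in> span S1" using diag x(1) unfolding idempotent_preserving_def by blast
    qed (use False in \<open>simp_all add: \<delta>_def representation_add representation_scale S(2,3) ri algebra_simps\<close>)
    then obtain C2 where C2: "C2 \<ge> 0" "\<forall>k\<ge>0. \<forall>x\<in>N k. \<delta> x \<in> pi_scale (- C2) (N k)" using \<epsilon> by blast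
    have "representation S x j \<odot> i \<in> pi_scale (- (C1 + C2)) (N k)" if k: "0 \<le> k" and x: "x \<in> N k" for k x
    proof -
      have sub: "submodule (pi_scale (- (C1 + C2)) (N k))" using N submodule_pi_scale by blast
      have "representation S x i \<odot> i \<in> pi_scale (- (C1 + C2)) (N k)"
        using C1(2) k x pi_scale_subset[of "N k" "- (C1 + C2)" "- C1"] N C2(1) by auto
      moreover have "\<delta> x \<in> pi_scale (- (C1 + C2)) (N k)"
        using C2(2) k x pi_scale_subset[of "N k" "- (C1 + C2)" "- C2"] N C1(1) by auto
      ultimately have "\<delta> x - representation S x i \<odot> i \<in> pi_scale (- (C1 + C2)) (N k)"
        using submodule_diff[OF sub] by blast
      then show ?thesis by (simp add: \<delta>_def scale_left_distrib)
    qed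
    then show ?thesis using C1(1) C2(1) by (intro exI[of _ "C1 + C2"]) auto
  qed
qed

text \<open>
  Let \<open>x\<^sub>j\<close> be a coordinate of \<open>x \<in> N\<^sub>k\<close> with \<open>j\<close> outside \<open>S1\<close>. The matrix units put \<open>x\<^sub>j\<close> times every basis
  vector, hence \<open>x\<^sub>j N\<^sub>0\<close>, into \<open>N\<^sub>k\<close> up to a bounded power of \<open>\<pi>\<close>. By \<open>straight_chain_not_subset\<close> this
  bounds \<open>x\<^sub>j\<close>.
\<close>

lemma complementary_coordinate_bound:
  assumes N: "straight_chain N"
    and S: "finite S" "independent S" "span S = UNIV" "S1 \<subseteq> S"
    and \<epsilon>: "\<And>\<epsilon>. idempotent_preserving (span S1) \<epsilon> \<Longrightarrow> \<exists>C\<ge>0. \<forall>k\<ge>0. \<forall>x\<in>N k. \<epsilon> x \<in> pi_scale (- C) (N k)"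
  obtains C where "\<And>k x b. 0 \<le> k \<Longrightarrow> x \<in> N k \<Longrightarrow> b \<in> S - S1 \<Longrightarrow> nv (representation S x b) \<le> q powi (k - C)"
proof -
  have sub: "submodule (N k)" for k by (rule full_lattice_submodule[OF straight_chainD(1)[OF N]])
  define P where "P = (\<lambda>i j C. C \<ge> 0 \<and> (\<forall>k\<ge>0. \<forall>x\<in>N k. representation S x j \<odot> i \<in> pi_scale (- C) (N k)))"
  define c where "c = (\<lambda>i j. SOME C. P i j C)"
  have "P i j (c i j)" if "j \<in> S - S1" "i \<in> S" for i j
  proof -
    have "\<exists>C. P i j C" unfolding P_def
      using matrix_unit_bound[OF S, of j i N] that sub \<epsilon> by blast
    then show ?thesis unfolding c_def by (rule someI_ex)
  qed
  then have c: "\<And>i j. j \<in> S - S1 \<Longrightarrow> i \<in> S \<Longrightarrow> 0 \<le> c i j"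
    "\<And>i j k x. j \<in> S - S1 \<Longrightarrow> i \<in> S \<Longrightarrow> 0 \<le> k \<Longrightarrow> x \<in> N k \<Longrightarrow> representation S x j \<odot> i \<in> pi_scale (- c i j) (N k)"
    unfolding P_def by blast+
  define C where "C = (\<Sum>i\<in>S. \<Sum>j\<in>S - S1. c i j)"
  have C: "c i j \<le> C" if "j \<in> S - S1" "i \<in> S" for i j
  proof -
    have "c i j \<le> (\<Sum>j\<in>S - S1. c i j)" by (rule member_le_sum[OF that(1)]) (use S(1) c(1) that in auto)
    also have "\<dots> \<le> C" unfolding C_def
      by (rule member_le_sum[OF that(2)]) (use S(1) c(1) in \<open>auto intro!: sum_nonneg\<close>)
    finally show ?thesis .
  qed
  have "full_lattice UNIV (box S (\<lambda>_. 0))" using full_lattice_box[OF S(1)] S(3) by simp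
  then obtain c0 where c0: "c0 \<ge> 0" "pi_scale c0 (N 0) \<subseteq> box S (\<lambda>_. 0)"
    using full_lattice_commensurable straight_chainD(1)[OF N] by metis
  have "nv (representation S x j) \<le> q powi (k - (C + c0))"
    if k: "0 \<le> k" and x: "x \<in> N k" and j: "j \<in> S - S1" for k x j
  proof (cases "representation S x j = 0")
    case False
    then obtain e where e: "nv (representation S x j) = q powi e" using nv_value by blast
    let ?a = "representation S x j * \<pi> powi (C + c0)"
    have unit: "representation S x j \<odot> i \<in> pi_scale (- C) (N k)" if "i \<in> S" for i
      using c(2)[OF j that k x] pi_scale_subset[OF sub, of "- C" "- c i j"] C[OF j that] by auto
    have "scale ?a ` N 0 \<subseteq> N k"
    proof
      fix z assume "z \<in> scale ?a ` N 0"
      then obtain y where y: "y \<in> N 0" "z = ?a \<odot> y" by blast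
      then have "(\<pi> powi c0) \<odot> y \<in> box S (\<lambda>_. 0)" using c0(2) pi_scale_I[of y] by blast
      then obtain a where a: "(\<pi> powi c0) \<odot> y = (\<Sum>b\<in>S. a b \<odot> b)" "\<forall>b\<in>S. nv (a b) \<le> 1"
        unfolding box_def by auto
      have "(representation S x j) \<odot> ((\<pi> powi c0) \<odot> y) = (\<Sum>b\<in>S. a b \<odot> (representation S x j \<odot> b))"
        unfolding a(1) by (simp add: scale_sum_right mult.commute)
      also have "\<dots> \<in> pi_scale (- C) (N k)"
        by (rule submodule_sum[OF submodule_pi_scale[OF sub]], rule submodule_scale[OF submodule_pi_scale[OF sub]])
          (use a(2) unit in auto)
      finally have "(\<pi> powi C) \<odot> ((representation S x j) \<odot> ((\<pi> powi c0) \<odot> y)) \<in> N k"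
        unfolding mem_pi_scale_iff by simp
      then show "z \<in> N k" unfolding y(2) by (simp add: power_int_add ac_simps)
    qed
    moreover have "nv ?a = q powi (e + (C + c0))" by (simp add: nv_mult e nv_pi_powi power_int_add)
    ultimately have *: "pi_scale (e + (C + c0)) (N 0) \<subseteq> N k" using scale_image_value[OF sub] unfolding pi_scale_def by metis
    have "\<not> e + (C + c0) \<le> k - 1"
    proof
      assume "e + (C + c0) \<le> k - 1"
      then have "pi_scale (k - 1) (N 0) \<subseteq> pi_scale (e + (C + c0)) (N 0)" by (rule pi_scale_subset[OF sub])
      then show False using * straight_chain_not_subset[OF N k, of 0] by auto
    qed
    then show ?thesis unfolding e by simp
  qed simp
  then show ?thesis using that by blast
qed

text \<open>
  Write \<open>x = y + z\<close> with \<open>y \<in> N\<^sub>k\<^sub>+\<^sub>a\<close> and \<open>z \<in> \<pi>\<^sup>a N\<^sub>k\<^sub>-\<^sub>a\<close> for a large \<open>a\<close>. Up to \<open>y \<in> N\<^sub>l\<close>, the projection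
  of \<open>x\<close> to the span of \<open>S1\<close> is that of \<open>z\<close> minus the complementary projection of \<open>y\<close>. Both are divisible
  by a high power of \<open>\<pi>\<close> by the two bounds.
\<close>

lemma straight_chain_projection:
  assumes N: "straight_chain N"
    and S: "finite S" "independent S" "span S = UNIV" "S1 \<subseteq> S"
    and b1: "\<And>k x b. 0 \<le> k \<Longrightarrow> x \<in> N k \<Longrightarrow> b \<in> S - S1 \<Longrightarrow> nv (representation S x b) \<le> q powi (k - C)"
    and b2: "\<And>k x b. 0 \<le> k \<Longrightarrow> x \<in> pi_scale k (N (- k)) \<Longrightarrow> b \<in> S1 \<Longrightarrow> nv (representation S x b) \<le> q powi (k - C)"
    and x: "x \<in> N k"
  shows "(\<Sum>b\<in>S1. representation S x b \<odot> b) \<in> N l"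
proof -
  have sub: "submodule (N k)" for k by (rule full_lattice_submodule[OF straight_chainD(1)[OF N]])
  have "full_lattice UNIV (box S (\<lambda>_. 0))" using full_lattice_box[OF S(1)] S(3) by simp
  then obtain c0 where c0: "c0 \<ge> 0" "pi_scale c0 (box S (\<lambda>_. 0)) \<subseteq> N 0"
    using full_lattice_commensurable straight_chainD(1)[OF N] by metis
  have small: "(\<Sum>b\<in>T. r b \<odot> b) \<in> N l"
    if T: "T \<subseteq> S" and r: "\<And>b. b \<in> T \<Longrightarrow> nv (r b) \<le> q powi m" and m: "m - c0 \<ge> max l 0" for T r m
  proof -
    have "r b \<odot> b \<in> pi_scale (m - c0) (N 0)" if b: "b \<in> T" for b
    proof -
      have "(\<pi> powi 0) \<odot> b \<in> box S (\<lambda>_. 0)" using scaled_basis_mem_box[OF S(1), of b "\<lambda>_. 0" 0] b T by auto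
      then have "(\<pi> powi c0) \<odot> b \<in> N 0" using c0(2) pi_scale_I[of b "box S (\<lambda>_. 0)"] by auto
      moreover have "nv (r b / \<pi> powi m) \<le> 1" using r[OF b] by (simp add: nv_divide nv_pi_powi)
      ultimately have "(r b / \<pi> powi m) \<odot> ((\<pi> powi c0) \<odot> b) \<in> N 0" by (rule submodule_scale[OF sub, rotated])
      moreover have "(\<pi> powi - (m - c0)) \<odot> (r b \<odot> b) = (r b / \<pi> powi m) \<odot> ((\<pi> powi c0) \<odot> b)"
      proof -
        have "\<pi> powi - (m - c0) = \<pi> powi c0 / \<pi> powi m" using power_int_diff[of \<pi> c0 m] by simp
        then show ?thesis by (simp add: mult.commute)
      qed
      ultimately show ?thesis unfolding mem_pi_scale_iff by (simp only:)
    qed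
    then have "(\<Sum>b\<in>T. r b \<odot> b) \<in> pi_scale (m - c0) (N 0)" by (rule submodule_sum[OF submodule_pi_scale[OF sub]])
    moreover have "pi_scale (m - c0) (N 0) \<subseteq> N (m - c0)"
      using straight_chain_pi_scale[OF N, of "m - c0" 0] m by simp
    moreover have "N (m - c0) \<subseteq> N l" using straight_chain_antimono[OF N] m by simp
    ultimately show ?thesis by blast
  qed
  \<comment> \<open>Large enough for both error terms to outweigh \<open>C\<close>, \<open>c0\<close> and \<open>l\<close>.\<close>
  define a where "a = \<bar>k\<bar> + \<bar>l\<bar> + \<bar>C\<bar> + c0"
  have a: "0 \<le> a" "0 \<le> k + a" "0 \<le> a - k" "l \<le> k + a" using c0(1) by (auto simp: a_def)
  have a': "k + (a + \<bar>k\<bar>) - C - c0 \<ge> max l 0" "(a + \<bar>k\<bar>) - C - c0 \<ge> max l 0" by (auto simp: a_def)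
  let ?a = "a + \<bar>k\<bar>"
  obtain y z where y: "y \<in> N (k + ?a)" and z: "z \<in> pi_scale ?a (N (k - ?a))" and xyz: "x = y + z"
    using straight_chain_sum[OF N x, of ?a ?a] a(1) by auto
  have rep: "representation S x b = representation S y b + representation S z b" for b
    unfolding xyz using S(2,3) by (simp add: representation_add)
  have "(\<Sum>b\<in>S1. representation S x b \<odot> b) =
      (\<Sum>b\<in>S1. representation S y b \<odot> b) + (\<Sum>b\<in>S1. representation S z b \<odot> b)"
    unfolding rep by (simp add: scale_left_distrib sum.distrib)
  moreover have "(\<Sum>b\<in>S1. representation S y b \<odot> b) = y - (\<Sum>b\<in>S - S1. representation S y b \<odot> b)"
  proof -
    have "y = (\<Sum>b\<in>S. representation S y b \<odot> b)"
      using sum_representation_eq[OF S(2), of y S] S(1,3) by simp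
    also have "\<dots> = (\<Sum>b\<in>S - S1. representation S y b \<odot> b) + (\<Sum>b\<in>S1. representation S y b \<odot> b)"
      by (rule sum.subset_diff[OF S(4,1)])
    finally show ?thesis by (simp add: algebra_simps)
  qed
  moreover have "l \<le> k + ?a" using a(4) by linarith
  then have "y \<in> N l" using y straight_chain_antimono[OF N] by blast
  moreover have "(\<Sum>b\<in>S - S1. representation S y b \<odot> b) \<in> N l"
  proof (rule small)
    show "nv (representation S y b) \<le> q powi (k + ?a - C)" if "b \<in> S - S1" for b
      by (rule b1[OF _ y that]) (use a in auto)
    show "max l 0 \<le> k + ?a - C - c0" by (rule a'(1))
  qed blast
  moreover have "(\<Sum>b\<in>S1. representation S z b \<odot> b) \<in> N l"
  proof (rule small[OF S(4) _ a'(2)])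
    fix b assume b: "b \<in> S1"
    have "(\<pi> powi (- k)) \<odot> z \<in> pi_scale (- k) (pi_scale ?a (N (k - ?a)))" using z by (rule pi_scale_I)
    then have "(\<pi> powi (- k)) \<odot> z \<in> pi_scale (?a - k) (N (- (?a - k)))" by (simp add: pi_scale_pi_scale algebra_simps)
    then have "nv (representation S ((\<pi> powi (- k)) \<odot> z) b) \<le> q powi (?a - k - C)"
      by (rule b2[rotated, OF _ b]) (use a in auto)
    then have "q powi (- k) * nv (representation S z b) \<le> q powi (- k) * q powi (?a - C)"
      using S(2,3) by (simp add: representation_scale nv_mult nv_pi_powi algebra_simps flip: power_int_add)
    then show "nv (representation S z b) \<le> q powi (?a - C)" by simp
  qed
  ultimately show ?thesis using submodule_add[OF sub] submodule_diff[OF sub] by metis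
qed

end

section \<open>Geodesics made of edges\<close>

lemma int_chain:
  fixes r :: "'a \<Rightarrow> 'a \<Rightarrow> bool"
  assumes "x0 \<in> S" "\<And>x. x \<in> S \<Longrightarrow> \<exists>y\<in>S. r x y" "\<And>x. x \<in> S \<Longrightarrow> \<exists>y\<in>S. r y x"
  obtains s :: "int \<Rightarrow> 'a" where "s 0 = x0" "\<And>k. s k \<in> S" "\<And>k. r (s k) (s (k + 1))"
proof -
  define f where "f = (\<lambda>x. SOME y. y \<in> S \<and> r x y)"
  define g where "g = (\<lambda>x. SOME y. y \<in> S \<and> r y x)"
  have f: "f x \<in> S \<and> r x (f x)" if "x \<in> S" for x
    unfolding f_def by (rule someI_ex) (use assms(2)[OF that] in blast)
  have g: "g x \<in> S \<and> r (g x) x" if "x \<in> S" for x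
    unfolding g_def by (rule someI_ex) (use assms(3)[OF that] in blast)
  define s where "s = (\<lambda>k::int. if k \<ge> 0 then (f ^^ nat k) x0 else (g ^^ nat (- k)) x0)"
  have fS: "(f ^^ m) x0 \<in> S" for m by (induction m) (use assms(1) f in auto)
  have gS: "(g ^^ m) x0 \<in> S" for m by (induction m) (use assms(1) g in auto)
  have "r (s k) (s (k + 1))" for k
  proof (cases "k \<ge> 0")
    case True
    then have "nat (k + 1) = Suc (nat k)" by simp
    then show ?thesis using True f[OF fS] by (simp add: s_def)
  next
    case False
    then have *: "nat (- k) = Suc (nat (- (k + 1)))" by simp
    have "s (k + 1) = (g ^^ nat (- (k + 1))) x0"
      using False by (cases "k = -1") (auto simp: s_def)
    then show ?thesis using False g[OF gS] by (simp add: s_def *)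
  qed
  moreover have "s k \<in> S" for k using fS gS by (simp add: s_def)
  ultimately show ?thesis using that[of s] by (simp add: s_def)
qed

context bruhat_tits_building begin

lemma geodesicD: "geodesic \<gamma> \<Longrightarrow> \<gamma> t \<in> points" "geodesic \<gamma> \<Longrightarrow> d (\<gamma> s) (\<gamma> t) = \<bar>s - t\<bar>"
  by (simp_all add: geodesic_def)

lemma geodesic_eq_iff: "geodesic \<gamma> \<Longrightarrow> \<gamma> s = \<gamma> t \<longleftrightarrow> s = t"
  using d_zero[of "\<gamma> s" "\<gamma> t"] geodesicD[of \<gamma>] by simp

lemma geodesic_isometry:
  fixes \<phi> :: "real \<Rightarrow> real"
  assumes "geodesic \<gamma>" "\<And>s t. \<bar>\<phi> s - \<phi> t\<bar> = \<bar>s - t\<bar>"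
  shows "geodesic (\<lambda>t. \<gamma> (\<phi> t))"
  using assms by (simp add: geodesic_def)

lemma geodesic_reverse: "geodesic \<gamma> \<Longrightarrow> geodesic (\<lambda>t. \<gamma> (- t))"
  by (rule geodesic_isometry) simp_all

lemma combinatorial_cong: "range \<gamma> = range \<gamma>' \<Longrightarrow> combinatorial \<gamma> \<longleftrightarrow> combinatorial \<gamma>'"
  by (simp add: combinatorial_def)

lemma range_reverse: "range (\<lambda>t::real. \<gamma> (- t)) = range \<gamma>"
proof -
  have "\<gamma> u \<in> range (\<lambda>t. \<gamma> (- t))" for u using rangeI[of "\<lambda>t. \<gamma> (- t)" "- u"] by simp
  then show ?thesis by blast
qed

definition traverses_edge :: "(real \<Rightarrow> 'v set set \<Rightarrow> real) \<Rightarrow> 'v set set \<Rightarrow> 'v set set \<Rightarrow> real \<Rightarrow> real \<Rightarrow> bool" where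
  "traverses_edge \<gamma> x y a b \<longleftrightarrow> edge x y \<and> a < b \<and> (\<forall>s. 0 \<le> s \<longrightarrow> s \<le> 1 \<longrightarrow> \<gamma> (a + s * (b - a)) = edge_point x y s)"

lemma traverses_edgeD:
  assumes "traverses_edge \<gamma> x y a b"
  shows "edge x y" "a < b" "0 \<le> s \<Longrightarrow> s \<le> 1 \<Longrightarrow> \<gamma> (a + s * (b - a)) = edge_point x y s"
    "\<gamma> a = vertex_point x" "\<gamma> b = vertex_point y"
proof -
  show 1: "edge x y" "a < b" "0 \<le> s \<Longrightarrow> s \<le> 1 \<Longrightarrow> \<gamma> (a + s * (b - a)) = edge_point x y s" for s
    using assms by (simp_all add: traverses_edge_def)
  show "\<gamma> a = vertex_point x" "\<gamma> b = vertex_point y" using 1(3)[of 0] 1(3)[of 1] by simp_all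
qed

lemma traverses_edge_reverse:
  assumes "traverses_edge \<gamma> x y a b"
  shows "traverses_edge (\<lambda>t. \<gamma> (- t)) y x (- b) (- a)"
  unfolding traverses_edge_def
proof (intro conjI allI impI)
  show "edge y x" "- b < - a" using traverses_edgeD[OF assms] edge_commute by auto
  fix s :: real assume s: "0 \<le> s" "s \<le> 1"
  have "- (- b + s * (- a - - b)) = a + (1 - s) * (b - a)" by (simp add: algebra_simps)
  then show "\<gamma> (- (- b + s * (- a - - b))) = edge_point y x s"
    using traverses_edgeD(3)[OF assms, of "1 - s"] s edge_point_swap[of x y "1 - s"] by simp
qed

text \<open>
  A point of the edge is determined on the real line by its distances to the two ends.
\<close>

lemma edge_in_geodesic:
  assumes \<gamma>: "geodesic \<gamma>" and xy: "edge x y" and sub: "closed_simplex {x, y} \<subseteq> range \<gamma>"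
  shows "\<exists>a b. traverses_edge \<gamma> x y a b \<or> traverses_edge \<gamma> y x a b"
proof -
  have ep: "edge_point x y s \<in> range \<gamma>" if "0 \<le> s" "s \<le> 1" for s
    using sub that unfolding closed_simplex_edge[OF xy] by auto
  obtain a where a: "\<gamma> a = vertex_point x" using ep[of 0] by (metis edge_point_0 imageE order_refl zero_le_one)
  obtain b where b: "\<gamma> b = vertex_point y" using ep[of 1] by (metis edge_point_1 imageE order_refl zero_le_one)
  have ab: "d (vertex_point x) (vertex_point y) = \<bar>a - b\<bar>" using geodesicD(2)[OF \<gamma>, of a b] a b by simp
  have "a \<noteq> b" using a b xy unfolding edge_def by (metis vertex_point_eq_iff)
  have mid: "\<gamma> (a + s * (b - a)) = edge_point x y s" if s: "0 \<le> s" "s \<le> 1" for s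
  proof -
    obtain u where u: "\<gamma> u = edge_point x y s" using ep[OF s] by (metis imageE)
    have 1: "\<bar>a - u\<bar> = s * \<bar>a - b\<bar>"
      using dist_along_edge[OF xy, of 0 s] s geodesicD(2)[OF \<gamma>, of a u] a u ab by simp
    have 2: "\<bar>b - u\<bar> = (1 - s) * \<bar>a - b\<bar>"
      using dist_along_edge[OF xy, of 1 s] s geodesicD(2)[OF \<gamma>, of b u] b u ab by simp
    have "u = a + s * (b - a)"
    proof (cases "a < b")
      case True
      define p where "p = s * (b - a)"
      have "\<bar>a - u\<bar> = p" "\<bar>b - u\<bar> = (b - a) - p" "0 \<le> p"
        using 1 2 True s by (simp_all add: p_def algebra_simps)
      then show ?thesis unfolding p_def[symmetric] using True by linarith
    next
      case False
      define p where "p = s * (a - b)"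
      have "\<bar>a - u\<bar> = p" "\<bar>b - u\<bar> = (a - b) - p" "0 \<le> p" "s * (b - a) = - p"
        using 1 2 False s by (simp_all add: p_def algebra_simps)
      then show ?thesis using False by linarith
    qed
    then show ?thesis using u by simp
  qed
  show ?thesis
  proof (cases "a < b")
    case True
    then have "traverses_edge \<gamma> x y a b" using mid xy by (simp add: traverses_edge_def)
    then show ?thesis by blast
  next
    case False
    have "traverses_edge \<gamma> y x b a" unfolding traverses_edge_def
    proof (intro conjI allI impI)
      show "edge y x" using xy edge_commute by blast
      show "b < a" using False \<open>a \<noteq> b\<close> by simp
      fix s :: real assume s: "0 \<le> s" "s \<le> 1"
      have "b + s * (a - b) = a + (1 - s) * (b - a)" by (simp add: algebra_simps)
      then show "\<gamma> (b + s * (a - b)) = edge_point y x s"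
        using mid[of "1 - s"] s edge_point_swap[of x y "1 - s"] by simp
    qed
    then show ?thesis by blast
  qed
qed

lemma traverses_edge_interval:
  assumes \<gamma>: "geodesic \<gamma>" and p: "traverses_edge \<gamma> x y a b" and u: "\<gamma> u \<in> closed_simplex {x, y}"
  shows "a \<le> u" "u \<le> b"
proof -
  obtain s where s: "\<gamma> u = edge_point x y s" "0 \<le> s" "s \<le> 1"
    using u unfolding closed_simplex_edge[OF traverses_edgeD(1)[OF p]] by auto
  then have "u = a + s * (b - a)" using traverses_edgeD(3)[OF p] geodesic_eq_iff[OF \<gamma>] by metis
  moreover have "0 \<le> s * (b - a)" "s * (b - a) \<le> b - a"
    using s traverses_edgeD(2)[OF p] by (auto intro!: mult_nonneg_nonneg mult_left_le_one_le)
  ultimately show "a \<le> u" "u \<le> b" by linarith+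
qed

lemma traverses_edge_cover:
  assumes "geodesic \<gamma>" "combinatorial \<gamma>"
  shows "\<exists>x y a b. traverses_edge \<gamma> x y a b \<and> a \<le> u \<and> u \<le> b"
proof -
  obtain E where E: "E \<subseteq> {\<sigma> \<in> simplices. card \<sigma> = 2}" "range \<gamma> = (\<Union>\<sigma>\<in>E. closed_simplex \<sigma>)"
    using assms(2) unfolding combinatorial_def by blast
  have "\<gamma> u \<in> (\<Union>\<sigma>\<in>E. closed_simplex \<sigma>)" using E(2) by blast
  then obtain \<sigma> where \<sigma>: "\<sigma> \<in> E" "\<gamma> u \<in> closed_simplex \<sigma>" by blast
  have "\<sigma> \<in> simplices" "card \<sigma> = 2" using E(1) \<sigma>(1) by auto
  then obtain x y where xy: "\<sigma> = {x, y}" "edge x y" using edge_if_card_2 by blast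
  have "closed_simplex {x, y} \<subseteq> range \<gamma>" using E(2) \<sigma>(1) unfolding xy(1)[symmetric] by blast
  then consider a b where "traverses_edge \<gamma> x y a b" | a b where "traverses_edge \<gamma> y x a b"
    using edge_in_geodesic[OF assms(1) xy(2)] by blast
  then show ?thesis
  proof cases
    case 1
    then show ?thesis using traverses_edge_interval[OF assms(1) 1] \<sigma>(2) xy(1) by blast
  next
    case 2
    have "\<gamma> u \<in> closed_simplex {y, x}" using \<sigma>(2) unfolding xy(1) by (simp add: insert_commute)
    then show ?thesis using traverses_edge_interval[OF assms(1) 2] 2 by blast
  qed
qed

lemma traverses_edge_interior:
  assumes "geodesic \<gamma>" "traverses_edge \<gamma> x y a b" "\<gamma> u = vertex_point v"
  shows "u \<le> a \<or> b \<le> u"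
proof (rule ccontr)
  assume "\<not> ?thesis"
  then have u: "a < u" "u < b" by auto
  define s where "s = (u - a) / (b - a)"
  have s: "0 < s" "s < 1" "u = a + s * (b - a)" using u by (simp_all add: s_def field_simps)
  then have "\<gamma> u = edge_point x y s" using traverses_edgeD(3)[OF assms(2), of s] by simp
  then have "supp (vertex_point v) = supp (edge_point x y s)" using assms(3) by simp
  then have "{v} = {x, y}" "x \<noteq> y"
    using supp_edge_point_interior[of x y s] s traverses_edgeD(1)[OF assms(2)] by (auto simp only: edge_def supp_vertex_point)
  then show False by (metis doubleton_eq_iff insert_absorb2)
qed

text \<open>
  The point shortly after \<open>u\<close> lies on an edge, and no edge is shorter than \<open>\<kappa>\<close>. If this edge began after
  \<open>u\<close>, there would be no room for an edge covering the time in between.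
\<close>

lemma next_edge:
  assumes \<gamma>: "geodesic \<gamma>" "combinatorial \<gamma>" and u: "\<gamma> u = vertex_point v"
  shows "\<exists>y b. traverses_edge \<gamma> v y u b"
proof -
  obtain \<kappa> where \<kappa>: "\<kappa> > 0" "\<And>x y. x \<in> vertices \<Longrightarrow> y \<in> vertices \<Longrightarrow> x \<noteq> y \<Longrightarrow> \<kappa> \<le> d (vertex_point x) (vertex_point y)"
    using dist_vertices_ge by blast
  have long: "\<kappa> \<le> b - a" if "traverses_edge \<gamma> x y a b" for x y a b
  proof -
    have "\<kappa> \<le> d (\<gamma> a) (\<gamma> b)"
      using \<kappa>(2) traverses_edgeD[OF that] edge_vertices[of x y] by (simp add: edge_def)
    then show ?thesis using geodesicD(2)[OF \<gamma>(1), of a b] traverses_edgeD(2)[OF that] by simp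
  qed
  obtain x y a b where p: "traverses_edge \<gamma> x y a b" "a \<le> u + \<kappa> / 2" "u + \<kappa> / 2 \<le> b"
    using traverses_edge_cover[OF \<gamma>] by blast
  have "u \<le> a" using traverses_edge_interior[OF \<gamma>(1) p(1) u] p(3) \<kappa>(1) by linarith
  moreover have "\<not> u < a"
  proof
    assume ua: "u < a"
    obtain x' y' a' b' where p': "traverses_edge \<gamma> x' y' a' b'" "a' \<le> (u + a) / 2" "(u + a) / 2 \<le> b'"
      using traverses_edge_cover[OF \<gamma>] by blast
    have m: "u < (u + a) / 2" "(u + a) / 2 < a" using ua by (simp_all add: field_simps)
    have "\<not> b' \<le> u" "\<not> a \<le> a'" using m p'(2,3) by linarith+
    then have "u \<le> a'" "b' \<le> a"
      using traverses_edge_interior[OF \<gamma>(1) p'(1) u] traverses_edge_interior[OF \<gamma>(1) p'(1) traverses_edgeD(4)[OF p(1)]] by blast+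
    then show False using long[OF p'(1)] p(2) \<kappa>(1) by linarith
  qed
  ultimately have "a = u" by simp
  moreover from this have "x = v" using traverses_edgeD(4)[OF p(1)] u by simp
  ultimately show ?thesis using p(1) by blast
qed

lemma previous_edge:
  assumes \<gamma>: "geodesic \<gamma>" "combinatorial \<gamma>" and u: "\<gamma> u = vertex_point v"
  shows "\<exists>y a. traverses_edge \<gamma> y v a u"
proof -
  have "combinatorial (\<lambda>t. \<gamma> (- t))" using combinatorial_cong[OF range_reverse] \<gamma>(2) by blast
  moreover have "\<gamma> (- (- u)) = vertex_point v" using u by simp
  ultimately obtain y b where "traverses_edge (\<lambda>t. \<gamma> (- t)) v y (- u) b"
    using next_edge[OF geodesic_reverse[OF \<gamma>(1)], of "- u"] by blast
  from traverses_edge_reverse[OF this] have "traverses_edge \<gamma> y v (- b) u" by simp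
  then show ?thesis by blast
qed

text \<open>
  Times and representatives are continued simultaneously, one edge at a time in both directions. The times
  cover the real line since edges have a minimal length.
\<close>

lemma combinatorial_geodesic_chain:
  assumes \<gamma>: "geodesic \<gamma>" "combinatorial \<gamma>"
  obtains t N where "straight_chain N" "\<And>k::int. traverses_edge \<gamma> (lattice_class (N k)) (lattice_class (N (k + 1))) (t k) (t (k + 1))"
    "\<And>u. \<exists>k. t k \<le> u \<and> u \<le> t (k + 1)"
proof -
  define S where "S = {(u, L). full_lattice UNIV L \<and> \<gamma> u = class_vertex L}"
  define r where "r = (\<lambda>(u, L) (u', L'). traverses_edge \<gamma> (lattice_class L) (lattice_class L') u u' \<and> scale \<pi> ` L \<subseteq> L' \<and> L' \<subseteq> L)"
  obtain x y a b where p: "traverses_edge \<gamma> x y a b" using traverses_edge_cover[OF \<gamma>] by blast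
  obtain L0 where L0: "full_lattice UNIV L0" "x = lattice_class L0"
    using edge_vertices(1)[OF traverses_edgeD(1)[OF p]] vertices_iff by blast
  have start: "(a, L0) \<in> S" using L0 traverses_edgeD(4)[OF p] by (simp add: S_def)
  have nxt: "\<exists>z'\<in>S. r z z'" if z: "z \<in> S" for z
  proof -
    obtain u L where uL: "z = (u, L)" "full_lattice UNIV L" "\<gamma> u = class_vertex L" using z by (auto simp: S_def)
    obtain y b where p: "traverses_edge \<gamma> (lattice_class L) y u b" using next_edge[OF \<gamma> uL(3)] by blast
    obtain M where M: "full_lattice UNIV M" "y = lattice_class M" "scale \<pi> ` L \<subseteq> M" "M \<subseteq> L"
      using edge_next_lattice[OF traverses_edgeD(1)[OF p] uL(2) refl] by blast
    have "(b, M) \<in> S" using M traverses_edgeD(5)[OF p] by (simp add: S_def)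
    moreover have "r z (b, M)" using p M by (simp add: r_def uL(1))
    ultimately show ?thesis by blast
  qed
  have prv: "\<exists>z'\<in>S. r z' z" if z: "z \<in> S" for z
  proof -
    obtain u L where uL: "z = (u, L)" "full_lattice UNIV L" "\<gamma> u = class_vertex L" using z by (auto simp: S_def)
    obtain y b where p: "traverses_edge \<gamma> y (lattice_class L) b u" using previous_edge[OF \<gamma> uL(3)] by blast
    obtain M where M: "full_lattice UNIV M" "y = lattice_class M" "scale \<pi> ` M \<subseteq> L" "L \<subseteq> M"
      using edge_prev_lattice[OF traverses_edgeD(1)[OF p] uL(2) refl] by blast
    have "(b, M) \<in> S" using M traverses_edgeD(4)[OF p] by (simp add: S_def)
    moreover have "r (b, M) z" using p M by (simp add: r_def uL(1))
    ultimately show ?thesis by blast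
  qed
  obtain s :: "int \<Rightarrow> real \<times> 'v set" where s: "\<And>k. s k \<in> S" "\<And>k. r (s k) (s (k + 1))"
    using int_chain[OF start nxt prv] by metis
  define t where "t = (\<lambda>k. fst (s k))"
  define N where "N = (\<lambda>k. snd (s k))"
  have sk: "s k = (t k, N k)" for k by (simp add: t_def N_def)
  have N: "full_lattice UNIV (N k)" "\<gamma> (t k) = class_vertex (N k)" for k using s(1)[of k] by (simp_all add: S_def sk)
  have P: "traverses_edge \<gamma> (lattice_class (N k)) (lattice_class (N (k + 1))) (t k) (t (k + 1))"
    "pi_scale 1 (N k) \<subseteq> N (k + 1)" "N (k + 1) \<subseteq> N k" for k
    using s(2)[of k] by (simp_all add: r_def sk pi_scale_1)
  have ne: "lattice_class (N k) \<noteq> lattice_class (N (k + 1))" for k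
    using traverses_edgeD(1)[OF P(1)] by (simp add: edge_def)
  have tlt: "t k < t (k + 1)" for k using traverses_edgeD(2)[OF P(1)] .
  have dd: "d (class_vertex (N i)) (class_vertex (N j)) = \<bar>t i - t j\<bar>" for i j
    using geodesicD(2)[OF \<gamma>(1), of "t i" "t j"] N(2) by simp
  have "straight_chain N" unfolding straight_chain_def
  proof (intro conjI allI ballI)
    fix k
    show "full_lattice UNIV (N k)" by (rule N(1))
    show "N (k + 1) \<subset> N k" using P(3)[of k] ne[of k] by auto
    have "lattice_class (pi_scale 1 (N k)) = lattice_class (N k)" unfolding pi_scale_def by (rule lattice_class_scale) simp
    then show "pi_scale 1 (N k) \<subset> N (k + 1)" using P(2)[of k] ne[of k] by auto
    fix x assume "x \<in> N k"
    have "\<exists>y z. y \<in> N (k + 1) \<and> z \<in> N (k - 1) \<and> x = y + \<pi> \<odot> z"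
    proof (rule straight_edges[OF N(1)[of "k - 1"] N(1)[of k] N(1)[of "k + 1"] _ _ _ _ _ _ _ \<open>x \<in> N k\<close>])
      show "scale \<pi> ` N (k - 1) \<subseteq> N k" "N k \<subseteq> N (k - 1)" "lattice_class (N (k - 1)) \<noteq> lattice_class (N k)"
        using P(2,3)[of "k - 1"] ne[of "k - 1"] by (simp_all add: pi_scale_1)
      show "scale \<pi> ` N k \<subseteq> N (k + 1)" "N (k + 1) \<subseteq> N k" "lattice_class (N k) \<noteq> lattice_class (N (k + 1))"
        using P(2,3)[of k] ne[of k] by (simp_all add: pi_scale_1)
      show "d (class_vertex (N (k - 1))) (class_vertex (N (k + 1))) =
        d (class_vertex (N (k - 1))) (class_vertex (N k)) + d (class_vertex (N k)) (class_vertex (N (k + 1)))"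
        unfolding dd using tlt[of "k - 1"] tlt[of k] by simp
    qed
    then obtain y z where "y \<in> N (k + 1)" "z \<in> N (k - 1)" "x = y + \<pi> \<odot> z" by blast
    then show "\<exists>y\<in>N (k + 1). \<exists>z\<in>pi_scale 1 (N (k - 1)). x = y + z"
      using pi_scale_I[of z "N (k - 1)" 1] by auto
  qed
  moreover have "\<exists>k. t k \<le> u \<and> u \<le> t (k + 1)" for u
  proof -
    obtain \<kappa> where \<kappa>: "\<kappa> > 0" "\<And>x y. x \<in> vertices \<Longrightarrow> y \<in> vertices \<Longrightarrow> x \<noteq> y \<Longrightarrow> \<kappa> \<le> d (vertex_point x) (vertex_point y)"
      using dist_vertices_ge by blast
    have gap: "t k + \<kappa> \<le> t (k + 1)" for k
      using \<kappa>(2)[OF lattice_class_vertex[OF N(1)[of k]] lattice_class_vertex[OF N(1)[of "k + 1"]] ne] tlt[of k]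
      unfolding dd by simp
    have up: "t 0 + real m * \<kappa> \<le> t (int m)" for m
    proof (induction m)
      case (Suc m)
      then show ?case using gap[of "int m"] by (simp add: algebra_simps)
    qed simp
    have down: "t (- int m) \<le> t 0 - real m * \<kappa>" for m
    proof (induction m)
      case (Suc m)
      then show ?case using gap[of "- int (Suc m)"] by (simp add: algebra_simps)
    qed simp
    obtain m where "\<bar>u - t 0\<bar> < real m * \<kappa>" using reals_Archimedean3[OF \<kappa>(1)] by blast
    then have m: "t (- int m) \<le> u" "u < t (int m)" using up[of m] down[of m] by linarith+
    have "\<exists>k. t k \<le> u \<and> u \<le> t (k + 1)" if "t k \<le> u" "u < t (k + int j)" for k j
      using that
    proof (induction j arbitrary: k)
      case 0
      then show ?case by simp
    next
      case (Suc j)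
      show ?case
      proof (cases "t (k + 1) \<le> u")
        case True
        then show ?thesis using Suc.IH[of "k + 1"] Suc.prems(2) by (simp add: algebra_simps)
      next
        case False
        then show ?thesis using Suc.prems(1) by (intro exI[of _ k]) simp
      qed
    qed
    from this[of "- int m" "2 * m"] m show ?thesis by simp
  qed
  ultimately show ?thesis using that P(1) by blast
qed

lemma traverses_edge_image:
  assumes "traverses_edge \<gamma> x y a b"
  shows "\<gamma> ` {a..b} = closed_simplex {x, y}"
proof -
  have "\<gamma> ` {a..b} = \<gamma> ` (\<lambda>s. a + s * (b - a)) ` {0..1}"
  proof -
    have "(\<lambda>s. a + s * (b - a)) ` {0..1} = {a..b}"
    proof (intro set_eqI iffI)
      fix u assume u: "u \<in> {a..b}"
      have "u = a + ((u - a) / (b - a)) * (b - a)" "(u - a) / (b - a) \<in> {0..1}"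
        using u traverses_edgeD(2)[OF assms] by (simp_all add: field_simps)
      then show "u \<in> (\<lambda>s. a + s * (b - a)) ` {0..1}" by blast
    next
      fix u assume "u \<in> (\<lambda>s. a + s * (b - a)) ` {0..1}"
      then obtain s where "u = a + s * (b - a)" "s \<in> {0..1}" by (rule imageE)
      then have s: "u = a + s * (b - a)" "0 \<le> s" "s \<le> 1" by simp_all
      moreover have "0 \<le> s * (b - a)" "s * (b - a) \<le> 1 * (b - a)"
        using s traverses_edgeD(2)[OF assms] by (auto intro!: mult_nonneg_nonneg mult_right_mono)
      ultimately show "u \<in> {a..b}" by simp
    qed
    then show ?thesis by simp
  qed
  also have "\<dots> = edge_point x y ` {0..1}"
    unfolding image_image by (rule image_cong) (use traverses_edgeD(3)[OF assms] in auto)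
  finally show ?thesis unfolding closed_simplex_edge[OF traverses_edgeD(1)[OF assms]] .
qed

lemma range_of_edges:
  fixes v :: "int \<Rightarrow> 'v set set" and t :: "int \<Rightarrow> real"
  assumes "geodesic \<gamma>" "\<And>k. traverses_edge \<gamma> (v k) (v (k + 1)) (t k) (t (k + 1))" "\<And>u. \<exists>k. t k \<le> u \<and> u \<le> t (k + 1)"
  shows "range \<gamma> = (\<Union>k. closed_simplex {v k, v (k + 1)})" "vertices_of \<gamma> = range v"
proof -
  have "(UNIV :: real set) = (\<Union>k. {t k..t (k + 1)})" using assms(3) by fastforce
  then have "range \<gamma> = (\<Union>k. \<gamma> ` {t k..t (k + 1)})" by (metis image_UN)
  then show "range \<gamma> = (\<Union>k. closed_simplex {v k, v (k + 1)})" unfolding traverses_edge_image[OF assms(2)] .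
  show "vertices_of \<gamma> = range v"
  proof (intro set_eqI iffI)
    fix x assume "x \<in> vertices_of \<gamma>"
    then obtain u where u: "\<gamma> u = vertex_point x" unfolding vertices_of_def by (metis (mono_tags, lifting) imageE mem_Collect_eq)
    obtain k where k: "t k \<le> u" "u \<le> t (k + 1)" using assms(3) by blast
    then have "u = t k \<or> u = t (k + 1)" using traverses_edge_interior[OF assms(1,2) u, of k] by linarith
    then have "vertex_point x = vertex_point (v k) \<or> vertex_point x = vertex_point (v (k + 1))"
      using traverses_edgeD(4,5)[OF assms(2)[of k]] u by metis
    then have "x = v k \<or> x = v (k + 1)" unfolding vertex_point_eq_iff .
    then show "x \<in> range v" by blast
  next
    fix x assume "x \<in> range v"
    then obtain k where k: "x = v k" by blast
    then have "vertex_point x \<in> range \<gamma>" using traverses_edgeD(4)[OF assms(2)[of k]] by (metis rangeI)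
    moreover have "x \<in> vertices" unfolding k using edge_vertices(1)[OF traverses_edgeD(1)[OF assms(2)]] .
    ultimately show "x \<in> vertices_of \<gamma>" unfolding vertices_of_def by blast
  qed
qed

section \<open>The action on the boundary\<close>

lemma GL_iff: "g \<in> GL \<longleftrightarrow> (\<forall>x y. g (x + y) = g x + g y) \<and> (\<forall>c x. g (c \<odot> x) = c \<odot> g x) \<and> bij g"
  unfolding GL_def Vector_Spaces.linear_iff using vector_space_axioms by blast

lemma GL_D:
  assumes "g \<in> GL"
  shows "g (x + y) = g x + g y" "g (c \<odot> x) = c \<odot> g x" "bij g" "inj g" "surj g"
    "inv g (g x) = x" "g (inv g x) = x" "inv (inv g) = g"
  using assms unfolding GL_iff by (auto simp: bij_is_inj bij_is_surj surj_f_inv_f inv_inv_eq)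

lemma GL_inv:
  assumes "g \<in> GL" shows "inv g \<in> GL"
  unfolding GL_iff
proof (intro conjI allI)
  show "inv g (x + y) = inv g x + inv g y" for x y
    by (rule injD[OF GL_D(4)[OF assms]]) (simp add: GL_D[OF assms])
  show "inv g (c \<odot> x) = c \<odot> inv g x" for c x
    by (rule injD[OF GL_D(4)[OF assms]]) (simp add: GL_D[OF assms])
  show "bij (inv g)" using GL_D(3)[OF assms] by (rule bij_imp_bij_inv)
qed

lemma GL_scale_image: "g \<in> GL \<Longrightarrow> g ` scale c ` L = scale c ` g ` L"
  by (simp add: image_image GL_D(2))

lemma full_lattice_GL_image:
  assumes g: "g \<in> GL" and L: "full_lattice U L"
  shows "full_lattice (g ` U) (g ` L)"
proof -
  have sub: "submodule L" and bd: "nv_bounded L" and sp: "span L = U" using L by (auto simp: full_lattice_def)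
  have lin: "Vector_Spaces.linear scale scale g" using g by (simp add: GL_def)
  interpret g: Vector_Spaces.linear scale scale g by (rule lin)
  have "submodule (g ` L)" unfolding submodule_def
  proof (intro conjI ballI allI impI)
    show "0 \<in> g ` L" using submodule_0[OF sub] GL_D(2)[OF g, of 0 0] by (metis imageI scale_zero_left)
    show "x + y \<in> g ` L" if "x \<in> g ` L" "y \<in> g ` L" for x y
      using that submodule_add[OF sub] GL_D(1)[OF g] by (metis (no_types, lifting) image_iff)
    show "c \<odot> x \<in> g ` L" if "nv c \<le> 1" "x \<in> g ` L" for c x
      using that submodule_scale[OF sub] GL_D(2)[OF g] by (metis (no_types, lifting) image_iff)
  qed
  moreover have "span (g ` L) = g ` U"
    using g.span_image[of L] sp by simp
  moreover have "nv_bounded (g ` L)"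
  proof -
    have f: "functional (\<lambda>x. representation std_basis (g x) b)" for b
      using functional_representation[OF std_basis(2,3), of b] GL_D(1,2)[OF g] unfolding functional_def by simp
    have "\<exists>r. \<forall>x\<in>L. nv (representation std_basis (g x) b) \<le> r" for b
      using functional_bounded[OF f bd] by metis
    then obtain r where r: "\<And>b x. x \<in> L \<Longrightarrow> nv (representation std_basis (g x) b) \<le> r b" by metis
    have "nv (representation std_basis (g x) b) \<le> (\<Sum>b\<in>std_basis. \<bar>r b\<bar>)"
      if "x \<in> L" "b \<in> std_basis" for x b
    proof -
      have "nv (representation std_basis (g x) b) \<le> \<bar>r b\<bar>" using r[OF that(1), of b] by linarith
      also have "\<dots> \<le> (\<Sum>b\<in>std_basis. \<bar>r b\<bar>)" by (rule member_le_sum[OF that(2)]) (auto simp: std_basis)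
      finally show ?thesis .
    qed
    then show ?thesis unfolding nv_bounded_def by blast
  qed
  ultimately show ?thesis by (simp add: full_lattice_def)
qed

lemma full_lattice_GL_image_UNIV: "g \<in> GL \<Longrightarrow> full_lattice UNIV L \<Longrightarrow> full_lattice UNIV (g ` L)"
  using full_lattice_GL_image[of g UNIV L] GL_D(5)[of g] by simp

lemma image_lattice_class: "g \<in> GL \<Longrightarrow> (`) g ` lattice_class L = lattice_class (g ` L)"
  unfolding lattice_class_def
proof (intro set_eqI iffI)
  fix X assume g: "g \<in> GL" and "X \<in> (`) g ` {scale c ` L |c. c \<noteq> 0}"
  then obtain c where "X = g ` scale c ` L" "c \<noteq> 0" by blast
  then show "X \<in> {scale c ` g ` L |c. c \<noteq> 0}" unfolding GL_scale_image[OF g] by blast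
next
  fix X assume g: "g \<in> GL" and "X \<in> {scale c ` g ` L |c. c \<noteq> 0}"
  then obtain c where "X = g ` scale c ` L" "c \<noteq> 0" unfolding GL_scale_image[OF g, symmetric] by blast
  then show "X \<in> (`) g ` {scale c ` L |c. c \<noteq> 0}" by blast
qed

abbreviation act_class :: "('v \<Rightarrow> 'v) \<Rightarrow> 'v set set \<Rightarrow> 'v set set" where
  "act_class g x \<equiv> (`) g ` x"

lemma act_class_inverse: "g \<in> GL \<Longrightarrow> act_class (inv g) (act_class g x) = x" "g \<in> GL \<Longrightarrow> act_class g (act_class (inv g) x) = x"
  by (simp_all add: image_image GL_D)

lemma act_class_vertices: "g \<in> GL \<Longrightarrow> x \<in> vertices \<Longrightarrow> act_class g x \<in> vertices"
  unfolding vertices_iff using image_lattice_class full_lattice_GL_image_UNIV by metis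

lemma act_class_adjacent:
  assumes "g \<in> GL" "adjacent x y"
  shows "adjacent (act_class g x) (act_class g y)"
proof -
  obtain M N where MN: "M \<in> x" "N \<in> y" "scale \<pi> ` N \<subseteq> M" "M \<subseteq> N" and "x \<noteq> y"
    using assms(2) unfolding adjacent_def by blast
  have "scale \<pi> ` g ` N \<subseteq> g ` M" unfolding GL_scale_image[OF assms(1), symmetric] by (rule image_mono[OF MN(3)])
  moreover have "g ` M \<subseteq> g ` N" by (rule image_mono[OF MN(4)])
  moreover have "act_class g x \<noteq> act_class g y" using \<open>x \<noteq> y\<close> act_class_inverse(1)[OF assms(1)] by metis
  ultimately show ?thesis unfolding adjacent_def using MN(1,2) by blast
qed

lemma act_class_simplex:
  assumes "g \<in> GL" "\<sigma> \<in> simplices"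
  shows "act_class g ` \<sigma> \<in> simplices"
  unfolding simplices_def mem_Collect_eq
proof (intro conjI ballI impI)
  have \<sigma>: "finite \<sigma>" "\<sigma> \<noteq> {}" "\<sigma> \<subseteq> vertices" "\<And>x y. x \<in> \<sigma> \<Longrightarrow> y \<in> \<sigma> \<Longrightarrow> x \<noteq> y \<Longrightarrow> adjacent x y"
    using assms(2) by (simp_all add: simplices_def)
  show "finite (act_class g ` \<sigma>)" "act_class g ` \<sigma> \<noteq> {}" using \<sigma> by simp_all
  show "act_class g ` \<sigma> \<subseteq> vertices"
  proof
    fix x assume "x \<in> act_class g ` \<sigma>"
    then obtain y where "y \<in> \<sigma>" "x = act_class g y" by (rule imageE)
    then show "x \<in> vertices" using \<sigma>(3) act_class_vertices[OF assms(1)] by blast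
  qed
  fix x y assume "x \<in> act_class g ` \<sigma>" "y \<in> act_class g ` \<sigma>" "x \<noteq> y"
  then obtain x' y' where "x' \<in> \<sigma>" "x = act_class g x'" "y' \<in> \<sigma>" "y = act_class g y'" by (elim imageE)
  then show "adjacent x y" using \<sigma>(4)[of x' y'] \<open>x \<noteq> y\<close> act_class_adjacent[OF assms(1)] by metis
qed

lemma supp_act:
  assumes "g \<in> GL"
  shows "supp (act g f) = act_class g ` supp f"
proof (rule set_eqI)
  fix x
  have "x \<in> act_class g ` supp f \<longleftrightarrow> act_class (inv g) x \<in> supp f"
  proof
    assume "x \<in> act_class g ` supp f"
    then obtain y where "x = act_class g y" "y \<in> supp f" by (rule imageE)
    then show "act_class (inv g) x \<in> supp f" using act_class_inverse(1)[OF assms] by metis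
  next
    assume "act_class (inv g) x \<in> supp f"
    then have "act_class g (act_class (inv g) x) \<in> act_class g ` supp f" by (rule imageI)
    then show "x \<in> act_class g ` supp f" unfolding act_class_inverse(2)[OF assms] .
  qed
  then show "x \<in> supp (act g f) \<longleftrightarrow> x \<in> act_class g ` supp f" by (simp add: supp_def act_def)
qed

lemma act_points:
  assumes "g \<in> GL" "f \<in> points"
  shows "act g f \<in> points"
proof -
  have f: "supp f \<in> simplices" "\<And>x. f x \<ge> 0" "(\<Sum>x\<in>supp f. f x) = 1" using assms(2) by (simp_all add: points_def)
  have inj: "inj_on (act_class g) (supp f)" using act_class_inverse(1)[OF assms(1)] by (metis inj_onI)
  have "(\<Sum>x\<in>supp (act g f). act g f x) = (\<Sum>x\<in>supp f. act g f (act_class g x))"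
    unfolding supp_act[OF assms(1)] by (simp only: sum.reindex[OF inj] o_def)
  also have "\<dots> = 1" unfolding act_def act_class_inverse(1)[OF assms(1)] by (rule f(3))
  finally have "(\<Sum>x\<in>supp (act g f). act g f x) = 1" .
  moreover have "supp (act g f) \<in> simplices"
    unfolding supp_act[OF assms(1)] by (rule act_class_simplex[OF assms(1) f(1)])
  moreover have "0 \<le> act g f x" for x unfolding act_def by (rule f(2))
  ultimately show ?thesis unfolding points_def by blast
qed

lemma act_inverse: "g \<in> GL \<Longrightarrow> act g (act (inv g) f) = f" "g \<in> GL \<Longrightarrow> act (inv g) (act g f) = f"
  unfolding act_def by (simp_all only: GL_D(8) act_class_inverse)

lemma act_class_vertex:
  assumes "g \<in> GL"
  shows "act g (class_vertex L) = class_vertex (g ` L)"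
proof
  fix x
  have "act_class (inv g) x = lattice_class L \<longleftrightarrow> x = lattice_class (g ` L)"
    using act_class_inverse[OF assms] image_lattice_class[OF assms] by metis
  then show "act g (class_vertex L) x = class_vertex (g ` L) x"
    by (simp add: act_def vertex_point_def)
qed

lemma half_geodesicD:
  "half_geodesic \<rho> \<Longrightarrow> 0 \<le> t \<Longrightarrow> \<rho> t \<in> points"
  "half_geodesic \<rho> \<Longrightarrow> 0 \<le> s \<Longrightarrow> 0 \<le> t \<Longrightarrow> d (\<rho> s) (\<rho> t) = \<bar>s - t\<bar>"
  by (simp_all add: half_geodesic_def)

lemma geodesic_half: "geodesic \<gamma> \<Longrightarrow> half_geodesic \<gamma>"
  by (simp add: geodesic_def half_geodesic_def)

lemma act_half_geodesic: "g \<in> GL \<Longrightarrow> half_geodesic \<rho> \<Longrightarrow> half_geodesic (\<lambda>t. act g (\<rho> t))"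
  unfolding half_geodesic_def by (simp add: act_points dist_invariant)

lemma mem_endpoint_iff:
  "\<rho>' \<in> endpoint \<rho> \<longleftrightarrow> half_geodesic \<rho> \<and> half_geodesic \<rho>' \<and> (\<exists>C. \<forall>t\<ge>0. d (\<rho> t) (\<rho>' t) \<le> C)"
  unfolding endpoint_def asymptotic_def by simp

text \<open>
  As \<open>g\<close> acts by isometries, it suffices to test one half-geodesic of the class.
\<close>

lemma endpoint_stabilizer_iff:
  assumes \<rho>: "half_geodesic \<rho>" and g: "g \<in> GL"
  shows "act_boundary g (endpoint \<rho>) = endpoint \<rho> \<longleftrightarrow> (\<exists>C. \<forall>t\<ge>0. d (\<rho> t) (act g (\<rho> t)) \<le> C)"
proof
  assume eq: "act_boundary g (endpoint \<rho>) = endpoint \<rho>"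
  have "d (\<rho> t) (\<rho> t) \<le> 0" if "t \<ge> 0" for t using half_geodesicD(2)[OF \<rho> that that] by simp
  then have "\<rho> \<in> endpoint \<rho>" unfolding mem_endpoint_iff
    by (intro conjI \<rho> exI[of _ 0] allI impI)
  then have "(\<lambda>t. act g (\<rho> t)) \<in> act_boundary g (endpoint \<rho>)" unfolding act_boundary_def by (rule imageI)
  then have "(\<lambda>t. act g (\<rho> t)) \<in> endpoint \<rho>" unfolding eq .
  then show "\<exists>C. \<forall>t\<ge>0. d (\<rho> t) (act g (\<rho> t)) \<le> C" unfolding mem_endpoint_iff by blast
next
  assume "\<exists>C. \<forall>t\<ge>0. d (\<rho> t) (act g (\<rho> t)) \<le> C"
  then obtain C where C: "\<And>t. t \<ge> 0 \<Longrightarrow> d (\<rho> t) (act g (\<rho> t)) \<le> C" by blast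
  have move: "(\<lambda>t. act h (\<rho>' t)) \<in> endpoint \<rho>"
    if h: "h \<in> GL" and Ch: "\<And>t. t \<ge> 0 \<Longrightarrow> d (\<rho> t) (act h (\<rho> t)) \<le> C" and \<rho>': "\<rho>' \<in> endpoint \<rho>" for h \<rho>'
  proof -
    obtain C' where C': "half_geodesic \<rho>'" "\<And>t. t \<ge> 0 \<Longrightarrow> d (\<rho> t) (\<rho>' t) \<le> C'" using \<rho>' unfolding mem_endpoint_iff by blast
    have "d (\<rho> t) (act h (\<rho>' t)) \<le> C + C'" if t: "t \<ge> 0" for t
    proof -
      have pts: "\<rho> t \<in> points" "\<rho>' t \<in> points" using half_geodesicD(1) \<rho> C'(1) t by blast+
      have "d (\<rho> t) (act h (\<rho>' t)) \<le> d (\<rho> t) (act h (\<rho> t)) + d (act h (\<rho> t)) (act h (\<rho>' t))"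
        by (intro d_triangle pts act_points h)
      also have "\<dots> \<le> C + C'" using Ch[OF t] C'(2)[OF t] dist_invariant[OF h pts] by simp
      finally show ?thesis .
    qed
    then show ?thesis unfolding mem_endpoint_iff using \<rho> act_half_geodesic[OF h C'(1)] by blast
  qed
  have inv: "d (\<rho> t) (act (inv g) (\<rho> t)) \<le> C" if t: "t \<ge> 0" for t
  proof -
    have pt: "\<rho> t \<in> points" using half_geodesicD(1)[OF \<rho> t] .
    have "d (\<rho> t) (act (inv g) (\<rho> t)) = d (act g (\<rho> t)) (act g (act (inv g) (\<rho> t)))"
      using dist_invariant[OF g pt act_points[OF GL_inv[OF g] pt]] by simp
    also have "\<dots> \<le> C" unfolding act_inverse(1)[OF g] using C[OF t] by (simp add: d_commute)
    finally show ?thesis .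
  qed
  show "act_boundary g (endpoint \<rho>) = endpoint \<rho>" unfolding act_boundary_def
  proof
    show "(\<lambda>\<rho> t. act g (\<rho> t)) ` endpoint \<rho> \<subseteq> endpoint \<rho>" using move[OF g C] by blast
    show "endpoint \<rho> \<subseteq> (\<lambda>\<rho> t. act g (\<rho> t)) ` endpoint \<rho>"
    proof
      fix \<rho>' assume "\<rho>' \<in> endpoint \<rho>"
      then have "(\<lambda>t. act (inv g) (\<rho>' t)) \<in> endpoint \<rho>" using move[OF GL_inv[OF g] inv] by blast
      then have "(\<lambda>\<rho> t. act g (\<rho> t)) (\<lambda>t. act (inv g) (\<rho>' t)) \<in> (\<lambda>\<rho> t. act g (\<rho> t)) ` endpoint \<rho>"
        by (rule imageI)
      then show "\<rho>' \<in> (\<lambda>\<rho> t. act g (\<rho> t)) ` endpoint \<rho>" unfolding act_inverse(1)[OF g] .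
    qed
  qed
qed

lemma boundary_vertex_iff:
  assumes "half_geodesic \<rho>"
  shows "boundary_vertex W (endpoint \<rho>) \<longleftrightarrow>
    (\<forall>g\<in>GL. (\<exists>C. \<forall>t\<ge>0. d (\<rho> t) (act g (\<rho> t)) \<le> C) \<longleftrightarrow> g ` W = W)"
proof -
  have "endpoint \<rho> \<in> boundary" unfolding endpoint_def boundary_def
    by (rule quotientI) (simp add: assms)
  then have "boundary_vertex W (endpoint \<rho>) \<longleftrightarrow>
      {g \<in> GL. act_boundary g (endpoint \<rho>) = endpoint \<rho>} = {g \<in> GL. g ` W = W}"
    by (simp only: boundary_vertex_def simp_thms)
  also have "\<dots> \<longleftrightarrow> (\<forall>g\<in>GL. act_boundary g (endpoint \<rho>) = endpoint \<rho> \<longleftrightarrow> g ` W = W)" by auto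
  also have "\<dots> \<longleftrightarrow> (\<forall>g\<in>GL. (\<exists>C. \<forall>t\<ge>0. d (\<rho> t) (act g (\<rho> t)) \<le> C) \<longleftrightarrow> g ` W = W)"
    by (rule ball_cong[OF refl]) (simp only: endpoint_stabilizer_iff[OF assms])
  finally show ?thesis .
qed

end

section \<open>Endpoints determine the splitting\<close>

context padic_vector_space begin

definition complementary :: "'v set \<Rightarrow> 'v set \<Rightarrow> bool" where
  "complementary W W' \<longleftrightarrow> subspace W \<and> subspace W' \<and> W \<inter> W' = {0} \<and> (\<forall>x. \<exists>y\<in>W. \<exists>z\<in>W'. x = y + z)"

lemma complementary_commute: "complementary W W' \<longleftrightarrow> complementary W' W"
proof -
  have "complementary W' W" if "complementary W W'" for W W'
    using that unfolding complementary_def by (metis Int_commute add.commute)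
  then show ?thesis by blast
qed

lemma complementary_unique:
  assumes "complementary W W'" "x \<in> W" "y \<in> W" "x' \<in> W'" "y' \<in> W'" "x + x' = y + y'"
  shows "x = y" "x' = y'"
proof -
  have W: "subspace W" "subspace W'" "W \<inter> W' = {0}" using assms(1) by (simp_all add: complementary_def)
  have "x - y = y' - x'" using assms(6) by (simp add: algebra_simps)
  moreover have "x - y \<in> W" "y' - x' \<in> W'" using W assms by (simp_all add: subspace_diff)
  ultimately have "x - y \<in> W \<inter> W'" by simp
  then have "x - y = 0" unfolding W(3) by simp
  then show "x = y" by simp
  then show "x' = y'" using assms(6) by simp
qed

lemma complementary_basis:
  assumes W: "complementary W W'"
    and S1: "finite S1" "independent S1" "span S1 = W" and S2: "finite S2" "independent S2" "span S2 = W'"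
  shows "S1 \<inter> S2 = {}" "finite (S1 \<union> S2)" "independent (S1 \<union> S2)" "span (S1 \<union> S2) = UNIV"
proof -
  have sub: "S1 \<subseteq> W" "S2 \<subseteq> W'" unfolding S1(3)[symmetric] S2(3)[symmetric] by (rule span_superset)+
  have "0 \<notin> S1" using S1(2) dependent_zero[of S1] by metis
  moreover have "S1 \<inter> S2 \<subseteq> {0}"
    using Int_mono[OF sub] W unfolding complementary_def by metis
  ultimately show disj: "S1 \<inter> S2 = {}" by blast
  show "finite (S1 \<union> S2)" using S1 S2 by simp
  show "independent (S1 \<union> S2)"
  proof (rule independent_if_scalars_zero)
    show "finite (S1 \<union> S2)" using S1 S2 by simp
    fix f x assume sum: "(\<Sum>x\<in>S1 \<union> S2. f x \<odot> x) = 0" and x: "x \<in> S1 \<union> S2"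
    have "(\<Sum>x\<in>S1. f x \<odot> x) \<in> W" unfolding S1(3)[symmetric] by (intro span_sum span_scale span_base)
    moreover have "(\<Sum>x\<in>S2. f x \<odot> x) \<in> W'" unfolding S2(3)[symmetric] by (intro span_sum span_scale span_base)
    moreover have "(\<Sum>x\<in>S1. f x \<odot> x) + (\<Sum>x\<in>S2. f x \<odot> x) = 0 + 0"
      using sum sum.union_disjoint[OF S1(1) S2(1) disj, of "\<lambda>x. f x \<odot> x"] by simp
    moreover have "0 \<in> W" "0 \<in> W'" using W unfolding complementary_def by (auto intro: subspace_0)
    ultimately have "(\<Sum>x\<in>S1. f x \<odot> x) = 0" "(\<Sum>x\<in>S2. f x \<odot> x) = 0"
      using complementary_unique[OF W] by blast+
    then show "f x = 0" using x independentD[OF S1(2,1) order_refl] independentD[OF S2(2,1) order_refl] by blast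
  qed
  show "span (S1 \<union> S2) = UNIV"
    unfolding span_Un S1(3) S2(3) using W unfolding complementary_def by blast
qed

definition joining_lattice :: "'v set \<Rightarrow> 'v set \<Rightarrow> int \<Rightarrow> 'v set" where
  "joining_lattice M M' k = {m + (\<pi> powi k) \<odot> m' | m m'. m \<in> M \<and> m' \<in> M'}"

lemma joining_lattice_box:
  assumes "finite S1" "finite S2" "S1 \<inter> S2 = {}"
  shows "joining_lattice (box S1 a) (box S2 a') k = box (S1 \<union> S2) (\<lambda>b. if b \<in> S2 then a' b + k else a b)"
    (is "_ = box _ ?e")
proof (intro set_eqI iffI)
  fix x assume "x \<in> joining_lattice (box S1 a) (box S2 a') k"
  then obtain m m' where x: "x = m + (\<pi> powi k) \<odot> m'" "m \<in> box S1 a" "m' \<in> box S2 a'"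
    unfolding joining_lattice_def by blast
  obtain c where c: "m = (\<Sum>b\<in>S1. c b \<odot> b)" "\<forall>b\<in>S1. nv (c b) \<le> q powi a b"
    using x(2) unfolding box_def by blast
  obtain c' where c': "m' = (\<Sum>b\<in>S2. c' b \<odot> b)" "\<forall>b\<in>S2. nv (c' b) \<le> q powi a' b"
    using x(3) unfolding box_def by blast
  define e where "e = (\<lambda>b. if b \<in> S2 then \<pi> powi k * c' b else c b)"
  have "x = (\<Sum>b\<in>S1 \<union> S2. e b \<odot> b)"
  proof -
    have "(\<Sum>b\<in>S1. e b \<odot> b) = m" unfolding c(1) by (rule sum.cong) (use assms(3) in \<open>auto simp: e_def\<close>)
    moreover have "(\<Sum>b\<in>S2. e b \<odot> b) = (\<pi> powi k) \<odot> m'" unfolding c'(1)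
      by (simp add: scale_sum_right e_def)
    ultimately show ?thesis using sum.union_disjoint[OF assms, of "\<lambda>b. e b \<odot> b"] x(1) by simp
  qed
  moreover have "\<forall>b\<in>S1 \<union> S2. nv (e b) \<le> q powi ?e b"
  proof
    fix b assume "b \<in> S1 \<union> S2"
    then show "nv (e b) \<le> q powi ?e b"
      using c(2) c'(2) by (auto simp: e_def nv_mult nv_pi_powi power_int_add mult.commute)
  qed
  ultimately show "x \<in> box (S1 \<union> S2) ?e" unfolding box_def by blast
next
  fix x assume "x \<in> box (S1 \<union> S2) ?e"
  then obtain e where e: "x = (\<Sum>b\<in>S1 \<union> S2. e b \<odot> b)" "\<forall>b\<in>S1 \<union> S2. nv (e b) \<le> q powi ?e b"
    unfolding box_def by blast
  define m' where "m' = (\<Sum>b\<in>S2. (e b / \<pi> powi k) \<odot> b)"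
  have "x = (\<Sum>b\<in>S1. e b \<odot> b) + (\<pi> powi k) \<odot> m'"
    unfolding e(1) sum.union_disjoint[OF assms] m'_def by (simp add: scale_sum_right)
  moreover have "\<forall>b\<in>S1. nv (e b) \<le> q powi a b"   proof
    fix b assume b: "b \<in> S1"
    then have "b \<notin> S2" using assms(3) by blast
    then show "nv (e b) \<le> q powi a b" using bspec[OF e(2), of b] b by simp
  qed
  then have "(\<Sum>b\<in>S1. e b \<odot> b) \<in> box S1 a" unfolding box_def by blast
  moreover have "m' \<in> box S2 a'" unfolding box_def m'_def
  proof (intro CollectI exI[of _ "\<lambda>b. e b / \<pi> powi k"] conjI refl ballI)
    fix b assume "b \<in> S2"
    then have "nv (e b) \<le> q powi (a' b + k)" using bspec[OF e(2), of b] by simp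
    then show "nv (e b / \<pi> powi k) \<le> q powi a' b"
      by (simp add: nv_divide nv_pi_powi power_int_add pos_divide_le_eq)
  qed
  ultimately show "x \<in> joining_lattice (box S1 a) (box S2 a') k" unfolding joining_lattice_def by blast
qed

text \<open>
  The intersection spans because it contains the projection of \<open>N\<^sub>0\<close>.
\<close>

lemma chain_component:
  assumes N: "straight_chain N"
    and S: "finite S" "independent S" "span S = UNIV" "S1 \<subseteq> S"
    and e: "\<And>k l x. x \<in> N k \<Longrightarrow> (\<Sum>b\<in>S1. representation S x b \<odot> b) \<in> N l"
  shows "full_lattice (span S1) (span S1 \<inter> (\<Inter>k. N k))"
proof -
  let ?M = "span S1 \<inter> (\<Inter>k. N k)" and ?e = "\<lambda>x. \<Sum>b\<in>S1. representation S x b \<odot> b"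
  have sub: "submodule (N k)" for k by (rule full_lattice_submodule[OF straight_chainD(1)[OF N]])
  have eW: "?e x \<in> span S1" for x by (intro span_sum span_scale span_base)
  have "submodule ?M" unfolding submodule_def
    using sub by (auto simp: span_zero span_add span_scale submodule_0 submodule_add submodule_scale)
  moreover have "nv_bounded ?M"
    using straight_chainD(1)[OF N, of 0] unfolding full_lattice_def nv_bounded_def by blast
  moreover have "span ?M = span S1"
  proof
    show "span ?M \<subseteq> span S1" by (rule span_minimal) auto
    show "span S1 \<subseteq> span ?M"
    proof
      fix w assume w: "w \<in> span S1"
      have "w \<in> span (N 0)" using straight_chainD(1)[OF N, of 0] by (simp add: full_lattice_def)
      then have "?e w \<in> span ?M"
      proof (induction rule: span_induct_alt)
        case base
        then show ?case using S(2,3) by (simp add: representation_zero span_zero)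
      next
        case (step c x y)
        have "?e (c \<odot> x + y) = c \<odot> ?e x + ?e y"
          using S(2,3) by (simp add: representation_add representation_scale scale_left_distrib sum.distrib scale_sum_right)
        moreover have "?e x \<in> ?M" using e[OF step(1)] eW by blast
        ultimately show ?case using span_add[OF span_scale[OF span_base] step(2)] by (simp only:)
      qed
      moreover have "?e w = w"
      proof -
        have S1: "finite S1" "independent S1" using S finite_subset independent_mono by blast+
        have "?e w = (\<Sum>b\<in>S1. representation S1 w b \<odot> b)"
          using representation_extend[OF S(2) w S(4)] by simp
        then show ?thesis using sum_representation_eq[OF S1(2) w S1(1) order_refl] by simp
      qed
      ultimately show "w \<in> span ?M" by simp
    qed
  qed
  ultimately show ?thesis by (simp add: full_lattice_def)
qed

text \<open>
  A lattice contains no line: a nonzero vector is divisible by bounded powers of \<open>\<pi>\<close> only.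
\<close>

lemma full_lattice_bounded_multiples:
  assumes "full_lattice U L" "b \<noteq> 0"
  obtains c where "\<And>i. b \<in> pi_scale i L \<Longrightarrow> i \<le> c"
proof (cases "b \<in> U")
  case True
  obtain S k where S: "finite S" "independent S" "span S = U" "L = box S k"
    using lattice_has_basis[OF assms(1)] by blast
  have "\<exists>s\<in>S. representation S b s \<noteq> 0"
  proof (rule ccontr)
    assume "\<not> ?thesis"
    then have "(\<Sum>s\<in>S. representation S b s \<odot> s) = 0" by simp
    then show False using sum_representation_eq[OF S(2) _ S(1) order_refl, of b] S(3) True assms(2) by simp
  qed
  then obtain s where s: "s \<in> S" "representation S b s \<noteq> 0" by blast
  obtain e where e: "nv (representation S b s) = q powi e" using nv_value[OF s(2)] by blast
  have "i \<le> e - k s" if "b \<in> pi_scale i L" for i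
  proof -
    have "nv (representation S ((\<pi> powi (- i)) \<odot> b) s) \<le> q powi k s"
      using that s(1) unfolding mem_pi_scale_iff S(4) mem_box_iff[OF S(1,2)] by blast
    moreover have "nv (representation S ((\<pi> powi (- i)) \<odot> b) s) = q powi (- i + e)"
      unfolding power_int_add[OF disjI1[OF q_nonzero]]
      using S(2,3) True by (simp add: representation_scale nv_mult nv_pi_powi e)
    ultimately have "q powi (- i + e) \<le> q powi k s" by (simp only:)
    then show ?thesis unfolding q_powi_le_iff by linarith
  qed
  then show ?thesis using that by blast
next
  case False
  have "b \<notin> pi_scale i L" for i
    using full_lattice_subset[OF full_lattice_pi_scale[OF assms(1)], of i] False by blast
  then show ?thesis using that by blast
qed

end

context bruhat_tits_building begin

text \<open>
  The involution \<open>g = 1 - 2 \<epsilon>\<close> fixes the end, so \<open>g N\<^sub>k\<close> lies between \<open>\<pi>\<^sup>j\<^sup>+\<^sup>C N\<^sub>k\<close> and \<open>\<pi>\<^sup>j N\<^sub>k\<close> with \<open>C\<close> independent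
  of \<open>k\<close>. The number \<open>j\<close> may depend on \<open>k\<close>, but applying \<open>g\<close> twice gives \<open>j + C \<ge> 0\<close>.
\<close>

lemma idempotent_bound:
  fixes t :: "int \<Rightarrow> real"
  assumes \<gamma>: "geodesic \<gamma>" and W: "boundary_vertex W (endpoint \<gamma>)" "subspace W"
    and N: "straight_chain N" and t: "\<And>k. 0 \<le> k \<Longrightarrow> \<gamma> (t k) = class_vertex (N k)" "\<And>k. 0 \<le> k \<Longrightarrow> t 0 \<le> t k"
    and \<epsilon>: "idempotent_preserving W \<epsilon>"
  shows "\<exists>C\<ge>0. \<forall>k\<ge>0. \<forall>x\<in>N k. \<epsilon> x \<in> pi_scale (- C) (N k)"
proof -
  have e: "\<epsilon> (x + y) = \<epsilon> x + \<epsilon> y" "\<epsilon> (c \<odot> x) = c \<odot> \<epsilon> x" "\<epsilon> (\<epsilon> x) = \<epsilon> x" "x \<in> W \<Longrightarrow> \<epsilon> x \<in> W" for x y c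
    using \<epsilon> unfolding idempotent_preserving_def by auto
  have em: "\<epsilon> (x - y) = \<epsilon> x - \<epsilon> y" for x y
    using e(1)[of "x - y" y] by (simp add: algebra_simps)
  define g where "g = (\<lambda>x. x - 2 \<odot> \<epsilon> x)"
  have gg: "g (g x) = x" for x
  proof -
    have "g (g x) = x - (2 \<odot> \<epsilon> x + 2 \<odot> \<epsilon> x) + (2 * 2) \<odot> \<epsilon> x"
      by (simp add: g_def em e scale_right_diff_distrib algebra_simps)
    also have "2 \<odot> \<epsilon> x + 2 \<odot> \<epsilon> x = (2 * 2) \<odot> \<epsilon> x" unfolding scale_left_distrib[symmetric] by simp
    finally show ?thesis by simp
  qed
  have gGL: "g \<in> GL" unfolding GL_iff
    using involuntory_imp_bij[of g] gg
    by (auto simp: g_def e scale_right_distrib scale_right_diff_distrib scale_left_commute algebra_simps)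
  have gW: "g ` W = W"
  proof -
    have sub: "g x \<in> W" if "x \<in> W" for x
      unfolding g_def using that e(4) W(2) by (intro subspace_diff subspace_scale)
    then have "W \<subseteq> g ` W" using gg by (metis imageI subsetI)
    then show ?thesis using sub by blast
  qed
  obtain D where D: "\<And>s. s \<ge> 0 \<Longrightarrow> d (\<gamma> s) (act g (\<gamma> s)) \<le> D"
    using W(1) gGL gW unfolding boundary_vertex_iff[OF geodesic_half[OF \<gamma>]] by blast
  have pts: "\<gamma> s \<in> points" "act g (\<gamma> s) \<in> points" for s using geodesicD(1)[OF \<gamma>] act_points[OF gGL] by blast+
  \<comment> \<open>The chain may start at a negative time, where the bound at the end does not apply directly.\<close>
  have D': "d (\<gamma> s) (act g (\<gamma> s)) \<le> D + 2 * \<bar>t 0\<bar>" if s: "t 0 \<le> s" for s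
  proof (cases "s \<ge> 0")
    case True
    then show ?thesis using D[of s] by simp
  next
    case False
    have "d (\<gamma> s) (act g (\<gamma> s)) \<le> d (\<gamma> s) (\<gamma> 0) + d (\<gamma> 0) (act g (\<gamma> s))" by (intro d_triangle pts)
    moreover have "d (\<gamma> 0) (act g (\<gamma> s)) \<le> d (\<gamma> 0) (act g (\<gamma> 0)) + d (act g (\<gamma> 0)) (act g (\<gamma> s))"
      by (intro d_triangle pts)
    moreover have "d (act g (\<gamma> 0)) (act g (\<gamma> s)) = \<bar>s\<bar>" "d (\<gamma> s) (\<gamma> 0) = \<bar>s\<bar>"
      using dist_invariant[OF gGL pts(1) pts(1)] geodesicD(2)[OF \<gamma>] by simp_all
    moreover have "\<bar>s\<bar> \<le> \<bar>t 0\<bar>" using s False by simp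
    ultimately show ?thesis using D[of 0] by simp
  qed
  obtain C where C: "C \<ge> 0" "\<And>L N. full_lattice UNIV L \<Longrightarrow> full_lattice UNIV N \<Longrightarrow> d (class_vertex L) (class_vertex N) \<le> D + 2 * \<bar>t 0\<bar> \<Longrightarrow>
    \<exists>j. scale (\<pi> powi (j + C)) ` L \<subseteq> N \<and> N \<subseteq> scale (\<pi> powi j) ` L"
    using classes_close by blast
  have two: "(2 :: 'k) \<noteq> 0" by simp
  \<comment> \<open>The residue characteristic may be 2, so dividing \<open>x - g x = 2 \<epsilon> x\<close> by 2 costs a power of \<open>\<pi>\<close>.\<close>
  obtain e2 where e2: "nv (2 :: 'k) = q powi e2" using nv_value[OF two] by blast
  have e2_nonneg: "0 \<le> e2"
  proof -
    have "nv (1 + 1 :: 'k) \<le> 1" by (rule nv_add_le) simp_all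
    then have "q powi e2 \<le> q powi 0" using e2 by simp
    then show ?thesis unfolding q_powi_le_iff .
  qed
  have "\<epsilon> x \<in> pi_scale (- (C + e2)) (N k)" if k: "0 \<le> k" and x: "x \<in> N k" for k x
  proof -
    have full_lattice: "full_lattice UNIV (N k)" and sub: "submodule (N k)"
      using straight_chainD(1)[OF N] full_lattice_submodule by blast+
    have gpi_scale: "g ` pi_scale j X = pi_scale j (g ` X)" for j X unfolding pi_scale_def by (rule GL_scale_image[OF gGL])
    have ggi: "g ` g ` X = X" for X by (simp add: image_image gg)
    have "d (class_vertex (N k)) (class_vertex (g ` N k)) \<le> D + 2 * \<bar>t 0\<bar>"
      using D'[OF t(2)[OF k]] unfolding t(1)[OF k] act_class_vertex[OF gGL] .
    then obtain j where j: "pi_scale (j + C) (N k) \<subseteq> g ` N k" "g ` N k \<subseteq> pi_scale j (N k)"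
      using C(2)[OF full_lattice full_lattice_GL_image_UNIV[OF gGL full_lattice]] unfolding pi_scale_def by blast
    have "pi_scale (j + C) (pi_scale (j + C) (N k)) \<subseteq> pi_scale (j + C) (g ` N k)" by (rule pi_scale_mono[OF j(1)])
    also have "\<dots> \<subseteq> g ` g ` N k" unfolding gpi_scale[symmetric] by (rule image_mono[OF j(1)])
    finally have "pi_scale ((j + C) + (j + C)) (N k) \<subseteq> pi_scale 0 (N k)" unfolding ggi pi_scale_pi_scale pi_scale_0 .
    then have jC: "0 \<le> (j + C) + (j + C)" unfolding pi_scale_lattice_subset_iff[OF N] .
    have "g x \<in> pi_scale j (N k)" using j(2) x by blast
    moreover have "pi_scale j (N k) \<subseteq> pi_scale (- C) (N k)" by (rule pi_scale_subset[OF sub]) (use jC in linarith)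
    moreover have "pi_scale 0 (N k) \<subseteq> pi_scale (- C) (N k)" by (rule pi_scale_subset[OF sub]) (use C(1) in simp)
    ultimately have "g x \<in> pi_scale (- C) (N k)" "x \<in> pi_scale (- C) (N k)" using x unfolding pi_scale_0 by blast+
    then have "x - g x \<in> pi_scale (- C) (N k)"
      using submodule_diff[OF submodule_pi_scale[OF sub, of "- C"]] by blast
    then have "2 \<odot> \<epsilon> x \<in> pi_scale (- C) (N k)" by (simp add: g_def)
    then have "(\<pi> powi e2) \<odot> \<epsilon> x \<in> pi_scale (- C) (N k)"
    proof -
      assume *: "2 \<odot> \<epsilon> x \<in> pi_scale (- C) (N k)"
      have "nv (\<pi> powi e2 / 2) \<le> 1" by (simp add: nv_divide nv_pi_powi e2)
      then have "(\<pi> powi e2 / 2) \<odot> (2 \<odot> \<epsilon> x) \<in> pi_scale (- C) (N k)"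
        by (rule submodule_scale[OF submodule_pi_scale[OF sub] _ *])
      then show ?thesis by simp
    qed
    then have "(\<pi> powi (- e2)) \<odot> ((\<pi> powi e2) \<odot> \<epsilon> x) \<in> pi_scale (- e2) (pi_scale (- C) (N k))" by (rule pi_scale_I)
    then show ?thesis by (simp add: pi_scale_pi_scale power_int_minus add.commute)
  qed
  then show ?thesis using C(1) e2_nonneg by (intro exI[of _ "C + e2"]) auto
qed

lemma joining_vertex_eq: "joining_vertex M M' k = lattice_class (joining_lattice M M' k)"
  by (simp add: joining_vertex_def joining_lattice_def)

text \<open>
  Applied to the chain and to its reverse, the preceding bounds show that both projections preserve all
  members of the chain up to the expected power of \<open>\<pi>\<close>. Hence each member is the sum of its components.
\<close>

lemma oriented_structure:
  assumes W: "complementary W W'"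
    and \<gamma>: "geodesic \<gamma>" "combinatorial \<gamma>"
    and ends: "boundary_vertex W (endpoint \<gamma>)" "boundary_vertex W' (endpoint (\<lambda>t. \<gamma> (- t)))"
  obtains M M' t where "full_lattice W M" "full_lattice W' M'"
    "\<And>k. traverses_edge \<gamma> (joining_vertex M M' k) (joining_vertex M M' (k + 1)) (t k) (t (k + 1))"
    "\<And>u. \<exists>k. t k \<le> u \<and> u \<le> t (k + 1)"
proof -
  obtain t N where N: "straight_chain N"
    and P: "\<And>k. traverses_edge \<gamma> (lattice_class (N k)) (lattice_class (N (k + 1))) (t k) (t (k + 1))"
    and cover: "\<And>u. \<exists>k. t k \<le> u \<and> u \<le> t (k + 1)"
    by (rule combinatorial_geodesic_chain[OF \<gamma>]) (rule that)
  have sW: "subspace W" "subspace W'" using W by (simp_all add: complementary_def)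
  have basis: "\<exists>B. finite B \<and> independent B \<and> span B = U" if U: "subspace U" for U
  proof -
    obtain B where "B \<subseteq> U" "independent B" "U \<subseteq> span B" by (rule maximal_independent_subset)
    moreover from this have "span B = U" by (intro subset_antisym span_minimal U)
    ultimately show ?thesis using finiteI_independent by blast
  qed
  obtain S1 where S1: "finite S1" "independent S1" "span S1 = W" using basis[OF sW(1)] by blast
  obtain S2 where S2: "finite S2" "independent S2" "span S2 = W'" using basis[OF sW(2)] by blast
  define S where "S = S1 \<union> S2"
  have S: "S1 \<inter> S2 = {}" "finite S" "independent S" "span S = UNIV"
    unfolding S_def by (rule complementary_basis[OF W S1 S2])+
  have SS: "S1 \<subseteq> S" "S2 \<subseteq> S" "S - S1 = S2" "S - S2 = S1" using S(1) by (auto simp: S_def)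
  have tmono: "t j \<le> t k" if "j \<le> k" for j k
    using that
  proof (induction k rule: int_ge_induct)
    case (step i)
    then show ?case using traverses_edgeD(2)[OF P[of i]] by simp
  qed simp
  have at: "\<gamma> (t k) = class_vertex (N k)" for k by (rule traverses_edgeD(4)[OF P])
  define N' where "N' = (\<lambda>k. pi_scale k (N (- k)))"
  have N': "straight_chain N'" unfolding N'_def by (rule straight_chain_reverse[OF N])
  have N'_class: "lattice_class (N' k) = lattice_class (N (- k))" for k
    unfolding N'_def pi_scale_def by (rule lattice_class_scale) simp
  have "\<exists>C\<ge>0. \<forall>k\<ge>0. \<forall>x\<in>N k. \<epsilon> x \<in> pi_scale (- C) (N k)" if "idempotent_preserving (span S1) \<epsilon>" for \<epsilon>
    by (rule idempotent_bound[OF \<gamma>(1) ends(1) sW(1) N, of t]) (use at tmono that S1(3) in auto)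
  then obtain C1 where C1: "\<And>k x b. 0 \<le> k \<Longrightarrow> x \<in> N k \<Longrightarrow> b \<in> S - S1 \<Longrightarrow> nv (representation S x b) \<le> q powi (k - C1)"
    using complementary_coordinate_bound[OF N S(2-4) SS(1)] by blast
  have "\<exists>C\<ge>0. \<forall>k\<ge>0. \<forall>x\<in>N' k. \<epsilon> x \<in> pi_scale (- C) (N' k)" if "idempotent_preserving (span S2) \<epsilon>" for \<epsilon>
  proof (rule idempotent_bound[OF geodesic_reverse[OF \<gamma>(1)] ends(2) sW(2) N', of "\<lambda>k. - t (- k)"])
    show "\<gamma> (- (- t (- k))) = class_vertex (N' k)" for k unfolding N'_class by (simp add: at)
    show "- t (- 0) \<le> - t (- k)" if "0 \<le> k" for k using tmono[of "- k" 0] that by simp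
    show "idempotent_preserving W' \<epsilon>" using that S2(3) by simp
  qed
  then obtain C2 where C2: "\<And>k x b. 0 \<le> k \<Longrightarrow> x \<in> N' k \<Longrightarrow> b \<in> S - S2 \<Longrightarrow> nv (representation S x b) \<le> q powi (k - C2)"
    using complementary_coordinate_bound[OF N' S(2-4) SS(2)] by blast
  define C where "C = max C1 C2"
  have B1: "nv (representation S x b) \<le> q powi (k - C)" if "0 \<le> k" "x \<in> N k" "b \<in> S2" for k x b
  proof -
    have "nv (representation S x b) \<le> q powi (k - C1)" by (rule C1) (use that SS in auto)
    also have "\<dots> \<le> q powi (k - C)" by (simp add: C_def)
    finally show ?thesis .
  qed
  have B2: "nv (representation S x b) \<le> q powi (k - C)" if "0 \<le> k" "x \<in> N' k" "b \<in> S1" for k x b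
  proof -
    have "nv (representation S x b) \<le> q powi (k - C2)" by (rule C2) (use that SS in auto)
    also have "\<dots> \<le> q powi (k - C)" by (simp add: C_def)
    finally show ?thesis .
  qed
  have N'N: "pi_scale k (N' (- k)) = N k" for k by (simp add: N'_def pi_scale_pi_scale)
  let ?e = "\<lambda>x. \<Sum>b\<in>S1. representation S x b \<odot> b" and ?f = "\<lambda>x. \<Sum>b\<in>S2. representation S x b \<odot> b"
  have e: "?e x \<in> N l" if "x \<in> N k" for k l x
    by (rule straight_chain_projection[OF N S(2-4) SS(1), of C, OF _ _ that])
      (use B1 B2 in \<open>simp_all add: SS N'_def\<close>)
  have f: "?f x \<in> N' l" if "x \<in> N' k" for k l x
    by (rule straight_chain_projection[OF N' S(2-4) SS(2), of C, OF _ _ that])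
      (use B1 B2 in \<open>simp_all add: SS N'N\<close>)
  define M where "M = span S1 \<inter> (\<Inter>k. N k)"
  define M' where "M' = span S2 \<inter> (\<Inter>k. N' k)"
  have M: "full_lattice W M" using chain_component[OF N S(2-4) SS(1) e] S1(3) unfolding M_def by simp
  have M': "full_lattice W' M'" using chain_component[OF N' S(2-4) SS(2) f] S2(3) unfolding M'_def by simp
  have "N k = joining_lattice M M' k" for k
  proof (intro set_eqI iffI)
    fix x assume x: "x \<in> N k"
    have "?e x \<in> M" using e[OF x] unfolding M_def by (auto intro!: span_sum span_scale intro: span_base)
    moreover have "(\<pi> powi (- k)) \<odot> x \<in> N' (- k)" unfolding N'_def using x pi_scale_I by simp
    then have "?f ((\<pi> powi (- k)) \<odot> x) \<in> M'" using f unfolding M'_def by (auto intro!: span_sum span_scale intro: span_base)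
    moreover have "(\<pi> powi k) \<odot> ?f ((\<pi> powi (- k)) \<odot> x) = ?f x"
    proof -
      have cancel: "\<pi> powi k * (\<pi> powi (- k) * a) = a" for a by (simp add: power_int_minus)
      show ?thesis using S(3,4) by (simp add: representation_scale scale_sum_right cancel)
    qed
    moreover have "x = ?e x + ?f x"
    proof -
      have "x = (\<Sum>b\<in>S. representation S x b \<odot> b)"
        using sum_representation_eq[OF S(3), of x S] S(2,4) by simp
      also have "\<dots> = ?e x + ?f x" unfolding S_def
        by (rule sum.union_disjoint[OF S1(1) S2(1) S(1)])
      finally show ?thesis .
    qed
    ultimately show "x \<in> joining_lattice M M' k" unfolding joining_lattice_def by (metis (mono_tags, lifting) mem_Collect_eq)
  next
    fix x assume "x \<in> joining_lattice M M' k"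
    then obtain m m' where m: "x = m + (\<pi> powi k) \<odot> m'" "m \<in> M" "m' \<in> M'" unfolding joining_lattice_def by blast
    have "m \<in> N k" "m' \<in> N' (- k)" using m unfolding M_def M'_def by blast+
    then have "m \<in> N k" "(\<pi> powi k) \<odot> m' \<in> N k" using pi_scale_I[of m' "N' (- k)" k] unfolding N'N by blast+
    then show "x \<in> N k" unfolding m(1) by (rule submodule_add[OF full_lattice_submodule[OF straight_chainD(1)[OF N]]])
  qed
  then have "lattice_class (N k) = joining_vertex M M' k" for k by (simp add: joining_vertex_eq)
  then show ?thesis using that[OF M M', of t] P cover by simp
qed

section \<open>The geodesic of a pair of lattices\<close>

lemma full_lattice_joining_lattice:
  assumes "complementary W W'" "full_lattice W M" "full_lattice W' M'"
  shows "full_lattice UNIV (joining_lattice M M' k)"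
proof -
  obtain S1 a where S1: "finite S1" "independent S1" "span S1 = W" and a: "M = box S1 a"
    using lattice_has_basis[OF assms(2)] by blast
  obtain S2 a' where S2: "finite S2" "independent S2" "span S2 = W'" and a': "M' = box S2 a'"
    using lattice_has_basis[OF assms(3)] by blast
  note S = complementary_basis[OF assms(1) S1 S2]
  show ?thesis unfolding a a' joining_lattice_box[OF S1(1) S2(1) S(1)] using full_lattice_box[OF S(2)] S(4) by simp
qed

lemma joining_lattice_mem:
  assumes "full_lattice W M" "full_lattice W' M'"
  shows "m \<in> M \<Longrightarrow> m \<in> joining_lattice M M' k" "m' \<in> M' \<Longrightarrow> (\<pi> powi k) \<odot> m' \<in> joining_lattice M M' k"
proof -
  have 0: "0 \<in> M" "0 \<in> M'" using assms submodule_0 full_lattice_submodule by blast+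
  show "m \<in> joining_lattice M M' k" if "m \<in> M"
    unfolding joining_lattice_def using that 0 by (intro CollectI exI[of _ m] exI[of _ 0]) simp
  show "(\<pi> powi k) \<odot> m' \<in> joining_lattice M M' k" if "m' \<in> M'"
    unfolding joining_lattice_def using that 0 by (intro CollectI exI[of _ 0] exI[of _ m']) simp
qed

text \<open>
  The image \<open>g M\<close> stays in \<open>W\<close> and is commensurable with \<open>M\<close>. For the other summand,
  \<open>g (\<pi>\<^sup>k M') \<subseteq> \<pi>\<^sup>k g L\<^sub>0\<close> is up to a bounded power of \<open>\<pi>\<close> contained in \<open>\<pi>\<^sup>k L\<^sub>0 \<subseteq> L\<^sub>k\<close>.
\<close>

lemma stabilizer_moves_boundedly:
  assumes W: "complementary W W'" "full_lattice W M" "full_lattice W' M'" and g: "g \<in> GL" "g ` W = W"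
  obtains C where "\<And>k. 0 \<le> k \<Longrightarrow> pi_scale C (g ` joining_lattice M M' k) \<subseteq> joining_lattice M M' k"
proof -
  let ?J = "joining_lattice M M'"
  have J: "full_lattice UNIV (?J k)" for k by (rule full_lattice_joining_lattice[OF W])
  have subM: "submodule M" and subM': "submodule M'" using W(2,3) full_lattice_submodule by blast+
  have subJ: "submodule (?J k)" for k by (rule full_lattice_submodule[OF J])
  have "full_lattice W (g ` M)" using full_lattice_GL_image[OF g(1) W(2)] g(2) by simp
  then obtain c where c: "c \<ge> 0" "pi_scale c (g ` M) \<subseteq> M" using full_lattice_commensurable[OF W(2)] by blast
  obtain c' where c': "c' \<ge> 0" "pi_scale c' (g ` ?J 0) \<subseteq> ?J 0"
    using full_lattice_commensurable[OF J full_lattice_GL_image_UNIV[OF g(1) J]] by blast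
  have "pi_scale (c + c') (g ` ?J k) \<subseteq> ?J k" if k: "0 \<le> k" for k
  proof
    fix x assume "x \<in> pi_scale (c + c') (g ` ?J k)"
    then obtain y where y: "x = (\<pi> powi (c + c')) \<odot> g y" "y \<in> ?J k" by (auto simp: pi_scale_def)
    obtain m m' where m: "y = m + (\<pi> powi k) \<odot> m'" "m \<in> M" "m' \<in> M'" using y(2) unfolding joining_lattice_def by blast
    have "(\<pi> powi c) \<odot> g m \<in> M" using c(2) pi_scale_I[of "g m" "g ` M" c] m(2) by blast
    then have "(\<pi> powi c') \<odot> ((\<pi> powi c) \<odot> g m) \<in> pi_scale c' M" by (rule pi_scale_I)
    then have "(\<pi> powi c') \<odot> ((\<pi> powi c) \<odot> g m) \<in> M" using pi_scale_subset[OF subM c'(1)] by auto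
    then have 1: "(\<pi> powi c') \<odot> ((\<pi> powi c) \<odot> g m) \<in> ?J k" by (rule joining_lattice_mem(1)[OF W(2,3)])
    have "(\<pi> powi 0) \<odot> m' \<in> ?J 0" by (rule joining_lattice_mem(2)[OF W(2,3) m(3)])
    then have "m' \<in> ?J 0" by simp
    then have "(\<pi> powi c') \<odot> g m' \<in> ?J 0" using c'(2) pi_scale_I[of "g m'" "g ` ?J 0" c'] by blast
    then obtain a a' where a: "(\<pi> powi c') \<odot> g m' = a + a'" "a \<in> M" "a' \<in> M'"
      unfolding joining_lattice_def by auto
    have "(\<pi> powi k) \<odot> a \<in> M" using pi_scale_subset[OF subM k] pi_scale_I[OF a(2), of k] by auto
    then have "(\<pi> powi k) \<odot> a + (\<pi> powi k) \<odot> a' \<in> ?J k"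
      using a(3) unfolding joining_lattice_def by blast
    then have "(\<pi> powi k) \<odot> ((\<pi> powi c') \<odot> g m') \<in> ?J k" unfolding a(1) scale_right_distrib .
    then have "(\<pi> powi c) \<odot> ((\<pi> powi k) \<odot> ((\<pi> powi c') \<odot> g m')) \<in> ?J k"
      using pi_scale_subset[OF subJ c(1), of k] pi_scale_I[of _ "?J k" c] unfolding pi_scale_0 by blast
    from submodule_add[OF subJ 1 this] show "x \<in> ?J k"
      unfolding y(1) m(1) by (simp add: GL_D(1,2)[OF g(1)] scale_right_distrib power_int_add ac_simps)
  qed
  then show ?thesis using that by blast
qed

text \<open>
  Suppose that \<open>g m\<close> has a nonzero component in \<open>W'\<close> for some \<open>m \<in> M\<close>. Since \<open>g m\<close> lies in \<open>\<pi>\<^sup>j L\<^sub>k\<close>, whose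
  part in \<open>W'\<close> is \<open>\<pi>\<^sup>j\<^sup>+\<^sup>k M'\<close>, the number \<open>j\<close> tends to \<open>-\<infinity>\<close> with growing \<open>k\<close>. But then \<open>\<pi>\<^sup>j\<^sup>+\<^sup>C m\<close>, which is in
  \<open>g L\<^sub>k \<subseteq> g L\<^sub>0\<close>, is unbounded.
\<close>

lemma bounded_move_stabilizes:
  assumes W: "complementary W W'" "full_lattice W M" "full_lattice W' M'" and g: "g \<in> GL"
    and D: "\<And>k. 0 \<le> k \<Longrightarrow> d (class_vertex (joining_lattice M M' k)) (class_vertex (g ` joining_lattice M M' k)) \<le> D"
  shows "g ` W \<subseteq> W"
proof (rule ccontr)
  let ?J = "joining_lattice M M'"
  have J: "full_lattice UNIV (?J k)" for k by (rule full_lattice_joining_lattice[OF W])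
  have sW: "subspace W" using W(1) by (simp add: complementary_def)
  assume "\<not> g ` W \<subseteq> W"
  have "\<exists>m\<in>M. g m \<notin> W"
  proof (rule ccontr)
    assume "\<not> ?thesis"
    then have sub: "M \<subseteq> g -` W" by blast
    have "subspace (g -` W)" unfolding subspace_def vimage_def mem_Collect_eq
      using sW GL_D(1,2)[OF g] GL_D(2)[OF g, of 0 0] by (auto simp: subspace_def)
    then have "span M \<subseteq> g -` W" by (rule span_minimal[OF sub])
    then show False using \<open>\<not> g ` W \<subseteq> W\<close> W(2) by (auto simp: full_lattice_def)
  qed
  then obtain m where m: "m \<in> M" "g m \<notin> W" by blast
  obtain a b where ab: "g m = a + b" "a \<in> W" "b \<in> W'" using W(1) unfolding complementary_def by blast
  have "b \<noteq> 0" using ab m(2) by auto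
  then obtain c where c: "\<And>i. b \<in> pi_scale i M' \<Longrightarrow> i \<le> c" using full_lattice_bounded_multiples[OF W(3)] by blast
  have "m \<noteq> 0" using m(2) sW GL_D(2)[OF g, of 0 0] by (auto simp: subspace_0)
  then obtain c2 where c2: "\<And>i. m \<in> pi_scale i (g ` ?J 0) \<Longrightarrow> i \<le> c2"
    using full_lattice_bounded_multiples[OF full_lattice_GL_image_UNIV[OF g J]] by blast
  obtain C where C: "C \<ge> 0" "\<And>L N. full_lattice UNIV L \<Longrightarrow> full_lattice UNIV N \<Longrightarrow> d (class_vertex L) (class_vertex N) \<le> D \<Longrightarrow>
    \<exists>j. scale (\<pi> powi (j + C)) ` L \<subseteq> N \<and> N \<subseteq> scale (\<pi> powi j) ` L"
    using classes_close by blast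
  have "k \<le> c + C + c2" if k: "0 \<le> k" for k
  proof -
    obtain j where j: "pi_scale (j + C) (?J k) \<subseteq> g ` ?J k" "g ` ?J k \<subseteq> pi_scale j (?J k)"
      using C(2)[OF J full_lattice_GL_image_UNIV[OF g J] D[OF k]] unfolding pi_scale_def by blast
    have mJ: "m \<in> ?J k" by (rule joining_lattice_mem(1)[OF W(2,3) m(1)])
    then have "g m \<in> pi_scale j (?J k)" using j(2) by blast
    then obtain y where y: "g m = (\<pi> powi j) \<odot> y" "y \<in> ?J k" by (rule pi_scale_E)
    obtain n n' where n: "y = n + (\<pi> powi k) \<odot> n'" "n \<in> M" "n' \<in> M'" using y(2) unfolding joining_lattice_def by blast
    have "a + b = (\<pi> powi j) \<odot> n + (\<pi> powi (j + k)) \<odot> n'"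
      using ab(1) y(1) n(1) by (simp add: scale_right_distrib power_int_add)
    moreover have "(\<pi> powi j) \<odot> n \<in> W" using n(2) full_lattice_subset[OF W(2)] sW by (auto intro: subspace_scale)
    moreover have "(\<pi> powi (j + k)) \<odot> n' \<in> W'"
      using n(3) full_lattice_subset[OF W(3)] full_lattice_subspace[OF W(3)] by (auto intro: subspace_scale)
    ultimately have "b = (\<pi> powi (j + k)) \<odot> n'" using complementary_unique(2)[OF W(1) ab(2) _ ab(3)] by blast
    then have jk: "j + k \<le> c" using c pi_scale_I[OF n(3)] by blast
    have "?J k \<subseteq> ?J 0"
    proof
      fix x assume "x \<in> ?J k"
      then obtain n n' where n: "x = n + (\<pi> powi k) \<odot> n'" "n \<in> M" "n' \<in> M'" unfolding joining_lattice_def by blast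
      have "(\<pi> powi k) \<odot> n' \<in> M'" using pi_scale_subset[OF full_lattice_submodule[OF W(3)] k] pi_scale_I[OF n(3), of k] by auto
      then show "x \<in> ?J 0" unfolding joining_lattice_def n(1) using n(2)
        by (intro CollectI exI[of _ n] exI[of _ "(\<pi> powi k) \<odot> n'"]) simp
    qed
    then have "(\<pi> powi (j + C)) \<odot> m \<in> g ` ?J 0" using j(1) pi_scale_I[OF mJ, of "j + C"] by blast
    then have "m \<in> pi_scale (- (j + C)) (g ` ?J 0)" by (simp only: mem_pi_scale_iff minus_minus)
    then have "- (j + C) \<le> c2" by (rule c2)
    then show ?thesis using jk by linarith
  qed
  from this[of "max 0 (c + C + c2 + 1)"] show False by simp
qed

lemma joining_geodesic_endpoint:
  assumes W: "complementary W W'" "full_lattice W M" "full_lattice W' M'"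
    and \<gamma>: "geodesic \<gamma>" "len > 0" "\<And>k. \<gamma> (len * real_of_int k) = vertex_point (joining_vertex M M' k)"
  shows "boundary_vertex W (endpoint \<gamma>)"
  unfolding boundary_vertex_iff[OF geodesic_half[OF \<gamma>(1)]]
proof (intro ballI iffI)
  let ?J = "joining_lattice M M'"
  have at: "\<gamma> (len * real_of_int k) = class_vertex (?J k)" for k unfolding \<gamma>(3) joining_vertex_eq ..
  have J: "full_lattice UNIV (?J k)" for k by (rule full_lattice_joining_lattice[OF W])
  fix g assume g: "g \<in> GL"
  have pts: "\<gamma> s \<in> points" "act g (\<gamma> s) \<in> points" for s using geodesicD(1)[OF \<gamma>(1)] act_points[OF g] by blast+
  {
    assume "\<exists>C. \<forall>t\<ge>0. d (\<gamma> t) (act g (\<gamma> t)) \<le> C"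
    then obtain D where D: "\<And>t. t \<ge> 0 \<Longrightarrow> d (\<gamma> t) (act g (\<gamma> t)) \<le> D" by blast
    have DJ: "d (class_vertex (?J k)) (class_vertex (g ` ?J k)) \<le> D" if "0 \<le> k" for k
      using D[of "len * real_of_int k"] that \<gamma>(2) unfolding at act_class_vertex[OF g] by simp
    have "d (class_vertex (?J k)) (class_vertex (inv g ` ?J k)) \<le> D" if k: "0 \<le> k" for k
    proof -
      have v: "class_vertex L \<in> points" if "full_lattice UNIV L" for L
        using vertex_point_in_points[OF lattice_class_vertex[OF that]] .
      have "d (class_vertex (?J k)) (class_vertex (inv g ` ?J k)) =
          d (act g (class_vertex (?J k))) (act g (class_vertex (inv g ` ?J k)))"
        using dist_invariant[OF g v[OF J] v[OF full_lattice_GL_image_UNIV[OF GL_inv[OF g] J]]] by simp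
      also have "\<dots> = d (class_vertex (g ` ?J k)) (class_vertex (?J k))"
        unfolding act_class_vertex[OF g] by (simp add: image_image GL_D[OF g])
      finally show ?thesis using DJ[OF k] by (simp add: d_commute)
    qed
    from bounded_move_stabilizes[OF W GL_inv[OF g] this] have "inv g ` W \<subseteq> W" .
    then have "W \<subseteq> g ` W" using GL_D(7)[OF g] by (metis image_subset_iff imageI subsetI)
    then show "g ` W = W" using bounded_move_stabilizes[OF W g DJ] by blast
  }
  assume gW: "g ` W = W"
  have igW: "inv g ` W = W" using gW GL_D(6)[OF g] by (metis image_inv_f_f GL_D(4)[OF g])
  obtain C1 where C1: "\<And>k. 0 \<le> k \<Longrightarrow> pi_scale C1 (g ` ?J k) \<subseteq> ?J k" using stabilizer_moves_boundedly[OF W g gW] by blast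
  obtain C2 where C2: "\<And>k. 0 \<le> k \<Longrightarrow> pi_scale C2 (inv g ` ?J k) \<subseteq> ?J k"
    using stabilizer_moves_boundedly[OF W GL_inv[OF g] igW] by blast
  define C where "C = max C1 C2"
  obtain B where B: "B \<ge> 0" "\<And>L N a. full_lattice UNIV L \<Longrightarrow> full_lattice UNIV N \<Longrightarrow> scale (\<pi> powi a) ` L \<subseteq> N \<Longrightarrow>
    scale (\<pi> powi a) ` N \<subseteq> L \<Longrightarrow> d (class_vertex L) (class_vertex N) \<le> B * real_of_int a"
    using dist_classes_le by blast
  have close: "d (class_vertex (?J k)) (class_vertex (g ` ?J k)) \<le> B * real_of_int C" if k: "0 \<le> k" for k
  proof (rule B(2)[OF J full_lattice_GL_image_UNIV[OF g J]])
    have subJ: "submodule (?J k)" "submodule (g ` ?J k)" "submodule (inv g ` ?J k)"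
      using J full_lattice_GL_image_UNIV[OF g J] full_lattice_GL_image_UNIV[OF GL_inv[OF g] J] full_lattice_submodule by blast+
    have "pi_scale C (g ` ?J k) \<subseteq> pi_scale C1 (g ` ?J k)" by (rule pi_scale_subset[OF subJ(2)]) (simp add: C_def)
    then show "scale (\<pi> powi C) ` g ` ?J k \<subseteq> ?J k" using C1[OF k] unfolding pi_scale_def by blast
    have "pi_scale C (inv g ` ?J k) \<subseteq> pi_scale C2 (inv g ` ?J k)" by (rule pi_scale_subset[OF subJ(3)]) (simp add: C_def)
    then have "pi_scale C (inv g ` ?J k) \<subseteq> ?J k" using C2[OF k] by blast
    then have "g ` pi_scale C (inv g ` ?J k) \<subseteq> g ` ?J k" by (rule image_mono)
    moreover have "g ` inv g ` ?J k = ?J k" by (simp add: image_image GL_D[OF g])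
    ultimately show "scale (\<pi> powi C) ` ?J k \<subseteq> g ` ?J k" unfolding pi_scale_def GL_scale_image[OF g] by simp
  qed
  have "d (\<gamma> u) (act g (\<gamma> u)) \<le> B * real_of_int C + 2 * len" if u: "u \<ge> 0" for u
  proof -
    define k where "k = \<lfloor>u / len\<rfloor>"
    have "0 \<le> u / len" using u \<gamma>(2) by simp
    then have k: "0 \<le> k" by (simp add: k_def)
    have "real_of_int k \<le> u / len" "u / len \<le> real_of_int k + 1" unfolding k_def by linarith+
    then have near: "\<bar>u - len * real_of_int k\<bar> \<le> len" using \<gamma>(2) by (simp add: field_simps)
    let ?v = "\<gamma> (len * real_of_int k)"
    have "d (\<gamma> u) (act g (\<gamma> u)) \<le> d (\<gamma> u) ?v + d ?v (act g (\<gamma> u))" by (intro d_triangle pts)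
    moreover have "d ?v (act g (\<gamma> u)) \<le> d ?v (act g ?v) + d (act g ?v) (act g (\<gamma> u))" by (intro d_triangle pts)
    moreover have "d ?v (act g ?v) \<le> B * real_of_int C"
      unfolding at act_class_vertex[OF g] by (rule close[OF k])
    moreover have "d (act g ?v) (act g (\<gamma> u)) = \<bar>u - len * real_of_int k\<bar>" "d (\<gamma> u) ?v = \<bar>u - len * real_of_int k\<bar>"
      using dist_invariant[OF g pts(1) pts(1)] geodesicD(2)[OF \<gamma>(1)] by (simp_all add: abs_minus_commute)
    ultimately show ?thesis using near by linarith
  qed
  then show "\<exists>C. \<forall>t\<ge>0. d (\<gamma> t) (act g (\<gamma> t)) \<le> C" by blast
qed

text \<open>
  Exchanging the two lattices reverses the direction of the line, which reduces the backward end to the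
  forward end.
\<close>

lemma joining_lattice_swap: "pi_scale k (joining_lattice M M' (- k)) = joining_lattice M' M k"
proof (intro set_eqI iffI)
  fix x assume "x \<in> pi_scale k (joining_lattice M M' (- k))"
  then obtain m m' where "x = (\<pi> powi k) \<odot> (m + (\<pi> powi (- k)) \<odot> m')" "m \<in> M" "m' \<in> M'"
    unfolding joining_lattice_def pi_scale_def by blast
  moreover from this have "x = m' + (\<pi> powi k) \<odot> m"
    by (simp add: scale_right_distrib power_int_minus add.commute)
  ultimately show "x \<in> joining_lattice M' M k" unfolding joining_lattice_def by blast
next
  fix x assume "x \<in> joining_lattice M' M k"
  then obtain m m' where m: "x = m' + (\<pi> powi k) \<odot> m" "m \<in> M" "m' \<in> M'" unfolding joining_lattice_def by blast
  have "m + (\<pi> powi (- k)) \<odot> m' \<in> joining_lattice M M' (- k)" using m unfolding joining_lattice_def by blast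
  then have "(\<pi> powi k) \<odot> (m + (\<pi> powi (- k)) \<odot> m') \<in> pi_scale k (joining_lattice M M' (- k))" by (rule pi_scale_I)
  then show "x \<in> pi_scale k (joining_lattice M M' (- k))"
    unfolding m(1) by (simp add: scale_right_distrib power_int_minus add.commute)
qed

lemma joining_vertex_swap: "joining_vertex M M' (- k) = joining_vertex M' M k"
  unfolding joining_vertex_eq joining_lattice_swap[of k M M', symmetric] pi_scale_def
  by (rule lattice_class_scale[symmetric]) simp

text \<open>
  In a basis composed of bases of \<open>M\<close> and \<open>M'\<close>, the exponents of \<open>L\<^sub>k\<close> are \<open>\<alpha> + k \<iota>\<close>, where \<open>\<iota>\<close> is the
  indicator of the basis vectors in \<open>W'\<close>. It is not constant, because \<open>W\<close> and \<open>W'\<close> are nonzero, so \<open>L\<^sub>k\<close> moves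
  with speed \<open>len > 0\<close> along a line.
\<close>

lemma joining_geodesic_exists:
  assumes W: "complementary W W'" "full_lattice W M" "full_lattice W' M'" "W \<noteq> {0}" "W' \<noteq> {0}"
  obtains \<gamma> where "\<gamma> \<in> combinatorial_geodesics W W'" "vertices_of \<gamma> = range (joining_vertex M M')"
proof -
  obtain S1 a where S1: "finite S1" "independent S1" "span S1 = W" and a: "M = box S1 a"
    using lattice_has_basis[OF W(2)] by blast
  obtain S2 a' where S2: "finite S2" "independent S2" "span S2 = W'" and a': "M' = box S2 a'"
    using lattice_has_basis[OF W(3)] by blast
  note S = complementary_basis[OF W(1) S1 S2]
  obtain w where w: "is_basis w" "w ` {..<n} = S1 \<union> S2" "\<And>k. box (S1 \<union> S2) k = basis_lattice w (\<lambda>i. k (w i))"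
    using is_basis_from_set[OF S(2-4)] by blast
  define \<alpha> where "\<alpha> = (\<lambda>i. if w i \<in> S2 then a' (w i) else a (w i))"
  define \<iota> :: "nat \<Rightarrow> int" where "\<iota> = (\<lambda>i. if w i \<in> S2 then 1 else 0)"
  have J: "joining_lattice M M' k = basis_lattice w (\<lambda>i. \<alpha> i + k * \<iota> i)" for k
    unfolding a a' joining_lattice_box[OF S1(1) S2(1) S(1)] w(3)
    by (rule arg_cong[of _ _ "basis_lattice w"]) (auto simp: \<alpha>_def \<iota>_def)
  define v where "v = joining_vertex M M'"
  have v: "v k = lattice_class (basis_lattice w (\<lambda>i. \<alpha> i + k * \<iota> i))" for k
    unfolding v_def joining_vertex_eq J ..
  have "S1 \<noteq> {}" "S2 \<noteq> {}" using span_eq_0_empty W(4,5) S1(3) S2(3) by blast+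
  then obtain b1 b2 where b: "b1 \<in> S1" "b2 \<in> S2" by blast
  obtain i1 where i1: "i1 < n" "w i1 = b1" using b(1) w(2) by (metis UnI1 imageE lessThan_iff)
  obtain i2 where i2: "i2 < n" "w i2 = b2" using b(2) w(2) by (metis UnI2 imageE lessThan_iff)
  have \<iota>12: "\<iota> i1 = 0" "\<iota> i2 = 1" using i1 i2 b S(1) by (auto simp: \<iota>_def)
  have \<iota>01: "0 \<le> \<iota> i" "\<iota> i \<le> 1" for i by (auto simp: \<iota>_def)
  define len where "len = apartment_norm (\<lambda>i. real_of_int (\<iota> i))"
  have "len \<noteq> 0"
  proof
    assume "len = 0"
    then obtain c where "\<forall>i<n. real_of_int (\<iota> i) = c" unfolding len_def apartment_norm_eq_0_iff by blast
    then have "real_of_int (\<iota> i1) = real_of_int (\<iota> i2)" using i1(1) i2(1) by simp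
    then show False using \<iota>12 by simp
  qed
  then have len: "len > 0" using apartment_norm_nonneg[of "\<lambda>i. real_of_int (\<iota> i)"] unfolding len_def by linarith
  have edges: "edge (v k) (v (k + 1))" for k
    unfolding v
  proof (rule edge_classI)
    show "scale \<pi> ` basis_lattice w (\<lambda>i. \<alpha> i + k * \<iota> i) \<subseteq> basis_lattice w (\<lambda>i. \<alpha> i + (k + 1) * \<iota> i)"
      using scale_image_basis_lattice[OF w(1), of 1 "\<lambda>i. \<alpha> i + k * \<iota> i"] \<iota>01(2)
      by (simp add: basis_lattice_subset_iff[OF w(1)] algebra_simps)
    show "basis_lattice w (\<lambda>i. \<alpha> i + (k + 1) * \<iota> i) \<subseteq> basis_lattice w (\<lambda>i. \<alpha> i + k * \<iota> i)"
      unfolding basis_lattice_subset_iff[OF w(1)] using \<iota>01(1) by (simp add: algebra_simps)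
    show "lattice_class (basis_lattice w (\<lambda>i. \<alpha> i + k * \<iota> i)) \<noteq> lattice_class (basis_lattice w (\<lambda>i. \<alpha> i + (k + 1) * \<iota> i))"
    proof
      assume "lattice_class (basis_lattice w (\<lambda>i. \<alpha> i + k * \<iota> i)) = lattice_class (basis_lattice w (\<lambda>i. \<alpha> i + (k + 1) * \<iota> i))"
      then obtain j where "\<forall>i<n. \<alpha> i + k * \<iota> i = \<alpha> i + (k + 1) * \<iota> i + j"
        unfolding class_basis_lattice_eq_iff[OF w(1)] by blast
      then have "\<iota> i1 + j = 0" "\<iota> i2 + j = 0" using i1(1) i2(1) by (auto simp: algebra_simps)
      then show False using \<iota>12 by simp
    qed
  qed (rule full_lattice_basis_lattice[OF w(1)])+
  define \<gamma> where "\<gamma> = (\<lambda>u. edge_point (v \<lfloor>u / len\<rfloor>) (v (\<lfloor>u / len\<rfloor> + 1)) (frac (u / len)))"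
  have geo: "geodesic \<gamma>" unfolding geodesic_def
  proof (intro conjI allI)
    show "\<gamma> t \<in> points" for t unfolding \<gamma>_def
      by (rule edge_point_in_points[OF edges]) (simp_all add: frac_lt_1 less_imp_le)
    fix s t
    let ?k = "\<lfloor>s / len\<rfloor>" and ?l = "\<lfloor>t / len\<rfloor>"
    have coord: "(1 - frac x) * real_of_int (\<alpha> i + \<lfloor>x\<rfloor> * \<iota> i) + frac x * real_of_int (\<alpha> i + (\<lfloor>x\<rfloor> + 1) * \<iota> i) =
        real_of_int (\<alpha> i) + x * real_of_int (\<iota> i)" for x i
      unfolding frac_def by (simp add: algebra_simps)
    have "d (\<gamma> s) (\<gamma> t) = apartment_norm (\<lambda>i. ((1 - frac (s / len)) * real_of_int (\<alpha> i + ?k * \<iota> i) + frac (s / len) * real_of_int (\<alpha> i + (?k + 1) * \<iota> i))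
        - ((1 - frac (t / len)) * real_of_int (\<alpha> i + ?l * \<iota> i) + frac (t / len) * real_of_int (\<alpha> i + (?l + 1) * \<iota> i)))"
      unfolding \<gamma>_def
      by (rule dist_edge_points[OF w(1) edges edges]) (simp_all only: frac_ge_0 frac_lt_1 less_imp_le v)
    also have "\<dots> = apartment_norm (\<lambda>i. (s / len - t / len) * real_of_int (\<iota> i))"
      unfolding coord by (simp add: algebra_simps)
    also have "\<dots> = \<bar>s / len - t / len\<bar> * len" unfolding apartment_norm_scale len_def ..
    also have "\<dots> = \<bar>s - t\<bar>" using len by (simp add: abs_divide flip: diff_divide_distrib)
    finally show "d (\<gamma> s) (\<gamma> t) = \<bar>s - t\<bar>" .
  qed
  have pieces: "traverses_edge \<gamma> (v k) (v (k + 1)) (len * real_of_int k) (len * real_of_int (k + 1))" for k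
    unfolding traverses_edge_def
  proof (intro conjI allI impI)
    show "edge (v k) (v (k + 1))" by (rule edges)
    show "len * real_of_int k < len * real_of_int (k + 1)" using len by simp
    fix s :: real assume s: "0 \<le> s" "s \<le> 1"
    have u: "(len * real_of_int k + s * (len * real_of_int (k + 1) - len * real_of_int k)) / len = real_of_int k + s"
      using len by (simp add: field_simps)
    show "\<gamma> (len * real_of_int k + s * (len * real_of_int (k + 1) - len * real_of_int k)) = edge_point (v k) (v (k + 1)) s"
    proof (cases "s = 1")
      case True
      have "\<lfloor>real_of_int k + s\<rfloor> = k + 1" "frac (real_of_int k + s) = 0" unfolding True frac_def by simp_all
      then show ?thesis unfolding \<gamma>_def u using True by simp
    next
      case False
      then have "\<lfloor>real_of_int k + s\<rfloor> = k" using s by (simp add: floor_unique)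
      moreover from this have "frac (real_of_int k + s) = s" unfolding frac_def by simp
      ultimately show ?thesis unfolding \<gamma>_def u by simp
    qed
  qed
  have cover: "\<exists>k. len * real_of_int k \<le> u \<and> u \<le> len * real_of_int (k + 1)" for u
  proof -
    have "real_of_int \<lfloor>u / len\<rfloor> \<le> u / len" "u / len \<le> real_of_int (\<lfloor>u / len\<rfloor> + 1)" by linarith+
    then have "len * real_of_int \<lfloor>u / len\<rfloor> \<le> len * (u / len)" "len * (u / len) \<le> len * real_of_int (\<lfloor>u / len\<rfloor> + 1)"
      using len by (intro mult_left_mono; simp)+
    moreover have "len * (u / len) = u" using len by simp
    ultimately show ?thesis by metis
  qed
  note ran = range_of_edges[OF geo pieces cover]
  have "combinatorial \<gamma>" unfolding combinatorial_def
  proof (intro exI conjI)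
    show "range (\<lambda>k. {v k, v (k + 1)}) \<subseteq> {\<sigma> \<in> simplices. card \<sigma> = 2}"
    proof
      fix \<sigma> assume "\<sigma> \<in> range (\<lambda>k. {v k, v (k + 1)})"
      then obtain k where "\<sigma> = {v k, v (k + 1)}" by (rule imageE)
      then show "\<sigma> \<in> {\<sigma> \<in> simplices. card \<sigma> = 2}" using edges[of k] by (simp add: edge_def)
    qed
    show "range \<gamma> = (\<Union>\<sigma>\<in>range (\<lambda>k. {v k, v (k + 1)}). closed_simplex \<sigma>)" using ran(1) by simp
  qed
  moreover have "connects \<gamma> W W'"
  proof -
    have "boundary_vertex W (endpoint \<gamma>)"
      by (rule joining_geodesic_endpoint[OF W(1-3) geo len]) (use traverses_edgeD(4)[OF pieces] v_def in auto)
    moreover have "boundary_vertex W' (endpoint (\<lambda>t. \<gamma> (- t)))"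
    proof (rule joining_geodesic_endpoint[OF _ W(3,2) geodesic_reverse[OF geo] len])
      show "complementary W' W" using W(1) complementary_commute by blast
      show "\<gamma> (- (len * real_of_int k)) = vertex_point (joining_vertex M' M k)" for k
        using traverses_edgeD(4)[OF pieces[of "- k"]] unfolding v_def joining_vertex_swap by simp
    qed
    ultimately show ?thesis unfolding connects_def by blast
  qed
  ultimately have "\<gamma> \<in> combinatorial_geodesics W W'" unfolding combinatorial_geodesics_def using geo by blast
  then show ?thesis using that ran(2) unfolding v_def by blast
qed

section \<open>Lattice pairs and geodesics\<close>

lemma component_of_joining_lattice:
  assumes "complementary W W'" "full_lattice W M" "full_lattice W' M'"
  shows "W \<inter> joining_lattice M M' k = M" "W' \<inter> joining_lattice M M' k = pi_scale k M'"
proof -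
  have MW: "M \<subseteq> W" "M' \<subseteq> W'" using assms full_lattice_subset by blast+
  have sW: "subspace W" "subspace W'" using assms(1) by (simp_all add: complementary_def)
  have 0: "0 \<in> W" "0 \<in> W'" using sW subspace_0 by blast+
  have in': "(\<pi> powi k) \<odot> m' \<in> W'" if "m' \<in> M'" for m' using that MW sW by (auto intro: subspace_scale)
  show "W \<inter> joining_lattice M M' k = M"
  proof (intro set_eqI iffI)
    fix x assume x: "x \<in> W \<inter> joining_lattice M M' k"
    then obtain m m' where m: "x = m + (\<pi> powi k) \<odot> m'" "m \<in> M" "m' \<in> M'" unfolding joining_lattice_def by blast
    have "x = m" by (rule complementary_unique(1)[OF assms(1) _ _ 0(2) in'[OF m(3)]]) (use x m MW in auto)
    then show "x \<in> M" using m(2) by simp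
  qed (use MW joining_lattice_mem(1)[OF assms(2,3)] in blast)
  show "W' \<inter> joining_lattice M M' k = pi_scale k M'"
  proof (intro set_eqI iffI)
    fix x assume x: "x \<in> W' \<inter> joining_lattice M M' k"
    then obtain m m' where m: "x = m + (\<pi> powi k) \<odot> m'" "m \<in> M" "m' \<in> M'" unfolding joining_lattice_def by blast
    have "x = (\<pi> powi k) \<odot> m'" by (rule complementary_unique(2)[OF assms(1) 0(1) _ _ in'[OF m(3)], of m]) (use x m MW in auto)
    then show "x \<in> pi_scale k M'" using pi_scale_I[OF m(3)] by simp
  next
    fix x assume "x \<in> pi_scale k M'"
    then obtain m' where "x = (\<pi> powi k) \<odot> m'" "m' \<in> M'" by (rule pi_scale_E)
    then show "x \<in> W' \<inter> joining_lattice M M' k" using in' joining_lattice_mem(2)[OF assms(2,3)] by simp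
  qed
qed

lemma scale_image_Int_subspace:
  assumes "subspace W" "c \<noteq> 0"
  shows "W \<inter> scale c ` L = scale c ` (W \<inter> L)"
proof (intro set_eqI iffI)
  fix x assume "x \<in> W \<inter> scale c ` L"
  then show "x \<in> scale c ` (W \<inter> L)" unfolding Int_iff mem_scale_image[OF assms(2)]
    using subspace_scale[OF assms(1)] by blast
next
  fix x assume "x \<in> scale c ` (W \<inter> L)"
  then show "x \<in> W \<inter> scale c ` L" using subspace_scale[OF assms(1)] by auto
qed

text \<open>
  The lattices are recovered from any representative by intersecting it with \<open>W\<close> and \<open>W'\<close>.
\<close>

lemma joining_vertices_determine_classes:
  assumes W: "complementary W W'" and M: "full_lattice W M" "full_lattice W' M'" and N: "full_lattice W N" "full_lattice W' N'"
    and eq: "joining_vertex N N' 0 \<in> range (joining_vertex M M')"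
  shows "lattice_class N = lattice_class M" "lattice_class N' = lattice_class M'"
proof -
  obtain k where "lattice_class (joining_lattice N N' 0) = lattice_class (joining_lattice M M' k)"
    using eq unfolding joining_vertex_eq by blast
  then have "joining_lattice N N' 0 \<in> lattice_class (joining_lattice M M' k)"
    using self_mem_lattice_class by blast
  then obtain c where c: "joining_lattice N N' 0 = scale c ` joining_lattice M M' k" "c \<noteq> 0"
    unfolding lattice_class_def by blast
  have sW: "subspace W" "subspace W'" using W by (simp_all add: complementary_def)
  have "N = W \<inter> joining_lattice N N' 0" using component_of_joining_lattice(1)[OF W N] by simp
  also have "\<dots> = scale c ` M"
    unfolding c(1) scale_image_Int_subspace[OF sW(1) c(2)] component_of_joining_lattice(1)[OF W M] ..
  finally show "lattice_class N = lattice_class M" using lattice_class_scale[OF c(2)] by simp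
  have "N' = W' \<inter> joining_lattice N N' 0" using component_of_joining_lattice(2)[OF W N, of 0] by simp
  also have "\<dots> = scale c ` pi_scale k M'"
    unfolding c(1) scale_image_Int_subspace[OF sW(2) c(2)] component_of_joining_lattice(2)[OF W M] ..
  finally show "lattice_class N' = lattice_class M'"
    using lattice_class_scale[OF c(2)] lattice_class_scale[of "\<pi> powi k" M'] by (simp add: pi_scale_def)
qed

lemma joining_vertex_shift:
  assumes M: "full_lattice W M" "full_lattice W' M'"
    and eq: "lattice_class N = lattice_class M" "lattice_class N' = lattice_class M'"
  obtains j where "\<And>k. joining_vertex N N' k = joining_vertex M M' (k + j)"
proof -
  obtain a where a: "N = pi_scale a M" using eq(1) lattice_class_eq_iff[OF full_lattice_submodule[OF M(1)]] unfolding pi_scale_def by blast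
  obtain b where b: "N' = pi_scale b M'" using eq(2) lattice_class_eq_iff[OF full_lattice_submodule[OF M(2)]] unfolding pi_scale_def by blast
  have "joining_lattice N N' k = pi_scale a (joining_lattice M M' (k + (b - a)))" for k
  proof (intro set_eqI iffI)
    fix x assume "x \<in> joining_lattice N N' k"
    then obtain m m' where m: "x = (\<pi> powi a) \<odot> m + (\<pi> powi k) \<odot> ((\<pi> powi b) \<odot> m')" "m \<in> M" "m' \<in> M'"
      unfolding joining_lattice_def a b pi_scale_def by blast
    have "x = (\<pi> powi a) \<odot> (m + (\<pi> powi (k + (b - a))) \<odot> m')"
      unfolding m(1) by (simp add: scale_right_distrib flip: power_int_add)
    then show "x \<in> pi_scale a (joining_lattice M M' (k + (b - a)))"
      unfolding joining_lattice_def pi_scale_def using m(2,3) by blast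
  next
    fix x assume "x \<in> pi_scale a (joining_lattice M M' (k + (b - a)))"
    then obtain m m' where m: "x = (\<pi> powi a) \<odot> (m + (\<pi> powi (k + (b - a))) \<odot> m')" "m \<in> M" "m' \<in> M'"
      unfolding joining_lattice_def pi_scale_def by blast
    have "x = (\<pi> powi a) \<odot> m + (\<pi> powi k) \<odot> ((\<pi> powi b) \<odot> m')"
      unfolding m(1) by (simp add: scale_right_distrib flip: power_int_add)
    then show "x \<in> joining_lattice N N' k" unfolding joining_lattice_def a b pi_scale_def using m(2,3) by blast
  qed
  then have "joining_vertex N N' k = joining_vertex M M' (k + (b - a))" for k
    unfolding joining_vertex_eq pi_scale_def using lattice_class_scale by simp
  then show ?thesis using that by blast
qed

definition joining_line :: "'v set \<Rightarrow> 'v set \<Rightarrow> ('v set set \<Rightarrow> real) set" where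
  "joining_line M M' = (\<Union>k. closed_simplex {joining_vertex M M' k, joining_vertex M M' (k + 1)})"

lemma range_int_shift: "range (\<lambda>k::int. f (k + j)) = range f"
proof -
  have "f k \<in> range (\<lambda>k. f (k + j))" for k using rangeI[of "\<lambda>k. f (k + j)" "k - j"] by simp
  then show ?thesis by blast
qed

lemma joining_shift:
  assumes "\<And>k. joining_vertex N N' k = joining_vertex M M' (k + j)"
  shows "range (joining_vertex N N') = range (joining_vertex M M')" "joining_line N N' = joining_line M M'"
proof -
  have eq: "joining_vertex N N' = (\<lambda>k. joining_vertex M M' (k + j))" using assms by blast
  show "range (joining_vertex N N') = range (joining_vertex M M')" unfolding eq by (rule range_int_shift)
  define f where "f = (\<lambda>k. closed_simplex {joining_vertex M M' k, joining_vertex M M' (k + 1)})"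
  have "closed_simplex {joining_vertex N N' k, joining_vertex N N' (k + 1)} = f (k + j)" for k
    unfolding eq f_def by (simp add: algebra_simps)
  then have "joining_line N N' = \<Union> (range (\<lambda>k. f (k + j)))" unfolding joining_line_def by simp
  also have "\<dots> = \<Union> (range f)" by (simp only: range_int_shift)
  also have "\<dots> = joining_line M M'" by (simp only: joining_line_def f_def)
  finally show "joining_line N N' = joining_line M M'" .
qed

lemma combinatorial_geodesic_is_joining:
  assumes W: "complementary W W'" and \<gamma>: "\<gamma> \<in> combinatorial_geodesics W W'"
  obtains M M' where "full_lattice W M" "full_lattice W' M'" "vertices_of \<gamma> = range (joining_vertex M M')" "range \<gamma> = joining_line M M'"
proof -
  have g: "geodesic \<gamma>" "combinatorial \<gamma>" "connects \<gamma> W W'" using \<gamma> by (simp_all add: combinatorial_geodesics_def)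
  have oriented: "\<exists>M M'. full_lattice W M \<and> full_lattice W' M' \<and> vertices_of \<delta> = range (joining_vertex M M') \<and> range \<delta> = joining_line M M'"
    if \<delta>: "geodesic \<delta>" "combinatorial \<delta>" "boundary_vertex W (endpoint \<delta>)" "boundary_vertex W' (endpoint (\<lambda>t. \<delta> (- t)))" for \<delta>
  proof -
    obtain M M' t where M: "full_lattice W M" "full_lattice W' M'"
      and P: "\<And>k. traverses_edge \<delta> (joining_vertex M M' k) (joining_vertex M M' (k + 1)) (t k) (t (k + 1))"
      and cover: "\<And>u. \<exists>k. t k \<le> u \<and> u \<le> t (k + 1)"
      by (rule oriented_structure[OF W \<delta>]) (rule that)
    show ?thesis using M range_of_edges[OF \<delta>(1), of "joining_vertex M M'" t, OF P cover]
      unfolding joining_line_def by blast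
  qed
  have "\<exists>M M'. full_lattice W M \<and> full_lattice W' M' \<and> vertices_of \<gamma> = range (joining_vertex M M') \<and> range \<gamma> = joining_line M M'"
  proof (cases "boundary_vertex W (endpoint \<gamma>) \<and> boundary_vertex W' (endpoint (\<lambda>t. \<gamma> (- t)))")
    case True
    then show ?thesis using oriented[OF g(1,2)] by blast
  next
    case False
    then have ends: "boundary_vertex W (endpoint (\<lambda>t. \<gamma> (- t)))" "boundary_vertex W' (endpoint \<gamma>)"
      using g(3) unfolding connects_def by blast+
    let ?\<delta> = "\<lambda>t. \<gamma> (- t)"
    have "combinatorial ?\<delta>" using combinatorial_cong[OF range_reverse] g(2) by blast
    moreover have "boundary_vertex W' (endpoint (\<lambda>t. ?\<delta> (- t)))" using ends(2) by simp
    ultimately have "\<exists>M M'. full_lattice W M \<and> full_lattice W' M' \<and> vertices_of ?\<delta> = range (joining_vertex M M') \<and> range ?\<delta> = joining_line M M'"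
      using oriented[OF geodesic_reverse[OF g(1)] _ ends(1)] by blast
    moreover have "vertices_of ?\<delta> = vertices_of \<gamma>" unfolding vertices_of_def range_reverse ..
    ultimately show ?thesis unfolding range_reverse by simp
  qed
  then show ?thesis using that by blast
qed

text \<open>
  The geodesic comes from some pair of lattices, whose classes are those of the given pair.
\<close>

lemma same_vertices_same_range:
  assumes W: "complementary W W'" and \<gamma>: "\<gamma> \<in> combinatorial_geodesics W W'"
    and M: "full_lattice W M" "full_lattice W' M'" and eq: "vertices_of \<gamma> = range (joining_vertex M M')"
  shows "range \<gamma> = joining_line M M'"
proof -
  obtain N N' where N: "full_lattice W N" "full_lattice W' N'" "vertices_of \<gamma> = range (joining_vertex N N')" "range \<gamma> = joining_line N N'"
    using combinatorial_geodesic_is_joining[OF W \<gamma>] by blast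
  have "joining_vertex N N' 0 \<in> range (joining_vertex M M')" using N(3) eq by auto
  from joining_vertices_determine_classes[OF W M N(1,2) this]
  obtain j where "\<And>k. joining_vertex N N' k = joining_vertex M M' (k + j)"
    using joining_vertex_shift[OF M] by blast
  then have "joining_line N N' = joining_line M M'" by (rule joining_shift(2))
  then show ?thesis using N(4) by simp
qed

lemma same_range_reparametrization:
  assumes \<gamma>: "geodesic \<gamma>" "geodesic \<gamma>'" and ran: "range \<gamma> = range \<gamma>'"
  shows "(\<gamma>, \<gamma>') \<in> reparametrization"
proof -
  have "\<forall>t. \<exists>s. \<gamma> s = \<gamma>' t" using ran by (metis imageE rangeI)
  then obtain \<phi> where \<phi>: "\<And>t. \<gamma> (\<phi> t) = \<gamma>' t" by metis
  have "\<bar>\<phi> s - \<phi> t\<bar> = \<bar>s - t\<bar>" for s t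
    using geodesicD(2)[OF \<gamma>(1), of "\<phi> s" "\<phi> t"] geodesicD(2)[OF \<gamma>(2), of s t] unfolding \<phi> by simp
  moreover have "\<gamma>' = \<gamma> \<circ> \<phi>" using \<phi> by (simp add: fun_eq_iff)
  ultimately show ?thesis unfolding reparametrization_def by blast
qed

lemma line_isometry_cases:
  fixes \<phi> :: "real \<Rightarrow> real"
  assumes "\<And>s t. \<bar>\<phi> s - \<phi> t\<bar> = \<bar>s - t\<bar>"
  shows "(\<forall>t. \<phi> t = \<phi> 0 + t) \<or> (\<forall>t. \<phi> t = \<phi> 0 - t)"
proof -
  have "\<phi> 1 = \<phi> 0 + 1 \<or> \<phi> 1 = \<phi> 0 - 1" using assms[of 1 0] by (simp add: abs_if split: if_splits)
  then show ?thesis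
  proof
    assume 1: "\<phi> 1 = \<phi> 0 + 1"
    have "\<phi> t = \<phi> 0 + t" for t using assms[of t 0] assms[of t 1] 1 by (simp add: abs_if split: if_splits)
    then show ?thesis by blast
  next
    assume 1: "\<phi> 1 = \<phi> 0 - 1"
    have "\<phi> t = \<phi> 0 - t" for t using assms[of t 0] assms[of t 1] 1 by (simp add: abs_if split: if_splits)
    then show ?thesis by blast
  qed
qed

lemma endpoint_eqI:
  assumes "half_geodesic \<rho>" "half_geodesic \<rho>'" "\<And>t. 0 \<le> t \<Longrightarrow> d (\<rho> t) (\<rho>' t) \<le> C"
  shows "endpoint \<rho> = endpoint \<rho>'"
proof -
  have "endpoint \<rho> \<subseteq> endpoint \<rho>'"
    if \<rho>: "half_geodesic \<rho>" "half_geodesic \<rho>'" "\<And>t. 0 \<le> t \<Longrightarrow> d (\<rho> t) (\<rho>' t) \<le> C" for \<rho> \<rho>'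
  proof
    fix \<sigma> assume "\<sigma> \<in> endpoint \<rho>"
    then obtain D where \<sigma>: "half_geodesic \<sigma>" "\<And>t. t \<ge> 0 \<Longrightarrow> d (\<rho> t) (\<sigma> t) \<le> D" unfolding mem_endpoint_iff by blast
    have "d (\<rho>' t) (\<sigma> t) \<le> C + D" if t: "t \<ge> 0" for t
    proof -
      have "d (\<rho>' t) (\<sigma> t) \<le> d (\<rho>' t) (\<rho> t) + d (\<rho> t) (\<sigma> t)"
        by (intro d_triangle half_geodesicD(1) \<rho> \<sigma> t)
      then show ?thesis using \<rho>(3)[OF t] \<sigma>(2)[OF t] by (simp add: d_commute)
    qed
    then show "\<sigma> \<in> endpoint \<rho>'" unfolding mem_endpoint_iff using \<rho>(2) \<sigma>(1) by blast
  qed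
  from this[OF assms] this[OF assms(2,1)] assms(3) show ?thesis by (simp add: d_commute subset_antisym)
qed

lemma endpoint_shift:
  assumes "geodesic \<gamma>"
  shows "endpoint (\<lambda>t. \<gamma> (c + t)) = endpoint \<gamma>"
proof (rule endpoint_eqI)
  show "half_geodesic (\<lambda>t. \<gamma> (c + t))" by (rule geodesic_half, rule geodesic_isometry[OF assms]) simp
  show "half_geodesic \<gamma>" by (rule geodesic_half[OF assms])
  show "d (\<gamma> (c + t)) (\<gamma> t) \<le> \<bar>c\<bar>" for t using geodesicD(2)[OF assms] by simp
qed

text \<open>
  An isometry of the real line is a translation, possibly after a reflection. Translations do not change
  the ends and a reflection exchanges them, while connecting \<open>W\<close> and \<open>W'\<close> is symmetric in the ends.
\<close>

lemma reparametrization_preserves: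
  assumes \<gamma>: "\<gamma> \<in> combinatorial_geodesics W W'" and rep: "(\<gamma>, \<gamma>') \<in> reparametrization"
  shows "\<gamma>' \<in> combinatorial_geodesics W W'" "vertices_of \<gamma>' = vertices_of \<gamma>"
proof -
  have g: "geodesic \<gamma>" "combinatorial \<gamma>" "connects \<gamma> W W'" using \<gamma> by (simp_all add: combinatorial_geodesics_def)
  obtain \<phi> :: "real \<Rightarrow> real" where \<phi>: "\<And>s t. \<bar>\<phi> s - \<phi> t\<bar> = \<bar>s - t\<bar>" "\<gamma>' = \<gamma> \<circ> \<phi>"
    using rep unfolding reparametrization_def by blast
  have \<gamma>': "\<gamma>' = (\<lambda>t. \<gamma> (\<phi> t))" using \<phi>(2) by (simp add: comp_def)
  have geo: "geodesic \<gamma>'" unfolding \<gamma>' by (rule geodesic_isometry[OF g(1) \<phi>(1)])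
  have cases: "(\<forall>t. \<phi> t = \<phi> 0 + t) \<or> (\<forall>t. \<phi> t = \<phi> 0 - t)" by (rule line_isometry_cases[OF \<phi>(1)])
  then have "\<exists>t. \<phi> t = u" for u by (metis add_diff_cancel_left' diff_add_cancel diff_diff_eq2 add.commute)
  then have "\<gamma> u \<in> range \<gamma>'" for u unfolding \<gamma>' by (metis rangeI)
  then have ran: "range \<gamma>' = range \<gamma>" unfolding \<gamma>' by blast
  then show "vertices_of \<gamma>' = vertices_of \<gamma>" unfolding vertices_of_def by simp
  have rev: "endpoint (\<lambda>t. \<gamma> (c - t)) = endpoint (\<lambda>t. \<gamma> (- t))" for c
    using endpoint_shift[OF geodesic_reverse[OF g(1)], of "- c"] by simp
  have "connects \<gamma>' W W'"
    using cases
  proof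
    assume "\<forall>t. \<phi> t = \<phi> 0 + t"
    then have "\<gamma>' = (\<lambda>t. \<gamma> (\<phi> 0 + t))" "(\<lambda>t. \<gamma>' (- t)) = (\<lambda>t. \<gamma> (\<phi> 0 - t))" unfolding \<gamma>' by (metis, metis add_uminus_conv_diff)
    then have "endpoint \<gamma>' = endpoint \<gamma>" "endpoint (\<lambda>t. \<gamma>' (- t)) = endpoint (\<lambda>t. \<gamma> (- t))"
      using endpoint_shift[OF g(1)] rev by simp_all
    then show ?thesis using g(3) unfolding connects_def by simp
  next
    assume "\<forall>t. \<phi> t = \<phi> 0 - t"
    then have "\<gamma>' = (\<lambda>t. \<gamma> (\<phi> 0 - t))" "(\<lambda>t. \<gamma>' (- t)) = (\<lambda>t. \<gamma> (\<phi> 0 + t))" unfolding \<gamma>' by (metis, metis diff_minus_eq_add)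
    then have ends: "endpoint \<gamma>' = endpoint (\<lambda>t. \<gamma> (- t))" "endpoint (\<lambda>t. \<gamma>' (- t)) = endpoint \<gamma>"
      using endpoint_shift[OF g(1)] rev by simp_all
    show ?thesis using g(3) unfolding connects_def ends by (elim disjE) simp_all
  qed
  then show "\<gamma>' \<in> combinatorial_geodesics W W'"
    using geo g(2) combinatorial_cong[OF ran] by (simp add: combinatorial_geodesics_def)
qed

text \<open>
  The bijection of the theorem, written without choosing representatives of the classes; any
  representatives may be used by \<open>joining_geodesics_eq\<close>.
\<close>

definition joining_geodesics :: "'v set \<Rightarrow> 'v set \<Rightarrow> 'v set set \<times> 'v set set \<Rightarrow> (real \<Rightarrow> 'v set set \<Rightarrow> real) set" where
  "joining_geodesics W W' c = {\<gamma> \<in> combinatorial_geodesics W W'. \<exists>M M'. full_lattice W M \<and> full_lattice W' M' \<and>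
     c = (lattice_class M, lattice_class M') \<and> vertices_of \<gamma> = range (joining_vertex M M')}"

lemma joining_geodesics_eq:
  assumes "full_lattice W M" "full_lattice W' M'"
  shows "joining_geodesics W W' (lattice_class M, lattice_class M') =
    {\<gamma> \<in> combinatorial_geodesics W W'. vertices_of \<gamma> = range (joining_vertex M M')}"
proof (intro set_eqI iffI)
  fix \<gamma> assume "\<gamma> \<in> joining_geodesics W W' (lattice_class M, lattice_class M')"
  then obtain N N' where N: "\<gamma> \<in> combinatorial_geodesics W W'" "lattice_class N = lattice_class M"
    "lattice_class N' = lattice_class M'" "vertices_of \<gamma> = range (joining_vertex N N')"
    unfolding joining_geodesics_def by auto
  obtain j where "\<And>k. joining_vertex N N' k = joining_vertex M M' (k + j)"
    using joining_vertex_shift[OF assms N(2,3)] by blast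
  then have "range (joining_vertex N N') = range (joining_vertex M M')" by (rule joining_shift(1))
  then show "\<gamma> \<in> {\<gamma> \<in> combinatorial_geodesics W W'. vertices_of \<gamma> = range (joining_vertex M M')}" using N by simp
next
  fix \<gamma> assume "\<gamma> \<in> {\<gamma> \<in> combinatorial_geodesics W W'. vertices_of \<gamma> = range (joining_vertex M M')}"
  then show "\<gamma> \<in> joining_geodesics W W' (lattice_class M, lattice_class M')"
    unfolding joining_geodesics_def using assms by blast
qed

lemma reparametrization_class:
  assumes W: "complementary W W'" and \<gamma>: "\<gamma> \<in> combinatorial_geodesics W W'"
    and M: "full_lattice W M" "full_lattice W' M'" and eq: "vertices_of \<gamma> = range (joining_vertex M M')"
  shows "reparametrization `` {\<gamma>} = joining_geodesics W W' (lattice_class M, lattice_class M')"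
  unfolding joining_geodesics_eq[OF M]
proof (intro set_eqI iffI)
  fix \<gamma>' assume "\<gamma>' \<in> reparametrization `` {\<gamma>}"
  then have "(\<gamma>, \<gamma>') \<in> reparametrization" by blast
  then show "\<gamma>' \<in> {\<gamma> \<in> combinatorial_geodesics W W'. vertices_of \<gamma> = range (joining_vertex M M')}"
    using reparametrization_preserves[OF \<gamma>] eq by simp
next
  fix \<gamma>' assume "\<gamma>' \<in> {\<gamma> \<in> combinatorial_geodesics W W'. vertices_of \<gamma> = range (joining_vertex M M')}"
  then have \<gamma>': "\<gamma>' \<in> combinatorial_geodesics W W'" "vertices_of \<gamma>' = range (joining_vertex M M')" by simp_all
  have "range \<gamma> = range \<gamma>'" using same_vertices_same_range[OF W \<gamma> M eq] same_vertices_same_range[OF W \<gamma>'(1) M \<gamma>'(2)] by simp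
  then have "(\<gamma>, \<gamma>') \<in> reparametrization"
    using same_range_reparametrization \<gamma> \<gamma>'(1) by (simp add: combinatorial_geodesics_def)
  then show "\<gamma>' \<in> reparametrization `` {\<gamma>}" by blast
qed

lemma joining_geodesics_bij:
  assumes W: "complementary W W'" "W \<noteq> {0}" "W' \<noteq> {0}"
  shows "bij_betw (joining_geodesics W W') (lattice_classes_in W \<times> lattice_classes_in W')
    (combinatorial_geodesics W W' // reparametrization)"
proof -
  have cls: "x \<in> lattice_classes_in U \<longleftrightarrow> (\<exists>L. full_lattice U L \<and> x = lattice_class L)" for x U
    by (auto simp: lattice_classes_in_def lattice_in_iff_lat)
  have ex: "\<exists>\<gamma>\<in>combinatorial_geodesics W W'. vertices_of \<gamma> = range (joining_vertex M M')" if "full_lattice W M" "full_lattice W' M'" for M M'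
    using joining_geodesic_exists[OF W(1) that W(2,3)] by blast
  show ?thesis unfolding bij_betw_def
  proof
    show "inj_on (joining_geodesics W W') (lattice_classes_in W \<times> lattice_classes_in W')"
    proof (rule inj_onI)
      fix c e assume c: "c \<in> lattice_classes_in W \<times> lattice_classes_in W'" and e: "e \<in> lattice_classes_in W \<times> lattice_classes_in W'"
        and eq: "joining_geodesics W W' c = joining_geodesics W W' e"
      obtain M M' where M: "full_lattice W M" "full_lattice W' M'" "c = (lattice_class M, lattice_class M')"
        using c cls by (metis mem_Times_iff prod.collapse)
      obtain N N' where N: "full_lattice W N" "full_lattice W' N'" "e = (lattice_class N, lattice_class N')"
        using e cls by (metis mem_Times_iff prod.collapse)
      obtain \<gamma> where \<gamma>: "\<gamma> \<in> combinatorial_geodesics W W'" "vertices_of \<gamma> = range (joining_vertex M M')"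
        using ex[OF M(1,2)] by blast
      have "\<gamma> \<in> joining_geodesics W W' e"
        using \<gamma> unfolding eq[symmetric] M(3) joining_geodesics_eq[OF M(1,2)] by blast
      then have "vertices_of \<gamma> = range (joining_vertex N N')" unfolding N(3) joining_geodesics_eq[OF N(1,2)] by blast
      then have "joining_vertex M M' 0 \<in> range (joining_vertex N N')" using \<gamma>(2) by auto
      from joining_vertices_determine_classes[OF W(1) N(1,2) M(1,2) this]
      show "c = e" unfolding M(3) N(3) by simp
    qed
    show "joining_geodesics W W' ` (lattice_classes_in W \<times> lattice_classes_in W') =
        combinatorial_geodesics W W' // reparametrization"
    proof (intro subset_antisym subsetI)
      fix X assume "X \<in> joining_geodesics W W' ` (lattice_classes_in W \<times> lattice_classes_in W')"
      then obtain c where c: "c \<in> lattice_classes_in W \<times> lattice_classes_in W'" "X = joining_geodesics W W' c" by blast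
      obtain M M' where M: "full_lattice W M" "full_lattice W' M'" "c = (lattice_class M, lattice_class M')"
        using c(1) cls by (metis mem_Times_iff prod.collapse)
      obtain \<gamma> where \<gamma>: "\<gamma> \<in> combinatorial_geodesics W W'" "vertices_of \<gamma> = range (joining_vertex M M')"
        using ex[OF M(1,2)] by blast
      have "X = reparametrization `` {\<gamma>}" unfolding c(2) M(3) reparametrization_class[OF W(1) \<gamma>(1) M(1,2) \<gamma>(2)] ..
      then show "X \<in> combinatorial_geodesics W W' // reparametrization" using quotientI[OF \<gamma>(1)] by simp
    next
      fix X assume "X \<in> combinatorial_geodesics W W' // reparametrization"
      then obtain \<gamma> where \<gamma>: "\<gamma> \<in> combinatorial_geodesics W W'" "X = reparametrization `` {\<gamma>}" by (rule quotientE)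
      obtain M M' where M: "full_lattice W M" "full_lattice W' M'" "vertices_of \<gamma> = range (joining_vertex M M')"
        by (rule combinatorial_geodesic_is_joining[OF W(1) \<gamma>(1)]) (rule that)
      have "X = joining_geodesics W W' (lattice_class M, lattice_class M')"
        unfolding \<gamma>(2) by (rule reparametrization_class[OF W(1) \<gamma>(1) M])
      moreover have "(lattice_class M, lattice_class M') \<in> lattice_classes_in W \<times> lattice_classes_in W'"
        using M(1,2) cls by blast
      ultimately show "X \<in> joining_geodesics W W' ` (lattice_classes_in W \<times> lattice_classes_in W')" by blast
    qed
  qed
qed

lemma joining_geodesics_correspondence:
  assumes "subspace W" "subspace W'" "W \<noteq> {0}" "W' \<noteq> {0}" "W \<inter> W' = {0}" "{x + y | x y. x \<in> W \<and> y \<in> W'} = UNIV"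
  shows "(\<forall>M M'. lattice_in W M \<and> lattice_in W' M' \<longrightarrow>
      (\<exists>\<gamma> \<in> combinatorial_geodesics W W'. vertices_of \<gamma> = range (joining_vertex M M') \<and>
        (\<forall>\<gamma>' \<in> combinatorial_geodesics W W'. vertices_of \<gamma>' = range (joining_vertex M M') \<longrightarrow>
          (\<gamma>, \<gamma>') \<in> reparametrization))) \<and>
    (\<exists>\<Phi>. bij_betw \<Phi> (lattice_classes_in W \<times> lattice_classes_in W') (combinatorial_geodesics W W' // reparametrization) \<and>
      (\<forall>M M'. lattice_in W M \<and> lattice_in W' M' \<longrightarrow> \<Phi> (lattice_class M, lattice_class M') =
        {\<gamma> \<in> combinatorial_geodesics W W'. vertices_of \<gamma> = range (joining_vertex M M')}))"
proof (intro conjI exI[of _ "joining_geodesics W W'"] allI impI)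
  have "\<forall>x. \<exists>y\<in>W. \<exists>z\<in>W'. x = y + z" using assms(6) by blast
  then have W: "complementary W W'" using assms by (simp add: complementary_def)
  show "bij_betw (joining_geodesics W W') (lattice_classes_in W \<times> lattice_classes_in W')
      (combinatorial_geodesics W W' // reparametrization)"
    by (rule joining_geodesics_bij[OF W assms(3,4)])
  fix M M' assume "lattice_in W M \<and> lattice_in W' M'"
  then have M: "full_lattice W M" "full_lattice W' M'" by (simp_all add: lattice_in_iff_lat)
  show "joining_geodesics W W' (lattice_class M, lattice_class M') =
      {\<gamma> \<in> combinatorial_geodesics W W'. vertices_of \<gamma> = range (joining_vertex M M')}"
    by (rule joining_geodesics_eq[OF M])
  obtain \<gamma> where \<gamma>: "\<gamma> \<in> combinatorial_geodesics W W'" "vertices_of \<gamma> = range (joining_vertex M M')"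
    using joining_geodesic_exists[OF W M assms(3,4)] by blast
  have "\<forall>\<gamma>' \<in> combinatorial_geodesics W W'. vertices_of \<gamma>' = range (joining_vertex M M') \<longrightarrow> (\<gamma>, \<gamma>') \<in> reparametrization"
    using reparametrization_class[OF W \<gamma>(1) M \<gamma>(2)] unfolding joining_geodesics_eq[OF M] by blast
  then show "\<exists>\<gamma> \<in> combinatorial_geodesics W W'. vertices_of \<gamma> = range (joining_vertex M M') \<and>
      (\<forall>\<gamma>' \<in> combinatorial_geodesics W W'. vertices_of \<gamma>' = range (joining_vertex M M') \<longrightarrow> (\<gamma>, \<gamma>') \<in> reparametrization)"
    using \<gamma> by blast
qed

end

theorem proposition2p4:
  fixes p :: nat and nv :: "'k::field_char_0 \<Rightarrow> real"
    and scale :: "'k \<Rightarrow> 'v::ab_group_add \<Rightarrow> 'v" and \<pi> :: 'k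
    and ip :: "(nat \<Rightarrow> real) \<Rightarrow> (nat \<Rightarrow> real) \<Rightarrow> real"
    and d :: "('v set set \<Rightarrow> real) \<Rightarrow> ('v set set \<Rightarrow> real) \<Rightarrow> real"
    and W W' :: "'v set"
  assumes "bruhat_tits_building p nv scale \<pi> ip d"
    and "module.subspace scale W" and "module.subspace scale W'"
    and "W \<noteq> {0}" and "W' \<noteq> {0}"
    and "W \<inter> W' = {0}" and "{x + y | x y. x \<in> W \<and> y \<in> W'} = UNIV"
  shows "(\<forall>M M'. padic_vector_space.lattice_in nv scale W M \<and>
                 padic_vector_space.lattice_in nv scale W' M' \<longrightarrow>
            (\<exists>\<gamma> \<in> bruhat_tits_building.combinatorial_geodesics nv scale \<pi> d W W'.
               bruhat_tits_building.vertices_of nv scale \<gamma> =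
                 range (bruhat_tits_building.joining_vertex scale \<pi> M M') \<and>
               (\<forall>\<gamma>' \<in> bruhat_tits_building.combinatorial_geodesics nv scale \<pi> d W W'.
                  bruhat_tits_building.vertices_of nv scale \<gamma>' =
                    range (bruhat_tits_building.joining_vertex scale \<pi> M M') \<longrightarrow>
                  (\<gamma>, \<gamma>') \<in> bruhat_tits_building.reparametrization))) \<and>
         (\<exists>\<Phi>. bij_betw \<Phi>
                (padic_vector_space.lattice_classes_in nv scale W \<times>
                 padic_vector_space.lattice_classes_in nv scale W')
                (bruhat_tits_building.combinatorial_geodesics nv scale \<pi> d W W' //
                 bruhat_tits_building.reparametrization) \<and>
              (\<forall>M M'. padic_vector_space.lattice_in nv scale W M \<and>
                      padic_vector_space.lattice_in nv scale W' M' \<longrightarrow>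
                 \<Phi> (padic_vector_space.lattice_class scale M,
                    padic_vector_space.lattice_class scale M') =
                 {\<gamma> \<in> bruhat_tits_building.combinatorial_geodesics nv scale \<pi> d W W'.
                    bruhat_tits_building.vertices_of nv scale \<gamma> =
                      range (bruhat_tits_building.joining_vertex scale \<pi> M M')}))"
  by (rule bruhat_tits_building.joining_geodesics_correspondence[OF assms])

end
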